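(* Let $d\ge2$, $\nu=\tfrac d2-1$ and $\rho>0$. Then there exist constants $\mathbf S_d(\rho)>0$ such that for all $f\in L^2(\mathbb S^{d-1})$, \[ \mathbf{S}_d(\rho)\, \mathrm{d}(f,\mathcal M_d(\rho))^2\le \delta_d(f;\rho)\le \mathbf{C}_d(\rho)\, \mathrm{d}(f,\mathcal M_d(\rho))^2, \] where both multiplicative constants are optimal (i.e. $\mathbf S_d(\rho)$ is the largest and $\mathbf C_d(\rho)$ the smallest constant for which the respective inequality holds for all $f$). Equality in the right-hand inequality holds only if $f\in\mathcal M_d(\rho)$. Equality in the left-hand inequality holds if and only if $f\in\mathcal M_d(\rho)\oplus\mathcal E_d(\rho)$, where $\mathbf S_d(\rho)$ and $\mathcal E_d(\rho)$ are as follows. (i) If $(J_\nu J_{\nu+1})(\rho)>0$: if $(J_{\nu+1}J_{\nu+2})(\rho)>0$ then $\mathbf S_d(\rho)=\Lambda_{0,d}(\rho)-\Lambda_{1,d}(\rho)$ and $\mathcal E_d(\rho)=\mathcal H_1$; if $(J_{\nu+1}J_{\nu+2})(\rho)<0$ then $\mathbf S_d(\rho)=\Lambda_{0,d}(\rho)-\Lambda_{2,d}(\rho)$ and $\mathcal E_d(\rho)=\mathcal H_2$; if $(J_{\nu+1}J_{\nu+2})(\rho)=0$ then $\mathbf S_d(\rho)=\Lambda_{0,d}(\rho)-\Lambda_{1,d}(\rho)=\Lambda_{0,d}(\rho)-\Lambda_{2,d}(\rho)$ and $\mathcal E_d(\rho)=\mathcal H_1\oplus\mathcal H_2\oplus\mathcal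 H_3$. (ii) If $(J_\nu J_{\nu+1})(\rho)<0$, let $\mathfrak J_\nu=J_\nu J_{\nu+1}+J_{\nu+1}J_{\nu+2}+J_{\nu+2}J_{\nu+3}$: if $\mathfrak J_\nu(\rho)>0$ then $\mathbf S_d(\rho)=\Lambda_{1,d}(\rho)-\Lambda_{0,d}(\rho)$ and $\mathcal E_d(\rho)=\mathcal H_0$; if $\mathfrak J_\nu(\rho)<0$ then $\mathbf S_d(\rho)=\Lambda_{1,d}(\rho)-\Lambda_{3,d}(\rho)$ and $\mathcal E_d(\rho)=\mathcal H_3$; if $\mathfrak J_\nu(\rho)=0$ then $\mathbf S_d(\rho)=\Lambda_{1,d}(\rho)-\Lambda_{0,d}(\rho)=\Lambda_{1,d}(\rho)-\Lambda_{3,d}(\rho)$ and $\mathcal E_d(\rho)=\mathcal H_0\oplus\mathcal H_3$. (iii) If $J_\nu(\rho)=0$: if $(J_{\nu+2}J_{\nu+3})(\rho)>0$ then $\mathbf S_d(\rho)=\Lambda_{0,d}(\rho)-\Lambda_{2,d}(\rho)$ and $\mathcal E_d(\rho)=\mathcal H_2$; if $(J_{\nu+2}J_{\nu+3})(\rho)<0$ then $\mathbf S_d(\rho)=\Lambda_{0,d}(\rho)-\Lambda_{3,d}(\rho)$ and $\mathcal E_d(\rho)=\mathcal H_3$. (iv) If $J_{\nu+1}(\rho)=0$: if $(J_{\nu+3}J_{\nu+4})(\rho)>0$ then $\mathbf S_d(\rho)=\Lambda_{0,d}(\rho)-\Lambda_{3,d}(\rho)$ and $\mathcal E_d(\rho)=\mathcal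 H_3$; if $(J_{\nu+3}J_{\nu+4})(\rho)<0$ then $\mathbf S_d(\rho)=\Lambda_{0,d}(\rho)-\Lambda_{4,d}(\rho)$ and $\mathcal E_d(\rho)=\mathcal H_4$.
   Context: $\mathbb S^{d-1}\subset\mathbb R^d$ is the unit sphere with surface measure $\sigma$; $B_\rho$ is the ball of radius $\rho$ centred at $0$; $\widehat{f\sigma}(\xi)=\int_{\mathbb S^{d-1}} f(\omega)e^{-i\omega\cdot\xi}\,\mathrm{d}\sigma(\omega)$. $J_\alpha$ is the Bessel function of the first kind of order $\alpha$ (with $J_{-1}=-J_1$), and $(J_\alpha J_\beta)(\rho)=J_\alpha(\rho)J_\beta(\rho)$. For $k\in\mathbb N_{\ge0}$, $\Lambda_{k,d}(\rho):=\frac\rho2 J_{\nu+k}^2(\rho)-\frac\rho2 J_{\nu+k-1}(\rho)J_{\nu+k+1}(\rho)$. $\mathcal H_k$ is the space of spherical harmonics of degree $k$ on $\mathbb S^{d-1}$ (with $0$). $\mathbf C_d(\rho):=\sup_{0\ne f\in L^2(\mathbb S^{d-1})}\frac{\rho^{-1}\int_{B_\rho}|\widehat{f\sigma}(x)|^2\,\mathrm{d}x/(2\pi)^d}{\|f\|_{L^2(\mathbb S^{d-1})}^2}$, which equals $\Lambda_{0,d}(\rho)$ if $(J_\nu J_{\nu+1})(\rho)\ge0$ and $\Lambda_{1,d}(\rho)$ if $(J_\nu J_{\nu+1})(\rho)\le0$. The space of maximisers $\mathcal M_d(\rho)$ is: $\mathcal H_0$ if $(J_\nu J_{\nu+1})(\rho)>0$;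 $\mathcal H_1$ if $(J_\nu J_{\nu+1})(\rho)<0$; $\mathcal H_0\oplus\mathcal H_1$ if $J_\nu(\rho)=0$; $\mathcal H_0\oplus\mathcal H_1\oplus\mathcal H_2$ if $J_{\nu+1}(\rho)=0$. The deficit is $\delta_d(f;\rho):=\mathbf C_d(\rho)\|f\|_{L^2(\mathbb S^{d-1})}^2-\frac1\rho\int_{B_\rho}|\widehat{f\sigma}(x)|^2\frac{\mathrm{d}x}{(2\pi)^d}$, and $\mathrm{d}(f,\mathcal M_d(\rho))=\inf\{\|f-m\|_{L^2(\mathbb S^{d-1})}: m\in\mathcal M_d(\rho)\}$. *)

theory Defs
  imports "HOL-Analysis.Analysis"
begin

text \<open>Power series definition J_a(x) = sum_m (-1)^m / (m! Gamma(m+a+1)) (x/2)^(2m+a),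
  written with the reciprocal Gamma function so that it is also correct at negative
  integer orders (in particular J_{-1} = -J_1). Only used for x > 0.\<close>
definition bessel_J :: "real \<Rightarrow> real \<Rightarrow> real" where
  "bessel_J a x = (\<Sum>m. (-1) ^ m * rGamma (real m + a + 1) / fact m * (x / 2) powr (2 * real m + a))"

definition bessel_nu :: "nat \<Rightarrow> real" where
  "bessel_nu d = real d / 2 - 1"

definition Jn :: "nat \<Rightarrow> real \<Rightarrow> real \<Rightarrow> real" where
  "Jn d k \<rho> = bessel_J (bessel_nu d + k) \<rho>"

definition Lambda :: "nat \<Rightarrow> nat \<Rightarrow> real \<Rightarrow> real" where
  "Lambda d k \<rho> = \<rho> / 2 * (bessel_J (bessel_nu d + real k) \<rho>)\<^sup>2
      - \<rho> / 2 * bessel_J (bessel_nu d + real k - 1) \<rho> * bessel_J (bessel_nu d + real k + 1) \<rho>"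

definition sphere_measure :: "'a::euclidean_space measure" where
  "sphere_measure = measure_of (sphere 0 1) (sets (restrict_space lborel (sphere (0::'a) 1)))
     (\<lambda>A. of_nat DIM('a) * emeasure lborel {t *\<^sub>R x | t x. t \<in> {0<..1} \<and> x \<in> A})"

definition L2S :: "('a::euclidean_space \<Rightarrow> complex) \<Rightarrow> bool" where
  "L2S f \<longleftrightarrow> f \<in> borel_measurable sphere_measure
      \<and> integrable sphere_measure (\<lambda>\<omega>. (cmod (f \<omega>))\<^sup>2)"

definition L2norm :: "('a::euclidean_space \<Rightarrow> complex) \<Rightarrow> real" where
  "L2norm f = sqrt (integral\<^sup>L sphere_measure (\<lambda>\<omega>. (cmod (f \<omega>))\<^sup>2))"

definition in_L2 :: "('a::euclidean_space \<Rightarrow> complex) \<Rightarrow> ('a \<Rightarrow> complex) set \<Rightarrow> bool" where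
  "in_L2 f V \<longleftrightarrow> (\<exists>m\<in>V. AE \<omega> in sphere_measure. f \<omega> = m \<omega>)"

definition L2dist :: "('a::euclidean_space \<Rightarrow> complex) \<Rightarrow> ('a \<Rightarrow> complex) set \<Rightarrow> real" where
  "L2dist f V = Inf {L2norm (\<lambda>\<omega>. f \<omega> - m \<omega>) | m. m \<in> V}"

definition dsum :: "('a \<Rightarrow> complex) set \<Rightarrow> ('a \<Rightarrow> complex) set \<Rightarrow> ('a \<Rightarrow> complex) set"
  (infixl "\<oplus>\<^sub>S" 65) where
  "V \<oplus>\<^sub>S W = {(\<lambda>x. v x + w x) | v w. v \<in> V \<and> w \<in> W}"

definition hom_poly :: "nat \<Rightarrow> ('a::euclidean_space \<Rightarrow> complex) \<Rightarrow> bool" where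
  "hom_poly k P \<longleftrightarrow> (\<exists>c :: ('a \<Rightarrow> nat) \<Rightarrow> complex. \<forall>x. P x =
     (\<Sum>\<alpha>\<in>{\<alpha>. (\<forall>b. b \<notin> Basis \<longrightarrow> \<alpha> b = 0) \<and> (\<Sum>b\<in>Basis. \<alpha> b) = k}.
        c \<alpha> * (\<Prod>b\<in>Basis. complex_of_real (x \<bullet> b) ^ \<alpha> b)))"

definition partial2 :: "('a::euclidean_space \<Rightarrow> complex) \<Rightarrow> 'a \<Rightarrow> 'a \<Rightarrow> complex" where
  "partial2 P b x = vector_derivative
      (\<lambda>t. vector_derivative (\<lambda>s. P (x + s *\<^sub>R b)) (at t)) (at 0)"

definition harmonic :: "('a::euclidean_space \<Rightarrow> complex) \<Rightarrow> bool" where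
  "harmonic P \<longleftrightarrow> (\<forall>x. (\<Sum>b\<in>Basis. partial2 P b x) = 0)"

definition SH :: "nat \<Rightarrow> ('a::euclidean_space \<Rightarrow> complex) set" where
  "SH k = {f. \<exists>P. hom_poly k P \<and> harmonic P \<and> (\<forall>x\<in>sphere 0 1. f x = P x)}"

definition fourier_ext :: "('a::euclidean_space \<Rightarrow> complex) \<Rightarrow> 'a \<Rightarrow> complex" where
  "fourier_ext f \<xi> = integral\<^sup>L sphere_measure (\<lambda>\<omega>. f \<omega> * exp (- \<i> * complex_of_real (\<omega> \<bullet> \<xi>)))"

definition energy :: "('a::euclidean_space \<Rightarrow> complex) \<Rightarrow> real \<Rightarrow> real" where
  "energy f \<rho> = (1 / \<rho>) * (set_lebesgue_integral lborel (ball 0 \<rho>)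
      (\<lambda>x. (cmod (fourier_ext f x))\<^sup>2) / (2 * pi) ^ DIM('a))"

definition Cd :: "real \<Rightarrow> 'a::euclidean_space itself \<Rightarrow> real" where
  "Cd \<rho> _ = Sup {energy f \<rho> / (L2norm f)\<^sup>2 | f :: 'a \<Rightarrow> complex. L2S f \<and> L2norm f \<noteq> 0}"

definition deficit :: "('a::euclidean_space \<Rightarrow> complex) \<Rightarrow> real \<Rightarrow> real" where
  "deficit f \<rho> = Cd \<rho> TYPE('a) * (L2norm f)\<^sup>2 - energy f \<rho>"

text \<open>Space of maximisers, as described in the paper (J_nu and J_{nu+1} have no common zero).\<close>
definition Md :: "real \<Rightarrow> ('a::euclidean_space \<Rightarrow> complex) set" where
  "Md \<rho> = (let d = DIM('a) in
     if Jn d 0 \<rho> * Jn d 1 \<rho> > 0 then SH 0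
     else if Jn d 0 \<rho> * Jn d 1 \<rho> < 0 then SH 1
     else if Jn d 0 \<rho> = 0 then SH 0 \<oplus>\<^sub>S SH 1
     else SH 0 \<oplus>\<^sub>S SH 1 \<oplus>\<^sub>S SH 2)"

end

theory Submission
  imports Defs
begin

text \<open>Every f in L2 of the sphere is the sum of its projections f_k to the spaces H_k of spherical
  harmonics, and by the Hecke-Bochner formula the quadratic form
  rho^{-1} (2 pi)^{-d} int_{B_rho} |fhat|^2 is diagonal in this decomposition, with value
  Lambda_k(rho) |f_k|^2 on H_k. Hence the deficit is sum_k (C - Lambda_k) |f_k|^2, the squared
  distance to a sum of spaces H_k is the sum of the remaining |f_k|^2, and the theorem becomes the
  determination of the largest and second largest values of the sequence Lambda_k.
  These follow from Lambda_k - Lambda_{k+1} = J_{nu+k} J_{nu+k+1} and the resulting identity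
  Lambda_k - Lambda_{k+2} = 2 (nu+k+1)/rho J_{nu+k+1}^2, which makes the even and the odd
  subsequence decreasing. Telescoping the second identity also gives Lambda_k \<longrightarrow> 0, so that no
  asymptotics of Bessel functions are needed.\<close>

text \<open>All analysis on the sphere rests on one identity,
  \<open>sphere_integration_by_parts\<close>. Used with a harmonic factor it gives an expression
  symmetric in two polynomials, hence orthogonality of different degrees; used with powers of x . xi
  it gives the recursion behind the Hecke-Bochner formula. Working with homogeneous polynomials
  keeps derivatives, products and polar coordinates algebraic. Lambda_k appears as the value on H_k
  because it is Lommel's integral of J_{nu+k}^2. The same integral gives Lambda_k > 0, which has two
  uses: J_{nu+k} and J_{nu+k+1} have no common zero, and C - Lambda_k < C, so that equality on the
  right forces f to be a maximiser. The limit Lambda_k -> 0 makes C optimal on the right, since the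
  ratios C - Lambda_k on H_k approach C. The obstacle in the case distinction is that only steps of
  two are monotone: finitely many indices near the maximum are ordered by hand, and zeros of
  neighbouring Bessel functions are excluded by the three-term recurrence to keep the inequalities
  strict.\<close>

section \<open>Homogeneous polynomials and the Laplacian\<close>

text \<open>Chosen for its induction principle; \<open>hom_poly_iff_homog\<close> matches it with
  the coefficient form in \<open>hom_poly\<close>. Zero belongs to every degree, which makes
  truncated degrees such as \<open>n - 1\<close> and \<open>n - 2\<close> harmless below.\<close>

inductive homog :: "nat \<Rightarrow> ('a::euclidean_space \<Rightarrow> complex) \<Rightarrow> bool" where
  homog_const: "homog 0 (\<lambda>x. c)"
| homog_zero: "homog n (\<lambda>x. 0)"
| homog_add: "homog n P \<Longrightarrow> homog n Q \<Longrightarrow> homog n (\<lambda>x. P x + Q x)"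
| homog_coord_mult: "homog n P \<Longrightarrow> b \<in> Basis \<Longrightarrow> homog (Suc n) (\<lambda>x. complex_of_real (x \<bullet> b) * P x)"

lemma homog_cmult: "homog n P \<Longrightarrow> homog n (\<lambda>x. c * P x)"
proof (induction rule: homog.induct)
  case (homog_add n P Q)
  then show ?case using homog.homog_add by (simp add: distrib_left)
next
  case (homog_coord_mult n P b)
  then show ?case using homog.homog_coord_mult[of n "\<lambda>x. c * P x" b] by (simp add: mult_ac)
qed (auto intro: homog.intros)

lemma homog_diff: "homog n P \<Longrightarrow> homog n Q \<Longrightarrow> homog n (\<lambda>x. P x - Q x)"
  using homog_add[of n P "\<lambda>x. (-1) * Q x"] homog_cmult[of n Q "-1"] by simp

lemma homog_sum: "(\<And>i. i \<in> A \<Longrightarrow> homog n (P i)) \<Longrightarrow> homog n (\<lambda>x. \<Sum>i\<in>A. P i x)"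
  by (induction A rule: infinite_finite_induct) (auto intro: homog.intros)

lemma homog_inner: "homog (Suc 0) (\<lambda>x::'a::euclidean_space. complex_of_real (x \<bullet> v))"
proof -
  have "homog (Suc 0) (\<lambda>x::'a. \<Sum>b\<in>Basis. complex_of_real (v \<bullet> b) * (complex_of_real (x \<bullet> b) * 1))"
    by (intro homog_sum homog_cmult homog_coord_mult homog_const)
  also have "(\<lambda>x::'a. \<Sum>b\<in>Basis. complex_of_real (v \<bullet> b) * (complex_of_real (x \<bullet> b) * 1))
      = (\<lambda>x. complex_of_real (x \<bullet> v))"
    by (subst euclidean_inner) (simp add: mult.commute)
  finally show ?thesis .
qed

lemma homog_mult: "homog m P \<Longrightarrow> homog n Q \<Longrightarrow> homog (m + n) (\<lambda>x. P x * Q x)"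
proof (induction rule: homog.induct)
  case (homog_add n P Q)
  then show ?case using homog.homog_add by (simp add: distrib_right)
next
  case (homog_coord_mult n P b)
  then show ?case using homog.homog_coord_mult by (simp add: mult.assoc)
qed (auto intro: homog.intros homog_cmult)

lemma homog_inner_mult:
  "homog n P \<Longrightarrow> homog (Suc n) (\<lambda>x. complex_of_real (x \<bullet> v) * P x)"
  using homog_mult[OF homog_inner, of n P v] by simp

lemma homog_power: "homog m P \<Longrightarrow> homog (k * m) (\<lambda>x. P x ^ k)"
  by (induction k) (auto intro: homog.intros homog_mult)

lemma homog_prod:
  "(\<And>i. i \<in> A \<Longrightarrow> homog (n i) (P i)) \<Longrightarrow> homog (\<Sum>i\<in>A. n i) (\<lambda>x. \<Prod>i\<in>A. P i x)"
  by (induction A rule: infinite_finite_induct) (auto intro: homog.intros homog_mult)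

lemma homog_cnj: "homog n P \<Longrightarrow> homog n (\<lambda>x. cnj (P x))"
  by (induction rule: homog.induct) (auto intro: homog.intros)

lemma homog_scaleR: "homog n P \<Longrightarrow> P (r *\<^sub>R x) = complex_of_real r ^ n * P x"
  by (induction rule: homog.induct) (auto simp: algebra_simps)

lemma continuous_on_homog: "homog n P \<Longrightarrow> continuous_on A P"
  by (induction rule: homog.induct) (auto intro!: continuous_intros)

text \<open>\<open>vector_derivative\<close> is a choice operator, total even where no derivative
  exists; the rules below take differentiability from \<open>homog\<close>.\<close>

definition ddir :: "'a::euclidean_space \<Rightarrow> ('a \<Rightarrow> complex) \<Rightarrow> 'a \<Rightarrow> complex" where
  "ddir v P x = vector_derivative (\<lambda>t. P (x + t *\<^sub>R v)) (at 0)"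

text \<open>The clause for \<open>n = 0\<close> strengthens the induction: in the coordinate step
  with \<open>n = 0\<close> the coordinate times \<open>P'\<close> must again have degree 0, which
  holds because \<open>P'\<close> vanishes.\<close>

lemma homog_deriv_exists:
  "homog n P \<Longrightarrow> \<exists>P'. homog (n - 1) P' \<and> (n = 0 \<longrightarrow> P' = (\<lambda>x. 0)) \<and>
     (\<forall>x. ((\<lambda>t. P (x + t *\<^sub>R v)) has_vector_derivative P' x) (at 0))"
proof (induction rule: homog.induct)
  case (homog_add n P Q)
  then obtain P' Q' where "homog (n - 1) P'" "homog (n - 1) Q'" "n = 0 \<longrightarrow> P' = (\<lambda>x. 0)" "n = 0 \<longrightarrow> Q' = (\<lambda>x. 0)"
    "\<And>x. ((\<lambda>t. P (x + t *\<^sub>R v)) has_vector_derivative P' x) (at 0)"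
    "\<And>x. ((\<lambda>t. Q (x + t *\<^sub>R v)) has_vector_derivative Q' x) (at 0)" by blast
  then show ?case
    by (intro exI[of _ "\<lambda>x. P' x + Q' x"]) (auto intro: homog.intros has_vector_derivative_add)
next
  case (homog_coord_mult n P b)
  then obtain P' where P': "homog (n - 1) P'" "n = 0 \<longrightarrow> P' = (\<lambda>x. 0)"
    "\<And>x. ((\<lambda>t. P (x + t *\<^sub>R v)) has_vector_derivative P' x) (at 0)" by blast
  have "homog n (\<lambda>x. complex_of_real (x \<bullet> b) * P' x)"
    using P' homog_coord_mult(2) by (cases n) (auto intro: homog.intros)
  then have "homog n (\<lambda>x. complex_of_real (v \<bullet> b) * P x + complex_of_real (x \<bullet> b) * P' x)"
    using homog_coord_mult by (intro homog_add homog_cmult)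
  moreover have "((\<lambda>t. complex_of_real ((x + t *\<^sub>R v) \<bullet> b) * P (x + t *\<^sub>R v))
     has_vector_derivative (complex_of_real (v \<bullet> b) * P x + complex_of_real (x \<bullet> b) * P' x)) (at 0)" for x
  proof -
    have "((\<lambda>t. complex_of_real ((x + t *\<^sub>R v) \<bullet> b)) has_vector_derivative complex_of_real (v \<bullet> b)) (at 0)"
      unfolding inner_add_left inner_scaleR_left
      by (rule has_vector_derivative_eq_rhs, rule has_vector_derivative_of_real)
         (auto intro!: derivative_eq_intros)
    from has_vector_derivative_mult[OF this P'(3)[of x]] show ?thesis by (simp add: add.commute)
  qed
  ultimately show ?case by auto
qed (auto intro: homog.intros)

lemma homog_has_ddir_0:
  "homog n P \<Longrightarrow> ((\<lambda>t. P (x + t *\<^sub>R v)) has_vector_derivative ddir v P x) (at 0)"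
  using homog_deriv_exists[of n P v] unfolding ddir_def
  by (metis vector_derivative_at)

lemma homog_has_ddir:
  assumes "homog n P"
  shows "((\<lambda>t. P (x + t *\<^sub>R v)) has_vector_derivative ddir v P (x + s *\<^sub>R v)) (at s)"
proof -
  have "((\<lambda>t. t - s) has_vector_derivative 1) (at s)"
    by (rule has_vector_derivative_eq_rhs, rule has_vector_derivative_diff) (auto intro!: derivative_eq_intros)
  from vector_diff_chain_at[OF this, of "\<lambda>t. P ((x + s *\<^sub>R v) + t *\<^sub>R v)" "ddir v P (x + s *\<^sub>R v)"]
    homog_has_ddir_0[OF assms, of "x + s *\<^sub>R v" v]
  show ?thesis by (simp add: o_def algebra_simps)
qed

lemma homog_ddir: "homog n P \<Longrightarrow> homog (n - 1) (ddir v P)"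
proof -
  assume P: "homog n P"
  obtain P' where P': "homog (n - 1) P'" "\<forall>x. ((\<lambda>t. P (x + t *\<^sub>R v)) has_vector_derivative P' x) (at 0)"
    using homog_deriv_exists[OF P] by blast
  then have "ddir v P = P'" unfolding ddir_def by (auto intro: vector_derivative_at)
  with P' show ?thesis by simp
qed

lemma ddir_homog_0: "homog 0 P \<Longrightarrow> ddir v P = (\<lambda>x. 0)"
  using homog_deriv_exists[of 0 P v] unfolding ddir_def by (auto intro: vector_derivative_at)

lemma homog_ddir': "homog (Suc n) P \<Longrightarrow> homog n (ddir v P)"
  using homog_ddir[of "Suc n"] by simp

lemma ddir_const [simp]: "ddir v (\<lambda>x. c) = (\<lambda>x. 0)"
  by (rule ddir_homog_0) (rule homog_const)

lemma ddir_add: "homog m P \<Longrightarrow> homog n Q \<Longrightarrow> ddir v (\<lambda>x. P x + Q x) = (\<lambda>x. ddir v P x + ddir v Q x)"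
  by (rule ext, subst ddir_def, rule vector_derivative_at) (intro has_vector_derivative_add homog_has_ddir_0)

lemma ddir_mult: "homog m P \<Longrightarrow> homog n Q \<Longrightarrow>
   ddir v (\<lambda>x. P x * Q x) = (\<lambda>x. P x * ddir v Q x + ddir v P x * Q x)"
  apply (rule ext, subst ddir_def, rule vector_derivative_at)
  subgoal for x
    using has_vector_derivative_mult[OF homog_has_ddir_0[of m P x v] homog_has_ddir_0[of n Q x v]] by simp
  done

lemma ddir_cmult: "homog n Q \<Longrightarrow> ddir v (\<lambda>x. c * Q x) = (\<lambda>x. c * ddir v Q x)"
  using ddir_mult[OF homog_const, of n Q v c] by simp

lemma ddir_diff: "homog m P \<Longrightarrow> homog n Q \<Longrightarrow> ddir v (\<lambda>x. P x - Q x) = (\<lambda>x. ddir v P x - ddir v Q x)"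
  by (rule ext, subst ddir_def, rule vector_derivative_at) (intro has_vector_derivative_diff homog_has_ddir_0)

lemma ddir_sum: "(\<And>i. i \<in> A \<Longrightarrow> homog n (P i)) \<Longrightarrow>
   ddir v (\<lambda>x. \<Sum>i\<in>A. P i x) = (\<lambda>x. \<Sum>i\<in>A. ddir v (P i) x)"
  by (rule ext, subst ddir_def, rule vector_derivative_at) (intro has_vector_derivative_sum homog_has_ddir_0)

lemma ddir_inner [simp]: "ddir v (\<lambda>x. complex_of_real (x \<bullet> w)) = (\<lambda>x. complex_of_real (v \<bullet> w))"
  apply (rule ext, subst ddir_def, rule vector_derivative_at)
  unfolding inner_add_left inner_scaleR_left
  by (rule has_vector_derivative_eq_rhs, rule has_vector_derivative_of_real)
         (auto intro!: derivative_eq_intros)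

lemma ddir_inner_mult: "homog n P \<Longrightarrow>
  ddir v (\<lambda>x. complex_of_real (x \<bullet> w) * P x) =
    (\<lambda>x. complex_of_real (x \<bullet> w) * ddir v P x + complex_of_real (v \<bullet> w) * P x)"
  by (subst ddir_mult[OF homog_inner]) auto

lemma ddir_cnj: "homog n P \<Longrightarrow> ddir v (\<lambda>x. cnj (P x)) = (\<lambda>x. cnj (ddir v P x))"
  by (rule ext, subst ddir_def, rule vector_derivative_at)
     (intro has_vector_derivative_cnj homog_has_ddir_0)

text \<open>In the coordinate step both orders of differentiation give one formula, symmetric in v
  and w by the induction hypothesis.\<close>

lemma ddir_commute: "homog n P \<Longrightarrow> ddir v (ddir w P) = ddir w (ddir v P)"
proof (induction rule: homog.induct)
  case (homog_add n P Q)
  then show ?case by (simp add: ddir_add[of n _ n] ddir_add[of "n - Suc 0" _ "n - Suc 0"] homog_ddir[simplified])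
next
  case (homog_coord_mult n P b)
  then have "ddir v (ddir w (\<lambda>x. complex_of_real (x \<bullet> b) * P x)) =
    (\<lambda>x. complex_of_real (x \<bullet> b) * ddir v (ddir w P) x + complex_of_real (v \<bullet> b) * ddir w P x
        + complex_of_real (w \<bullet> b) * ddir v P x)" for v w
    by (simp add: ddir_inner_mult ddir_add[OF homog_inner_mult[OF homog_ddir] homog_cmult]
        ddir_inner_mult[OF homog_ddir] ddir_cmult)
  with homog_coord_mult show ?case by (simp add: add_ac)
qed auto

lemma ddir_basis: "homog n P \<Longrightarrow> ddir v P x = (\<Sum>b\<in>Basis. complex_of_real (v \<bullet> b) * ddir b P x)"
proof (induction rule: homog.induct)
  case (homog_add n P Q)
  then show ?case by (simp add: ddir_add[of n _ n] sum.distrib distrib_left)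
next
  case (homog_coord_mult n P c)
  have "(\<Sum>b\<in>Basis. complex_of_real (v \<bullet> b) * complex_of_real (b \<bullet> c)) = complex_of_real (v \<bullet> c)"
    by (subst euclidean_inner[of v c]) (simp add: inner_commute)
  then have "(\<Sum>b\<in>Basis. complex_of_real (v \<bullet> b) * complex_of_real (b \<bullet> c) * P x) = complex_of_real (v \<bullet> c) * P x"
    by (metis sum_distrib_right)
  then show ?case using homog_coord_mult
    by (simp add: ddir_inner_mult sum.distrib distrib_left sum_distrib_left) (simp add: mult_ac)
qed auto

lemma euler_homog: "homog n P \<Longrightarrow> ddir x P x = of_nat n * P x"
proof (induction rule: homog.induct)
  case (homog_add n P Q)
  then show ?case by (simp add: ddir_add[of n _ n] distrib_left)
next
  case (homog_coord_mult n P b)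
  then show ?case by (simp add: ddir_inner_mult) (simp add: algebra_simps)
qed simp_all

section \<open>The Laplacian of homogeneous polynomials\<close>

definition lap :: "('a::euclidean_space \<Rightarrow> complex) \<Rightarrow> 'a \<Rightarrow> complex" where
  "lap P x = (\<Sum>b\<in>Basis. ddir b (ddir b P) x)"

lemma homog_lap: "homog n P \<Longrightarrow> homog (n - 2) (lap P)"
  unfolding lap_def[abs_def] using homog_ddir[OF homog_ddir]
  by (intro homog_sum) (simp add: numeral_2_eq_2)

lemma lap_homog_less_2: "homog n P \<Longrightarrow> n < 2 \<Longrightarrow> lap P = (\<lambda>x. 0)"
  unfolding lap_def[abs_def] using homog_ddir[of n P] by (auto simp: less_2_cases_iff ddir_homog_0)

lemma lap_add: "homog n P \<Longrightarrow> homog n Q \<Longrightarrow> lap (\<lambda>x. P x + Q x) = (\<lambda>x. lap P x + lap Q x)"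
  unfolding lap_def[abs_def]
  by (simp add: ddir_add[of n _ n] ddir_add[of "n - Suc 0" _ "n - Suc 0"] homog_ddir[simplified] sum.distrib)

lemma lap_diff: "homog n P \<Longrightarrow> homog n Q \<Longrightarrow> lap (\<lambda>x. P x - Q x) = (\<lambda>x. lap P x - lap Q x)"
  unfolding lap_def[abs_def]
  by (simp add: ddir_diff[of n _ n] ddir_diff[of "n - Suc 0" _ "n - Suc 0"] homog_ddir[simplified] sum_subtractf)

lemma lap_cmult: "homog n P \<Longrightarrow> lap (\<lambda>x. c * P x) = (\<lambda>x. c * lap P x)"
  unfolding lap_def[abs_def]
  by (simp add: ddir_cmult[of n] ddir_cmult[of "n - Suc 0"] homog_ddir[simplified] sum_distrib_left)

lemma lap_cnj: "homog n P \<Longrightarrow> lap (\<lambda>x. cnj (P x)) = (\<lambda>x. cnj (lap P x))"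
  unfolding lap_def[abs_def]
  by (simp add: ddir_cnj[of n] ddir_cnj[of "n - Suc 0"] homog_ddir[simplified])

lemma lap_ddir:
  assumes "homog n P"
  shows "lap (ddir v P) = ddir v (lap P)"
proof -
  have "ddir b (ddir b (ddir v P)) = ddir v (ddir b (ddir b P))" for b
    by (simp add: ddir_commute[OF assms, of b v] ddir_commute[OF homog_ddir[OF assms], of b v])
  then show ?thesis
    unfolding lap_def[abs_def]
    by (subst ddir_sum[OF homog_ddir[OF homog_ddir[OF assms]]]) auto
qed

lemma lap_mult:
  assumes "homog m P" "homog n Q"
  shows "lap (\<lambda>x. P x * Q x) x =
    P x * lap Q x + lap P x * Q x + 2 * (\<Sum>b\<in>Basis. ddir b P x * ddir b Q x)"
proof -
  have "ddir b (ddir b (\<lambda>x. P x * Q x)) x =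
     P x * ddir b (ddir b Q) x + ddir b (ddir b P) x * Q x + 2 * (ddir b P x * ddir b Q x)" for b
    by (simp only: ddir_mult[OF assms] ddir_mult[OF homog_ddir[OF assms(1)] assms(2)]
        ddir_mult[OF assms(1) homog_ddir[OF assms(2)]]
        ddir_add[OF homog_mult[OF assms(1) homog_ddir[OF assms(2)]] homog_mult[OF homog_ddir[OF assms(1)] assms(2)]])
       (simp add: algebra_simps)
  then show ?thesis unfolding lap_def
    by (simp add: sum.distrib sum_distrib_left sum_distrib_right)
qed

section \<open>Multiplication by |x|^2 and the Laplacian\<close>

definition normsq :: "'a::euclidean_space \<Rightarrow> complex" where
  "normsq x = complex_of_real ((norm x)\<^sup>2)"

lemma normsq_sum: "normsq = (\<lambda>x::'a::euclidean_space. \<Sum>b\<in>Basis. complex_of_real (x \<bullet> b) * complex_of_real (x \<bullet> b))"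
  by (rule ext) (simp add: normsq_def power2_norm_eq_inner, subst euclidean_inner, simp)

lemma homog_normsq: "homog 2 (normsq :: 'a::euclidean_space \<Rightarrow> complex)"
  unfolding normsq_sum numeral_2_eq_2 by (intro homog_sum homog_inner_mult homog_inner)

lemma ddir_normsq: "ddir v normsq x = 2 * complex_of_real (x \<bullet> v)"
proof -
  have "ddir v normsq x = (\<Sum>b\<in>Basis. 2 * (complex_of_real (x \<bullet> b) * complex_of_real (v \<bullet> b)))"
    unfolding normsq_sum
    by (subst ddir_sum[of _ "Suc (Suc 0)"])
       (auto intro!: homog_inner_mult homog_inner simp: ddir_inner_mult[OF homog_inner])
  also have "\<dots> = 2 * complex_of_real (x \<bullet> v)"
    by (subst euclidean_inner) (simp add: sum_distrib_left)
  finally show ?thesis .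
qed

lemma lap_normsq: "lap normsq (x::'a::euclidean_space) = 2 * of_nat DIM('a)"
proof -
  have "ddir b (ddir b normsq) x = 2" if "b \<in> Basis" for b :: 'a
    using that by (subst ddir_normsq[abs_def]) (simp add: ddir_cmult[OF homog_inner])
  then show ?thesis by (simp add: lap_def)
qed

text \<open>The Laplacian of |x|^2 is 2d, and the cross term of the product rule is 4 x . grad P,
  which Euler's identity turns into 4 n P.\<close>

lemma lap_normsq_mult:
  assumes "homog n (P :: 'a::euclidean_space \<Rightarrow> complex)"
  shows "lap (\<lambda>x. normsq x * P x) x = (2 * of_nat DIM('a) + 4 * of_nat n) * P x + normsq x * lap P x"
proof -
  have "(\<Sum>b\<in>Basis. ddir b normsq x * ddir b P x) = 2 * of_nat n * P x"
    using ddir_basis[OF assms, of x x]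
    by (simp add: ddir_normsq mult.assoc flip: sum_distrib_left euler_homog[OF assms])
  then show ?thesis
    unfolding lap_mult[OF homog_normsq assms] lap_normsq by (simp add: algebra_simps)
qed

lemma homog_normsq_power_mult: "homog m g \<Longrightarrow> homog (m + 2 * j) (\<lambda>x. normsq x ^ j * g x)"
  using homog_mult[OF homog_power[OF homog_normsq], of m g j] by (simp add: algebra_simps)

text \<open>The existential form records what \<open>lap_normsq_surj\<close> divides by: a positive
  number. Each further factor |x|^2 adds a positive amount by
  \<open>lap_normsq_mult\<close>.\<close>

lemma lap_normsq_power_mult:
  assumes "homog m (g :: 'a::euclidean_space \<Rightarrow> complex)"
  shows "\<exists>c>0. \<forall>x. lap (\<lambda>x. normsq x ^ Suc j * g x) x =
     complex_of_real c * (normsq x ^ j * g x) + normsq x ^ Suc j * lap g x"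
proof (induction j)
  case 0
  show ?case by (rule exI[of _ "real (2 * DIM('a) + 4 * m)"]) (auto simp: lap_normsq_mult[OF assms] intro!: add_pos_nonneg)
next
  case (Suc j)
  then obtain c where c: "c > 0" "\<And>x. lap (\<lambda>x. normsq x ^ Suc j * g x) x =
     complex_of_real c * (normsq x ^ j * g x) + normsq x ^ Suc j * lap g x" by blast
  have "lap (\<lambda>x. normsq x ^ Suc (Suc j) * g x) x =
     complex_of_real (2 * DIM('a) + 4 * (m + 2 * Suc j) + c) * (normsq x ^ Suc j * g x) + normsq x ^ Suc (Suc j) * lap g x" for x
    using lap_normsq_mult[OF homog_normsq_power_mult[OF assms, of "Suc j"], of x] unfolding c(2)
    by (simp add: mult.assoc) (simp add: algebra_simps)
  with c(1) show ?case
    by (intro exI[of _ "2 * DIM('a) + 4 * (m + 2 * Suc j) + c"]) auto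
qed

text \<open>Induction on m: lap (|x|^(2j+2) g) is a positive multiple of |x|^(2j) g plus |x|^(2j+2) lap g.\<close>
lemma lap_normsq_surj:
  "homog m (g :: 'a::euclidean_space \<Rightarrow> complex) \<Longrightarrow>
     \<exists>q. homog (m + 2 * j) q \<and> (\<forall>x. lap (\<lambda>x. normsq x * q x) x = normsq x ^ j * g x)"
proof (induction m arbitrary: g j rule: less_induct)
  case (less m)
  obtain c where c: "c > 0" "\<And>x. lap (\<lambda>x. normsq x ^ Suc j * g x) x =
     complex_of_real c * (normsq x ^ j * g x) + normsq x ^ Suc j * lap g x"
    using lap_normsq_power_mult[OF less.prems] by blast
  \<comment> \<open>Correction for the unwanted term |x|^(2j+2) lap g. Since \<open>lap g\<close>
    has degree m - 2 and carries one more factor |x|^2, the induction hypothesis is used with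
    \<open>Suc j\<close>; hence j is arbitrary in the induction.\<close>
  obtain q' where q': "homog (m + 2 * j) q'"
     "\<And>x. lap (\<lambda>x. normsq x * q' x) x = normsq x ^ Suc j * lap g x"
  proof (cases "m < 2")
    case True
    then show ?thesis
      by (intro that[of "\<lambda>x. 0"]) (simp_all add: homog_zero lap_homog_less_2[OF less.prems] lap_def)
  next
    case False
    then have "m - 2 < m" "m - 2 + 2 * Suc j = m + 2 * j" by auto
    then show ?thesis using less.IH[OF _ homog_lap[OF less.prems], of "Suc j"] that
      by metis
  qed
  define q where "q = (\<lambda>x. complex_of_real (1 / c) * (normsq x ^ j * g x - q' x))"
  have q: "homog (m + 2 * j) q" unfolding q_def
    by (intro homog_cmult homog_diff q'(1) homog_normsq_power_mult less.prems)
  have h: "homog (2 + (m + 2 * j)) (\<lambda>x. normsq x ^ Suc j * g x)"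
    using homog_normsq_power_mult[OF less.prems, of "Suc j"] by (simp add: algebra_simps)
  have h': "homog (2 + (m + 2 * j)) (\<lambda>x. normsq x * q' x)" by (intro homog_mult homog_normsq q')
  have eq: "(\<lambda>x. normsq x * q x) = (\<lambda>x. complex_of_real (1 / c) * (normsq x ^ Suc j * g x - normsq x * q' x))"
    by (auto simp: q_def algebra_simps)
  have "lap (\<lambda>x. normsq x * q x) x = normsq x ^ j * g x" for x
    unfolding eq lap_cmult[OF homog_diff[OF h h']] lap_diff[OF h h'] c(2) q'(2)
    using c(1) by simp
  with q show ?case by blast
qed

section \<open>Surface measure and polar coordinates\<close>

text \<open>The value at 0 is an arbitrary unit vector, so that the map maps into the sphere everywhere.\<close>
definition sproj :: "'a::euclidean_space \<Rightarrow> 'a" where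
  "sproj x = (if x = 0 then SOME b. b \<in> Basis else x /\<^sub>R norm x)"

lemma norm_sproj [simp]: "norm (sproj x) = 1"
  by (auto simp: sproj_def intro!: norm_Basis someI_ex[of "\<lambda>b. b \<in> Basis"])

lemma norm_scaleR_sproj [simp]: "norm x *\<^sub>R sproj x = x"
  by (auto simp: sproj_def)

lemma sproj_scaleR: "r > 0 \<Longrightarrow> sproj (r *\<^sub>R x) = sproj x"
  by (auto simp: sproj_def)

lemma sproj_sphere: "norm x = 1 \<Longrightarrow> sproj x = x"
  by (auto simp: sproj_def)

lemma measurable_sproj_borel [measurable]: "sproj \<in> borel_measurable borel"
  unfolding sproj_def[abs_def] by (rule measurable_If) auto

lemma measurable_sproj: "sproj \<in> borel \<rightarrow>\<^sub>M restrict_space borel (sphere 0 1)"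
  by (rule measurable_restrict_space2) auto

text \<open>The cone in \<open>sphere_measure\<close> has t > 0 and so omits the origin, which the
  preimage under \<open>sproj\<close> may contain because \<open>sproj 0\<close> is a unit
  vector.\<close>

lemma cone_eq:
  fixes A :: "'a::euclidean_space set"
  assumes "A \<subseteq> sphere 0 1"
  shows "{t *\<^sub>R x | t x. t \<in> {0<..1} \<and> x \<in> A} = (cball 0 1 \<inter> sproj -` A) - {0}" (is "?L = ?R")
proof (intro equalityI subsetI)
  fix y assume "y \<in> ?L"
  then show "y \<in> ?R" using assms by (auto simp: sproj_scaleR sproj_sphere subset_iff)
next
  fix y assume y: "y \<in> ?R"
  then have "y = norm y *\<^sub>R sproj y" "norm y \<in> {0<..1}" "sproj y \<in> A" by auto
  then show "y \<in> ?L" by blast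
qed

lemma emeasure_distr_sproj:
  fixes A :: "'a::euclidean_space set"
  assumes A: "A \<in> sets (restrict_space borel (sphere 0 1))"
  shows "emeasure (distr (density lborel (\<lambda>x::'a. ennreal (of_nat DIM('a) * indicator (cball 0 1) x)))
      (restrict_space borel (sphere 0 1)) sproj) A = of_nat DIM('a) * emeasure lborel (cball 0 1 \<inter> sproj -` A)"
proof -
  have B: "sproj -` A \<in> sets borel"
    using measurable_sets[OF measurable_sproj, of A] A by (simp add: space_borel)
  have "emeasure (distr (density lborel (\<lambda>x::'a. ennreal (of_nat DIM('a) * indicator (cball 0 1) x)))
      (restrict_space borel (sphere 0 1)) sproj) A
     = emeasure (density lborel (\<lambda>x::'a. ennreal (of_nat DIM('a) * indicator (cball 0 1) x))) (sproj -` A)"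
    using A measurable_sproj by (subst emeasure_distr) (simp_all add: measurable_cong_sets[OF sets_density refl])
  also have "\<dots> = (\<integral>\<^sup>+x. of_nat DIM('a) * indicator (cball 0 1 \<inter> sproj -` A) x \<partial>lborel)"
    using B by (subst emeasure_density)
      (auto intro!: nn_integral_cong simp: indicator_def ennreal_of_nat_eq_real_of_nat)
  also have "\<dots> = of_nat DIM('a) * emeasure lborel (cball 0 1 \<inter> sproj -` A)"
    using B by (subst nn_integral_cmult_indicator) auto
  finally show ?thesis .
qed

text \<open>\<open>measure_of\<close> yields the zero measure unless the given set function is a
  measure. Recognising it as the push-forward of d times Lebesgue measure on the unit ball supplies
  countable additivity and the values of \<open>emeasure\<close>.\<close>

lemma sphere_measure_eq_distr:
  "sphere_measure = distr (density lborel (\<lambda>x::'a::euclidean_space. ennreal (of_nat DIM('a) * indicator (cball 0 1) x)))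
      (restrict_space borel (sphere 0 1)) sproj" (is "_ = ?M")
proof -
  have sets: "sets (restrict_space lborel (sphere (0::'a) 1)) = sets ?M"
    by (simp add: sets_restrict_space)
  have "measure_of (sphere 0 1) (sets ?M) (\<lambda>A. of_nat DIM('a) * emeasure lborel {t *\<^sub>R x | t x. t \<in> {0<..1} \<and> x \<in> A})
      = measure_of (space ?M) (sets ?M) (emeasure ?M)"
  proof -
    have sp: "space ?M = sphere 0 1" by (simp add: space_restrict_space)
    have "of_nat DIM('a) * emeasure lborel {t *\<^sub>R x | t x. t \<in> {0<..1} \<and> x \<in> A} = emeasure ?M A"
      if A: "A \<in> sets ?M" for A
    proof -
      have A': "A \<subseteq> sphere 0 1" using sets.sets_into_space[OF A] sp by simp
      have B: "sproj -` A \<in> sets borel"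
        using measurable_sets[OF measurable_sproj, of A] A by (simp add: space_borel)
      have "emeasure ?M A = of_nat DIM('a) * emeasure lborel (cball 0 1 \<inter> sproj -` A)"
        using A by (intro emeasure_distr_sproj) simp
      \<comment> \<open>The origin, the only point in which cone and preimage can differ, is a null
        set.\<close>
      also have "emeasure lborel (cball 0 1 \<inter> sproj -` A) = emeasure lborel ((cball 0 1 \<inter> sproj -` A) - {0})"
        using B by (intro emeasure_Diff_null_set[symmetric]) auto
      finally show ?thesis unfolding cone_eq[OF A'] by simp
    qed
    then show ?thesis unfolding sp
      by (intro measure_of_eq) (use sets.space_closed[of ?M] sp sets.sigma_sets_eq[of ?M] in auto)
  qed
  then show ?thesis
    unfolding sphere_measure_def sets measure_of_of_measure .
qed

lemma sets_sphere_measure [measurable_cong]: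
  "sets (sphere_measure :: 'a::euclidean_space measure) = sets (restrict_space borel (sphere 0 1))"
  unfolding sphere_measure_eq_distr by simp

lemma space_sphere_measure [simp]: "space sphere_measure = sphere 0 1"
  unfolding sphere_measure_eq_distr by (simp add: space_restrict_space)

lemma measurable_sproj_sphere_measure [measurable]: "sproj \<in> borel \<rightarrow>\<^sub>M sphere_measure"
  using measurable_sproj sets_sphere_measure by (metis measurable_cong_sets)

lemma emeasure_sphere_measure:
  fixes A :: "'a::euclidean_space set"
  assumes "A \<in> sets sphere_measure"
  shows "emeasure sphere_measure A = of_nat DIM('a) * emeasure lborel (cball 0 1 \<inter> sproj -` A)"
  using assms emeasure_distr_sproj[of A] unfolding sets_sphere_measure
  unfolding sphere_measure_eq_distr by simp

lemma emeasure_sphere_measure_space: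
  "emeasure sphere_measure (sphere (0::'a::euclidean_space) 1) = ennreal (DIM('a) * unit_ball_vol DIM('a))"
proof -
  have "sproj -` sphere (0::'a) 1 = UNIV" by auto
  then show ?thesis
    using emeasure_sphere_measure[of "sphere (0::'a) 1"] sets.top[of "sphere_measure :: 'a measure"]
    by (simp add: emeasure_cball ennreal_mult' ennreal_of_nat_eq_real_of_nat)
qed

lemma finite_measure_sphere: "finite_measure (sphere_measure :: 'a::euclidean_space measure)"
  by (rule finite_measureI) (simp add: emeasure_sphere_measure_space)

lemma measure_sphere_measure_space:
  "measure sphere_measure (sphere (0::'a::euclidean_space) 1) = DIM('a) * unit_ball_vol DIM('a)"
  unfolding measure_def emeasure_sphere_measure_space by simp

lemma borel_measurable_sphere_measureI:
  "f \<in> borel_measurable borel \<Longrightarrow> f \<in> borel_measurable (sphere_measure :: 'a::euclidean_space measure)"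
  by (simp add: measurable_cong_sets[OF sets_sphere_measure refl] measurable_restrict_space1)

section \<open>Polar coordinates for Lebesgue measure\<close>

lemma sproj_vimage_borel: "A \<in> sets sphere_measure \<Longrightarrow> sproj -` A \<in> sets borel"
  using measurable_sets[OF measurable_sproj_sphere_measure, of A] by (simp add: space_borel)

lemma emeasure_cone_scaling:
  fixes A :: "'a::euclidean_space set"
  assumes "A \<in> sets sphere_measure" "R \<ge> 0"
  shows "emeasure lborel (cball 0 R \<inter> sproj -` A) =
    ennreal (R ^ DIM('a)) * emeasure lborel (cball 0 1 \<inter> sproj -` A)"
proof (cases "R = 0")
  case True
  have "emeasure lborel (cball 0 0 \<inter> sproj -` A) \<le> emeasure lborel {0::'a}"
    by (intro emeasure_mono) auto
  with True show ?thesis by simp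
next
  case False
  with assms have R: "R > 0" by simp
  note B = sproj_vimage_borel[OF assms(1)]
  have "emeasure lborel (cball 0 R \<inter> sproj -` A) =
      emeasure (density (distr lborel borel (\<lambda>x. 0 + R *\<^sub>R x)) (\<lambda>_. \<bar>R\<bar>^DIM('a))) (cball 0 R \<inter> sproj -` A)"
    using lborel_affine[of R "0::'a"] R by simp
  also have "\<dots> = ennreal (R ^ DIM('a)) * emeasure lborel ((\<lambda>x. R *\<^sub>R x) -` (cball 0 R \<inter> sproj -` A))"
    using B R by (subst emeasure_density_const) (auto simp: emeasure_distr)
  also have "(\<lambda>x. R *\<^sub>R x) -` (cball 0 R \<inter> sproj -` A) = cball 0 1 \<inter> sproj -` A"
    using R by (auto simp: sproj_scaleR)
  finally show ?thesis .
qed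

lemma nn_integral_power_Icc:
  assumes "0 \<le> a" "a \<le> b" "n > 0"
  shows "(\<integral>\<^sup>+r. ennreal (r ^ (n - 1)) * indicator {a..b} r \<partial>lborel) = ennreal ((b ^ n - a ^ n) / n)"
proof -
  have "(\<integral>\<^sup>+r. ennreal (r ^ (n - 1)) * indicator {a..b} r \<partial>lborel) = b ^ n / n - a ^ n / n"
    using assms
    by (intro nn_integral_FTC_Icc)
       (auto intro!: derivative_eq_intros simp flip: has_real_derivative_iff_has_vector_derivative)
  then show ?thesis by (simp add: diff_divide_distrib)
qed

text \<open>For a fixed angular set B both sides are Borel measures on the line, finite on
  half-lines, so it suffices to compare them on the half-lines above x. Both values are (R^d - y^d)
  s, where s is the volume of the unit cone over B.\<close>

lemma polar_cone_measure:
  fixes B :: "'a::euclidean_space set"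
  assumes B: "B \<in> sets sphere_measure" and R: "R \<ge> 0"
  shows "density lborel (\<lambda>r. emeasure sphere_measure B * ennreal (r ^ (DIM('a) - 1) * indicator {0..R} r)) =
    distr (density lborel (indicator (cball 0 R \<inter> sproj -` B))) borel norm" (is "?M = ?N")
proof (rule measure_eqI_lessThan)
  note [measurable] = sproj_vimage_borel[OF B] B
  define s where "s = measure lborel (cball 0 1 \<inter> sproj -` B)"
  have s0: "s \<ge> 0" by (simp add: s_def)
  have "emeasure lborel (cball 0 1 \<inter> sproj -` B) \<le> emeasure lborel (cball (0::'a) 1)"
    by (intro emeasure_mono) auto
  then have s: "emeasure lborel (cball 0 1 \<inter> sproj -` B) = ennreal s"
    unfolding s_def by (intro emeasure_eq_ennreal_measure) (auto simp: emeasure_cball top_unique)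
  have V: "emeasure lborel (cball 0 r \<inter> sproj -` B) = ennreal (r ^ DIM('a) * s)" if "r \<ge> 0" for r
    using emeasure_cone_scaling[OF B that] that s s0 by (simp add: ennreal_mult')
  have S: "emeasure sphere_measure B = ennreal (DIM('a) * s)"
    using emeasure_sphere_measure[OF B] s s0 by (simp add: ennreal_mult' ennreal_of_nat_eq_real_of_nat)
  \<comment> \<open>Here y is x clipped to [0, R], the interval that carries the density.\<close>
  have M: "emeasure ?M {x<..} = ennreal ((R ^ DIM('a) - y ^ DIM('a)) * s)"
    if "y = max 0 (min x R)" for x y
  proof -
    have y: "0 \<le> y" "y \<le> R" using that R by auto
    have "emeasure ?M {x<..} = (\<integral>\<^sup>+r. ennreal (DIM('a) * s) * (ennreal (r ^ (DIM('a) - 1)) * indicator {y..R} r) \<partial>lborel)"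
    proof (subst emeasure_density, measurable, rule nn_integral_cong_AE)
      show "AE r in lborel. emeasure sphere_measure B * ennreal (r ^ (DIM('a) - 1) * indicat_real {0..R} r) *
              indicator {x<..} r =
         ennreal (real DIM('a) * s) * (ennreal (r ^ (DIM('a) - 1)) * indicator {y..R} r)"
        using AE_lborel_singleton[of y] AE_lborel_singleton[of R]
        by eventually_elim (use that R in \<open>auto simp: S indicator_def max_def min_def split: if_splits\<close>)
    qed
    also have "\<dots> = ennreal (DIM('a) * s) * ennreal ((R ^ DIM('a) - y ^ DIM('a)) / DIM('a))"
      using y nn_integral_power_Icc[OF y, of "DIM('a)"] by (subst nn_integral_cmult) auto
    also have "\<dots> = ennreal ((R ^ DIM('a) - y ^ DIM('a)) * s)"
      using y s0 by (subst ennreal_mult'[symmetric]) (auto simp: mult_ac)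
    finally show ?thesis .
  qed
  show "emeasure ?M {x<..} < \<infinity>" for x using M[OF refl] by simp
  show "emeasure ?M {x<..} = emeasure ?N {x<..}" for x
  proof -
    have "emeasure ?N {x<..} = emeasure lborel (cball 0 R \<inter> sproj -` B \<inter> {z. norm z > x})"
    proof -
      have [measurable]: "norm -` {x<..} \<in> sets (borel :: 'a measure)"
        using measurable_sets[of norm "borel :: 'a measure" borel "{x<..}"] by simp
      have "emeasure ?N {x<..} = emeasure (density lborel (indicator (cball 0 R \<inter> sproj -` B))) (norm -` {x<..} :: 'a set)"
        by (subst emeasure_distr) auto
      also have "\<dots> = emeasure lborel (cball 0 R \<inter> sproj -` B \<inter> norm -` {x<..})"
        by (rule emeasure_restricted) auto
      also have "norm -` {x<..} = {z::'a. norm z > x}" by auto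
      finally show ?thesis .
    qed
    also have "\<dots> = ennreal ((R ^ DIM('a) - max 0 (min x R) ^ DIM('a)) * s)"
    proof -
      consider "x < 0" | "0 \<le> x" "x < R" | "x \<ge> R" by linarith
      then show ?thesis
      proof cases
        case 1
        then have "{z::'a. norm z > x} = UNIV" using norm_ge_zero by (auto intro: less_le_trans)
        with 1 R V[OF R] show ?thesis by (simp add: zero_power)
      next
        case 2
        have "cball 0 R \<inter> sproj -` B \<inter> {z. norm z > x} = (cball 0 R \<inter> sproj -` B) - (cball 0 x \<inter> sproj -` B)" by auto
        with 2 s0 show ?thesis
          by (simp add: emeasure_Diff V ennreal_minus power_mono algebra_simps subset_iff)
      next
        case 3
        then have "cball 0 R \<inter> sproj -` B \<inter> {z. norm z > x} = {}" by auto
        with 3 R show ?thesis by simp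
      qed
    qed
    finally show ?thesis using M[OF refl] by simp
  qed
qed auto

text \<open>A product measure is determined by rectangles, which \<open>polar_cone_measure\<close>
  evaluates. Cutting off at radius R keeps the radial factor finite, hence sigma-finite.\<close>

lemma polar_measure:
  assumes R: "R \<ge> 0"
  shows "density lborel (\<lambda>r. ennreal (r ^ (DIM('a) - 1) * indicator {0..R} r)) \<Otimes>\<^sub>M (sphere_measure :: 'a::euclidean_space measure)
    = distr (density lborel (indicator (cball (0::'a) R))) (borel \<Otimes>\<^sub>M sphere_measure) (\<lambda>x. (norm x, sproj x))"
    (is "?M1 \<Otimes>\<^sub>M _ = ?N")
proof (rule pair_measure_eqI)
  show "sigma_finite_measure (sphere_measure :: 'a measure)"
    using finite_measure_sphere by (rule finite_measure.axioms)
  have "emeasure ?M1 (space ?M1) = (\<integral>\<^sup>+r. ennreal (r ^ (DIM('a) - 1)) * indicator {0..R} r \<partial>lborel)"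
    by (subst emeasure_density) (auto intro!: nn_integral_cong simp: indicator_def)
  also have "\<dots> < \<infinity>" using nn_integral_power_Icc[of 0 R "DIM('a)"] R by simp
  finally have "finite_measure ?M1" by (intro finite_measureI) auto
  then show "sigma_finite_measure ?M1" by (rule finite_measure.axioms)
  show "sets (?M1 \<Otimes>\<^sub>M sphere_measure) = sets ?N" by (simp cong: sets_pair_measure_cong)
  fix A and B :: "'a set"
  assume A: "A \<in> sets ?M1" and B: "B \<in> sets sphere_measure"
  then have [measurable]: "A \<in> sets borel" by simp
  note [measurable] = sproj_vimage_borel[OF B] B
  have [measurable]: "norm -` A \<in> sets (borel :: 'a measure)"
    using measurable_sets[of norm "borel :: 'a measure" borel A] by simp
  have [measurable]: "(\<lambda>x::'a. (norm x, sproj x)) -` (A \<times> B) \<in> sets borel"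
  proof -
    have "(\<lambda>x::'a. (norm x, sproj x)) -` (A \<times> B) = norm -` A \<inter> sproj -` B" by auto
    then show ?thesis by simp
  qed
  have "emeasure ?M1 A * emeasure sphere_measure B =
     emeasure (density lborel (\<lambda>r. emeasure sphere_measure B * ennreal (r ^ (DIM('a) - 1) * indicator {0..R} r))) A"
    by (subst (1 2) emeasure_density) (auto simp: nn_integral_cmult[symmetric] nn_integral_multc[symmetric] mult_ac)
  also have "\<dots> = (\<integral>\<^sup>+x. indicator (cball 0 R) x * indicator (norm -` A \<inter> sproj -` B) x \<partial>lborel)"
    unfolding polar_cone_measure[OF B R]
    by (subst emeasure_distr, measurable, subst emeasure_density, measurable)
       (auto intro!: nn_integral_cong simp: indicator_def)
  also have "\<dots> = emeasure ?N (A \<times> B)"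
    by (subst emeasure_distr, measurable, subst emeasure_density, measurable)
       (auto intro!: nn_integral_cong simp: indicator_def)
  finally show "emeasure ?M1 A * emeasure sphere_measure B = emeasure ?N (A \<times> B)" .
qed

lemma integrable_sphere_continuous:
  fixes f :: "'a::euclidean_space \<Rightarrow> 'b::{banach, second_countable_topology}"
  assumes "continuous_on UNIV f"
  shows "integrable sphere_measure f"
proof -
  have "bounded (f ` sphere 0 1)"
    using assms by (intro compact_imp_bounded compact_continuous_image continuous_on_subset[OF assms]) auto
  then obtain C where "\<And>x. norm x = 1 \<Longrightarrow> norm (f x) \<le> C" by (auto simp: bounded_iff simp del: mem_sphere simp flip: mem_sphere_0)
  then show ?thesis
    using assms by (intro finite_measure.integrable_const_bound[OF finite_measure_sphere, where B=C]
       borel_measurable_sphere_measureI borel_measurable_continuous_onI) auto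
qed

text \<open>Since p (x) = |x|^n p (x / |x|), the integrand is a product of a radial and an angular
  function, and Fubini applies; the exponent n + d - 1 joins this |x|^n with the Jacobian
  r^(d-1).\<close>

lemma polar_homog:
  fixes p :: "'a::euclidean_space \<Rightarrow> complex"
  assumes p: "homog n p" and w: "continuous_on {0..R} w" and R: "R \<ge> 0"
  shows "(LINT x:cball 0 R|lborel. w (norm x) * p x) =
     (LINT r:{0..R}|lborel. complex_of_real (r ^ (n + DIM('a) - 1)) * w r) * integral\<^sup>L sphere_measure p"
proof -
  let ?M1 = "density lborel (\<lambda>r. ennreal (r ^ (DIM('a) - 1) * indicator {0..R} r))"
  have [measurable]: "p \<in> borel_measurable borel"
    by (intro borel_measurable_continuous_onI continuous_on_homog[OF p])
  have [measurable]: "p \<in> borel_measurable sphere_measure"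
    by (intro borel_measurable_sphere_measureI) measurable
  \<comment> \<open>The indicator makes W measurable and bounded on the whole line, although w is
    continuous only on [0, R].\<close>
  define W where "W = (\<lambda>r. indicator {0..R} r *\<^sub>R (w r * complex_of_real r ^ n))"
  have W [measurable]: "W \<in> borel_measurable borel"
    unfolding W_def by (intro borel_measurable_continuous_on_indicator continuous_intros w) auto
  interpret S: finite_measure "sphere_measure :: 'a measure" by (rule finite_measure_sphere)
  have "emeasure ?M1 (space ?M1) = (\<integral>\<^sup>+r. ennreal (r ^ (DIM('a) - 1)) * indicator {0..R} r \<partial>lborel)"
    by (subst emeasure_density) (auto intro!: nn_integral_cong simp: indicator_def)
  also have "\<dots> < \<infinity>" using nn_integral_power_Icc[of 0 R "DIM('a)"] R by simp
  finally interpret M1: finite_measure ?M1 by (intro finite_measureI) auto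
  interpret P: pair_sigma_finite ?M1 "sphere_measure :: 'a measure" ..
  have ip: "integrable sphere_measure p"
    by (intro integrable_sphere_continuous continuous_on_homog[OF p])
  have "compact ((\<lambda>r. w r * complex_of_real r ^ n) ` {0..R})"
    by (intro compact_continuous_image continuous_intros w) auto
  then obtain C where C: "\<And>r. r \<in> {0..R} \<Longrightarrow> norm (w r * complex_of_real r ^ n) \<le> C"
    by (meson bounded_iff compact_imp_bounded image_eqI)
  have C': "norm (W r) \<le> max C 0" for r using C[of r] by (auto simp: W_def indicator_def)
  have iW: "integrable ?M1 W"
    by (rule M1.integrable_const_bound[where B="max C 0"]) (use C' in auto)
  have iWp: "integrable (?M1 \<Otimes>\<^sub>M sphere_measure) (\<lambda>(r, y). W r * p y)"
    using iW ip by (intro P.Fubini_integrable) (auto simp: norm_mult intro!: integrable_mult_left integrable_mult_right)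
  have "(LINT x:cball 0 R|lborel. w (norm x) * p x) = (LINT x:cball 0 R|lborel. W (norm x) * p (sproj x))"
  proof -
    have "indicator (cball 0 R) x *\<^sub>R (w (norm x) * p x) = indicator (cball 0 R) x *\<^sub>R (W (norm x) * p (sproj x))" for x
      using homog_scaleR[OF p, of "norm x" "sproj x"] by (auto simp: W_def indicator_def)
    then show ?thesis unfolding set_lebesgue_integral_def by (simp only:)
  qed
  also have "\<dots> = (\<integral>x. W (norm x) * p (sproj x) \<partial>density lborel (\<lambda>x. ennreal (indicator (cball 0 R) x)))"
    unfolding set_lebesgue_integral_def by (subst integral_density) (auto intro: borel_measurable_indicator)
  also have "\<dots> = (\<integral>(r, y). W r * p y \<partial>distr (density lborel (indicator (cball 0 R))) (borel \<Otimes>\<^sub>M sphere_measure) (\<lambda>x. (norm x, sproj x)))"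
    by (subst integral_distr) (auto simp: ennreal_indicator)
  also have "\<dots> = (\<integral>r. (\<integral>y. W r * p y \<partial>sphere_measure) \<partial>?M1)"
    unfolding polar_measure[OF R, symmetric] by (rule P.integral_fst'[symmetric, OF iWp, unfolded prod.case])
  also have "\<dots> = (\<integral>r. W r \<partial>?M1) * integral\<^sup>L sphere_measure p" by simp
  also have "(\<integral>r. W r \<partial>?M1) = (\<integral>r. (r ^ (DIM('a) - 1) * indicator {0..R} r) *\<^sub>R W r \<partial>lborel)"
    by (subst integral_density) (auto simp: indicator_def)
  also have "\<dots> = (LINT r:{0..R}|lborel. complex_of_real (r ^ (n + DIM('a) - 1)) * w r)"
  proof -
    have eq: "n + DIM('a) - 1 = n + (DIM('a) - 1)" by (simp add: Suc_leI)
    show ?thesis unfolding set_lebesgue_integral_def eq power_add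
      by (intro Bochner_Integration.integral_cong refl) (auto simp: W_def indicator_def scaleR_conv_of_real)
  qed
  finally show ?thesis .
qed

text \<open>Squaring removes the kink of the positive part at 0, so the cut-off (1 - |x|^2)_+^2 is
  differentiable along lines.\<close>

lemma DERIV_max_0_power2: "((\<lambda>u::real. (max 0 u)\<^sup>2) has_real_derivative 2 * max 0 u) (at u)"
proof -
  consider "u > 0" | "u < 0" | "u = 0" by linarith
  then show ?thesis
  proof cases
    case 1
    have "((\<lambda>u::real. u\<^sup>2) has_real_derivative 2 * max 0 u) (at u)"
      using 1 by (auto intro!: derivative_eq_intros)
    then show ?thesis by (rule has_field_derivative_transform_within_open[of _ _ _ "{0<..}"]) (use 1 in auto)
  next
    case 2
    have "((\<lambda>u::real. 0) has_real_derivative 2 * max 0 u) (at u)"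
      using 2 by (auto intro!: derivative_eq_intros)
    then show ?thesis by (rule has_field_derivative_transform_within_open[of _ _ _ "{..<0}"]) (use 2 in auto)
  next
    case 3
    have "((\<lambda>h::real. (max 0 h)\<^sup>2 / h) \<longlongrightarrow> 0) (at 0)"
    proof (rule Lim_null_comparison)
      show "((\<lambda>h::real. \<bar>h\<bar>) \<longlongrightarrow> 0) (at 0)" by (rule tendsto_eq_intros | simp)+
      show "\<forall>\<^sub>F h in at 0. norm ((max 0 h)\<^sup>2 / h) \<le> \<bar>h::real\<bar>"
        by (rule always_eventually) (auto simp: max_def power2_eq_square)
    qed
    with 3 show ?thesis by (simp add: DERIV_def)
  qed
qed

text \<open>The derivative of q (1 - |x|^2)_+^2 along v has integral 0 by translation invariance; polar
  coordinates turn this into an identity on the sphere, because the two terms of the derivative are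
  homogeneous polynomials times radial factors.\<close>
lemma sphere_integration_by_parts:
  fixes q :: "'a::euclidean_space \<Rightarrow> complex"
  assumes q: "homog m q"
  shows "of_nat (m + DIM('a) - 1) * (LINT x|sphere_measure. complex_of_real (x \<bullet> v) * q x)
    = integral\<^sup>L sphere_measure (ddir v q)"
proof -
  \<comment> \<open>F is q times the cut-off, supported in the closed unit ball, and G is its
    derivative along v; G is still continuous because one factor c survives in it.\<close>
  define c where "c = (\<lambda>x::'a. max 0 (1 - (norm x)\<^sup>2))"
  define F where "F = (\<lambda>x. complex_of_real ((c x)\<^sup>2) * q x)"
  define G where "G = (\<lambda>x. complex_of_real ((c x)\<^sup>2) * ddir v q x - 4 * complex_of_real (c x) * (complex_of_real (x \<bullet> v) * q x))"
  note contq = continuous_on_homog[OF q] and contdq = continuous_on_homog[OF homog_ddir[OF q]]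
  have contF: "continuous_on UNIV F" unfolding F_def c_def by (intro continuous_intros contq)
  have contG: "continuous_on UNIV G" unfolding G_def c_def by (intro continuous_intros contq contdq)
  have [measurable]: "F \<in> borel_measurable borel" "G \<in> borel_measurable borel"
    using contF contG by (auto intro: borel_measurable_continuous_onI)
  have c0: "c x = 0" if "norm x \<ge> 1" for x using that by (simp add: c_def)
  have dF: "((\<lambda>t. F (x + t *\<^sub>R v)) has_vector_derivative G (x + s *\<^sub>R v)) (at s)" for x s
  proof -
    have "(norm (x + t *\<^sub>R v))\<^sup>2 = (norm x)\<^sup>2 + 2 * t * (x \<bullet> v) + t\<^sup>2 * (v \<bullet> v)" for t
      by (simp add: power2_norm_eq_inner inner_simps inner_commute) (simp add: power2_eq_square algebra_simps)
    then have "((\<lambda>t. 1 - (norm (x + t *\<^sub>R v))\<^sup>2) has_real_derivative - 2 * ((x + s *\<^sub>R v) \<bullet> v)) (at s)"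
      by (auto intro!: derivative_eq_intros simp: inner_simps)
    from DERIV_chain2[OF DERIV_max_0_power2 this]
    have "((\<lambda>t. (c (x + t *\<^sub>R v))\<^sup>2) has_real_derivative - 4 * c (x + s *\<^sub>R v) * ((x + s *\<^sub>R v) \<bullet> v)) (at s)"
      by (simp add: c_def mult_ac)
    then have "((\<lambda>t. complex_of_real ((c (x + t *\<^sub>R v))\<^sup>2)) has_vector_derivative
       complex_of_real (- 4 * c (x + s *\<^sub>R v) * ((x + s *\<^sub>R v) \<bullet> v))) (at s)"
      by (intro has_vector_derivative_of_real) (simp add: has_real_derivative_iff_has_vector_derivative)
    from has_vector_derivative_mult[OF this homog_has_ddir[OF q, of x v s]]
    show ?thesis unfolding F_def G_def by (simp add: mult_ac)
  qed
  have "compact (G ` cball 0 1)"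
    by (intro compact_continuous_image continuous_on_subset[OF contG]) auto
  then obtain C where C: "\<And>x. x \<in> cball 0 1 \<Longrightarrow> norm (G x) \<le> C"
    by (meson bounded_iff compact_imp_bounded image_eqI)
  have "norm (G 0) \<le> C" by (rule C) simp
  then have C0: "C \<ge> 0" using norm_ge_zero order_trans by blast
  have C': "norm (G x) \<le> C" for x
  proof (cases "norm x \<le> 1")
    case False
    then show ?thesis using C0 c0[of x] by (simp add: G_def)
  qed (use C in auto)
  \<comment> \<open>Difference quotients of F along v: their integrals vanish by translation
    invariance, and they converge pointwise to G.\<close>
  define s where "s = (\<lambda>n x. of_nat (Suc n) * (F (x + (1 / real (Suc n)) *\<^sub>R v) - F x))"
  have lim: "(\<lambda>n. s n x) \<longlonglongrightarrow> G x" for x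
  proof -
    have "((\<lambda>t. (F (x + t *\<^sub>R v) - F x) /\<^sub>R t) \<longlongrightarrow> G x) (at 0)"
    proof (rule LIM_zero_cancel, rule tendsto_norm_zero_cancel)
      have "((\<lambda>t. norm (F (x + t *\<^sub>R v) - F x - t *\<^sub>R G x) / norm t) \<longlongrightarrow> 0) (at 0)"
        using dF[of x 0] by (simp add: has_vector_derivative_def has_derivative_at)
      then show "((\<lambda>t. norm ((F (x + t *\<^sub>R v) - F x) /\<^sub>R t - G x)) \<longlongrightarrow> 0) (at 0)"
      proof (rule Lim_transform_eventually)
        have "norm (F (x + t *\<^sub>R v) - F x - t *\<^sub>R G x) / norm t = norm ((F (x + t *\<^sub>R v) - F x) /\<^sub>R t - G x)"
          if "t \<noteq> 0" for t
        proof -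
          have "(F (x + t *\<^sub>R v) - F x) /\<^sub>R t - G x = (F (x + t *\<^sub>R v) - F x - t *\<^sub>R G x) /\<^sub>R t"
            using that by (simp add: scaleR_diff_right)
          then show ?thesis by (simp add: divide_inverse mult.commute)
        qed
        then show "\<forall>\<^sub>F t in at 0. norm (F (x + t *\<^sub>R v) - F x - t *\<^sub>R G x) / norm t
            = norm ((F (x + t *\<^sub>R v) - F x) /\<^sub>R t - G x)"
          by (auto simp: eventually_at_filter)
      qed
    qed
    moreover have "filterlim (\<lambda>n. 1 / real (Suc n)) (at 0) sequentially"
      unfolding filterlim_at using LIMSEQ_inverse_real_of_nat by (auto simp: inverse_eq_divide)
    ultimately have "(\<lambda>n. (F (x + (1 / real (Suc n)) *\<^sub>R v) - F x) /\<^sub>R (1 / real (Suc n))) \<longlonglongrightarrow> G x"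
      by (rule filterlim_compose)
    then show ?thesis by (simp add: s_def scaleR_conv_of_real)
  qed
  \<comment> \<open>The shift has length at most \<open>norm v\<close>, so the quotient vanishes
    outside the ball of radius 1 + \<open>norm v\<close>; inside, the mean value theorem bounds it
    by the bound C of G.\<close>
  have dom: "norm (s n x) \<le> C * indicator (cball 0 (1 + norm v)) x" for n x
  proof (cases "norm x \<le> 1 + norm v")
    case True
    obtain y where y: "norm (F (x + (1 / real (Suc n)) *\<^sub>R v) - F (x + 0 *\<^sub>R v)) \<le> norm ((1 / real (Suc n) - 0) *\<^sub>R G (x + y *\<^sub>R v))"
    proof -
      have "continuous_on {0..1 / real (Suc n)} (\<lambda>t. F (x + t *\<^sub>R v))"
        by (intro continuous_at_imp_continuous_on ballI has_vector_derivative_continuous[OF dF])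
      moreover have "((\<lambda>t. F (x + t *\<^sub>R v)) has_derivative (\<lambda>h. h *\<^sub>R G (x + t *\<^sub>R v))) (at t)" for t
        using dF[of x t] by (simp add: has_vector_derivative_def)
      ultimately show ?thesis
        using mvt_general[of 0 "1 / real (Suc n)" "\<lambda>t. F (x + t *\<^sub>R v)" "\<lambda>t h. h *\<^sub>R G (x + t *\<^sub>R v)"] that
        by fastforce
    qed
    then have "norm (F (x + (1 / real (Suc n)) *\<^sub>R v) - F x) \<le> 1 / real (Suc n) * C"
      using mult_left_mono[OF C'[of "x + y *\<^sub>R v"], of "1 / real (Suc n)"] by simp
    then have "real (Suc n) * norm (F (x + (1 / real (Suc n)) *\<^sub>R v) - F x) \<le> C"
      by (simp add: field_simps del: of_nat_Suc)
    then show ?thesis using True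
      unfolding s_def norm_mult norm_of_nat by simp
  next
    case False
    have "norm x - norm ((1 / real (Suc n)) *\<^sub>R v) \<le> norm (x + (1 / real (Suc n)) *\<^sub>R v)"
      using norm_triangle_ineq4[of "x + (1 / real (Suc n)) *\<^sub>R v" "(1 / real (Suc n)) *\<^sub>R v"] by simp
    moreover have "norm ((1 / real (Suc n)) *\<^sub>R v) \<le> norm v"
      by (simp add: divide_le_eq mult_le_cancel_left1 field_simps)
    ultimately have "norm (x + (1 / real (Suc n)) *\<^sub>R v) \<ge> 1" "norm x \<ge> 1" using False norm_ge_zero[of v] by linarith+
    then show ?thesis using C0 by (simp add: s_def F_def c0)
  qed
  have bint: "integrable lborel (\<lambda>x. C * indicator (cball 0 (1 + norm v)) (x::'a))"
    by (intro integrable_mult_right) (simp add: emeasure_cball)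
  have intF: "integrable lborel F"
  proof -
    have "integrable lborel (\<lambda>x. indicator (cball 0 1) x *\<^sub>R F x)"
      using borel_integrable_compact[OF compact_cball continuous_on_subset[OF contF subset_UNIV]] .
    also have "(\<lambda>x. indicator (cball 0 1) x *\<^sub>R F x) = F"
      using c0 by (auto simp: F_def indicator_def fun_eq_iff)
    finally show ?thesis .
  qed
  have tr: "integral\<^sup>L lborel F = integral\<^sup>L lborel (\<lambda>x. F (x + h))" and intFh: "integrable lborel (\<lambda>x. F (x + h))" for h
    using integral_distr[of "(+) h" lborel borel F] integrable_distr_eq[of "(+) h" lborel borel F] intF
    by (simp_all add: lborel_distr_plus add.commute)
  have "(\<lambda>n. integral\<^sup>L lborel (s n)) \<longlonglongrightarrow> integral\<^sup>L lborel G"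
    by (rule integral_dominated_convergence[OF _ _ bint]) (use lim dom in \<open>auto simp: s_def\<close>)
  moreover have "integral\<^sup>L lborel (s n) = 0" for n
    unfolding s_def by (simp add: intF intFh flip: tr)
  ultimately have G0: "integral\<^sup>L lborel G = 0" by (simp add: LIMSEQ_const_iff)
  define I where "I = (LINT x|sphere_measure. complex_of_real (x \<bullet> v) * q x)"
  define J where "J = integral\<^sup>L sphere_measure (ddir v q)"
  \<comment> \<open>Radial moments of r^n (1 - r^2)^k on [0, 1]. The derivative of q has degree m -
    1 and x . v times q has degree m + 1, so with the Jacobian the exponents are m + d - 2 and m +
    d.\<close>
  define R where "R = (\<lambda>n k. LINT r:{0..1}|lborel. complex_of_real (r ^ n) * complex_of_real ((1 - r\<^sup>2) ^ k))"
  define k where "k = m + DIM('a) - 2"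
  have "integral\<^sup>L lborel G = (LINT x:cball 0 1|lborel. complex_of_real ((1 - (norm x)\<^sup>2)\<^sup>2) * ddir v q x
      - 4 * complex_of_real ((1 - (norm x)\<^sup>2) ^ 1) * (complex_of_real (x \<bullet> v) * q x))"
    unfolding set_lebesgue_integral_def
    by (intro Bochner_Integration.integral_cong refl) (auto simp: G_def indicator_def c_def power_le_one)
  also have "\<dots> = (LINT x:cball 0 1|lborel. complex_of_real ((1 - (norm x)\<^sup>2)\<^sup>2) * ddir v q x)
      - (LINT x:cball 0 1|lborel. (4 * complex_of_real ((1 - (norm x)\<^sup>2) ^ 1)) * (complex_of_real (x \<bullet> v) * q x))"
    unfolding set_integrable_def
    by (intro set_integral_diff) (auto simp: set_integrable_def intro!: borel_integrable_compact continuous_intros contq contdq)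
  also have "(LINT x:cball 0 1|lborel. complex_of_real ((1 - (norm x)\<^sup>2)\<^sup>2) * ddir v q x) = R (m + DIM('a) - 2) 2 * J"
  \<comment> \<open>For m = 0 the degree m - 1 is truncated and the exponent would be off by one,
    but then the derivative of q is 0.\<close>
  proof (cases m)
    case 0
    then show ?thesis using ddir_homog_0[of q v] q by (simp add: J_def)
  next
    case (Suc m')
    then show ?thesis
      using polar_homog[OF homog_ddir[OF q], of 1 "\<lambda>r. complex_of_real ((1 - r\<^sup>2)\<^sup>2)"]
      by (simp add: J_def R_def continuous_intros)
  qed
  also have "(LINT x:cball 0 1|lborel. (4 * complex_of_real ((1 - (norm x)\<^sup>2) ^ 1)) * (complex_of_real (x \<bullet> v) * q x)) = 4 * R (m + DIM('a)) 1 * I"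
  proof -
    have "(LINT x:cball 0 1|lborel. complex_of_real ((1 - (norm x)\<^sup>2) ^ 1) * (complex_of_real (x \<bullet> v) * q x))
        = R (m + DIM('a)) 1 * I"
      using polar_homog[OF homog_inner_mult[OF q, of v], of 1 "\<lambda>r. complex_of_real ((1 - r\<^sup>2) ^ 1)"]
      by (simp add: I_def R_def continuous_intros)
    then show ?thesis by (simp only: mult.assoc set_integral_mult_right)
  qed
  finally have eq: "R (m + DIM('a) - 2) 2 * J = 4 * R (m + DIM('a)) 1 * I" using G0 by simp
  have intP: "set_integrable lborel {0..1} (\<lambda>r::real. complex_of_real (r ^ n))" for n
    unfolding set_integrable_def by (intro borel_integrable_compact continuous_intros) auto
  have P: "(LINT r:{0..1}|lborel. complex_of_real (r ^ n)) = complex_of_real (1 / real (Suc n))" for n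
  proof -
    have "(LINT r:{0..1}|lborel. r ^ n) = 1 ^ Suc n / real (Suc n) - 0 ^ Suc n / real (Suc n)"
      unfolding set_lebesgue_integral_def
      by (rule integral_FTC_Icc)
         (auto intro!: derivative_eq_intros continuous_intros simp del: power_Suc of_nat_Suc
           simp flip: has_real_derivative_iff_has_vector_derivative)
    then show ?thesis by (simp only: set_integral_complex_of_real) simp
  qed
  have R1: "R n 1 = complex_of_real (1 / real (n + 1) - 1 / real (n + 3))" for n
  proof -
    have "R n 1 = (LINT r:{0..1}|lborel. complex_of_real (r ^ n) - complex_of_real (r ^ (n + 2)))"
      unfolding R_def by (simp add: algebra_simps power2_eq_square)
    also have "\<dots> = complex_of_real (1 / real (Suc n)) - complex_of_real (1 / real (Suc (n + 2)))"
      by (simp only: set_integral_diff(2)[OF intP intP] P)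
    finally show ?thesis by simp
  qed
  have R2: "R n 2 = complex_of_real (1 / real (n + 1) - 2 / real (n + 3) + 1 / real (n + 5))" for n
  proof -
    have "R n 2 = (LINT r:{0..1}|lborel. (complex_of_real (r ^ n) + complex_of_real (r ^ (n + 4))) - 2 * complex_of_real (r ^ (n + 2)))"
      unfolding R_def by (simp add: algebra_simps power2_eq_square power4_eq_xxxx power_add)
    also have "\<dots> = (complex_of_real (1 / real (Suc n)) + complex_of_real (1 / real (Suc (n + 4)))) - 2 * complex_of_real (1 / real (Suc (n + 2)))"
      by (simp only: set_integral_diff(2)[OF set_integral_add(1)[OF intP intP] set_integrable_mult_right[OF intP]]
           set_integral_add(2)[OF intP intP] set_integral_mult_right P)
    finally show ?thesis by (simp add: add.commute)
  qed
  show ?thesis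
  proof (cases "m + DIM('a) \<ge> 2")
    case True
    then obtain n where n: "m + DIM('a) = n + 2" by (metis add.commute le_Suc_ex)
    \<comment> \<open>With n = m + d - 2 the two moments differ by the factor n + 1, which is the
      factor m + d - 1 of the claim.\<close>
    have "R n 2 = complex_of_real (8 / (real (n + 1) * real (n + 3) * real (n + 5)))"
      unfolding R2 by (simp add: divide_simps) (simp add: algebra_simps)
    moreover have "4 * R (n + 2) 1 = complex_of_real (8 / (real (n + 3) * real (n + 5)))"
      unfolding R1 by (simp add: divide_simps) (simp add: algebra_simps)
    ultimately have "J = of_nat (n + 1) * I"
    proof -
      assume *: "R n 2 = complex_of_real (8 / (real (n + 1) * real (n + 3) * real (n + 5)))"
        "4 * R (n + 2) 1 = complex_of_real (8 / (real (n + 3) * real (n + 5)))"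
      have "complex_of_real (8 / (real (n + 1) * real (n + 3) * real (n + 5))) * J
         = complex_of_real (8 / (real (n + 3) * real (n + 5))) * I"
        using eq unfolding n *[symmetric] by simp
      moreover obtain K where K: "K = complex_of_real (8 / (real (n + 3) * real (n + 5)))" by blast
      moreover have e: "complex_of_real (8 / (real (n + 1) * real (n + 3) * real (n + 5))) = K / of_nat (n + 1)"
        by (simp add: K mult_ac)
      ultimately have "K / of_nat (n + 1) * J = K * I" by metis
      moreover have "real (n + 3) * real (n + 5) \<noteq> 0" by (simp del: of_nat_add)
      then have "K \<noteq> 0" unfolding K of_real_eq_0_iff by (metis divide_eq_0_iff zero_neq_numeral)
      moreover have "(of_nat (n + 1) :: complex) \<noteq> 0" by (metis of_nat_eq_0_iff add_is_0 one_neq_zero)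
      ultimately show ?thesis by (simp add: field_simps del: of_nat_Suc of_nat_add)
    qed
    then show ?thesis using n by (simp add: I_def J_def)
  next
    \<comment> \<open>Dimension one and constant q: the factor m + d - 1 and the derivative are both
      0.\<close>
    case False
    with DIM_positive[where 'a='a] have m: "m = 0" "DIM('a) = 1" by linarith+
    then show ?thesis using ddir_homog_0[of q v] q by simp
  qed
qed

section \<open>Bessel functions\<close>

text \<open>The entire function with J_a(x) = (x/2)^a bessel_E a (x^2/4), which avoids real exponents in
  integrals and derivatives.\<close>
definition bessel_E :: "real \<Rightarrow> real \<Rightarrow> real" where
  "bessel_E a t = (\<Sum>m. ((-1) ^ m * rGamma (real m + a + 1) / fact m) * t ^ m)"

text \<open>By rGamma z = z rGamma (z + 1) with z >= 1, the values at b, b + 1, ... stay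
  non-negative and do not increase. This bounds the coefficients of the Bessel series.\<close>

lemma rGamma_nonneg_bound:
  assumes "b \<ge> 1"
  shows "0 \<le> rGamma (real m + b)" "rGamma (real m + b) \<le> rGamma b"
proof (induction m)
  case 0
  case 1
  show ?case using assms by (simp add: rGamma_inverse_Gamma)
next
  case 0
  case 2
  show ?case by simp
next
  case (Suc m)
  have rec: "rGamma (real m + b) = (real m + b) * rGamma (real (Suc m) + b)"
    using rGamma_plus1[of "real m + b"] by (simp add: add_ac)
  case 1
  show ?case using Suc assms rec by (simp add: zero_le_mult_iff)
  case 2
  have "rGamma (real (Suc m) + b) \<le> (real m + b) * rGamma (real (Suc m) + b)"
    using assms \<open>0 \<le> rGamma (real (Suc m) + b)\<close> by (simp add: mult_le_cancel_right1)
  with rec Suc show ?case by simp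
qed

text \<open>For negative orders the first coefficients escape \<open>rGamma_nonneg_bound\<close>, so
  the comparison with the exponential series starts at an index k with a + k >= 0.\<close>

lemma summable_bessel_E: "summable (\<lambda>m. ((-1) ^ m * rGamma (real m + a + 1) / fact m) * (t::real) ^ m)"
proof -
  obtain k where "- a \<le> real k" using real_arch_simple by blast
  then have k: "real k + a + 1 \<ge> 1" by simp
  define b where "b = real k + a + 1"
  have "summable (\<lambda>m. ((-1) ^ (m + k) * rGamma (real (m + k) + a + 1) / fact (m + k)) * t ^ (m + k))"
  proof (rule summable_comparison_test')
    show "summable (\<lambda>m. (rGamma b * \<bar>t\<bar> ^ k) * (\<bar>t\<bar> ^ m / fact m))"
      using summable_exp[of "\<bar>t\<bar>"] by (intro summable_mult) (simp add: field_simps)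
    fix m
    have "rGamma (real (m + k) + a + 1) \<ge> 0 \<and> rGamma (real (m + k) + a + 1) \<le> rGamma b"
      using rGamma_nonneg_bound[of b m] k by (simp add: b_def add_ac)
    then have "norm (((-1) ^ (m + k) * rGamma (real (m + k) + a + 1) / fact (m + k)) * t ^ (m + k))
        \<le> rGamma b / fact (m + k) * \<bar>t\<bar> ^ (m + k)"
      by (simp add: abs_mult power_abs mult_right_mono divide_right_mono)
    also have "\<dots> \<le> rGamma b / fact m * \<bar>t\<bar> ^ (m + k)"
      using rGamma_nonneg_bound[of b 0] k
      by (intro mult_right_mono divide_left_mono fact_mono) (auto simp: b_def)
    finally show "norm (((-1) ^ (m + k) * rGamma (real (m + k) + a + 1) / fact (m + k)) * t ^ (m + k))
        \<le> (rGamma b * \<bar>t\<bar> ^ k) * (\<bar>t\<bar> ^ m / fact m)"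
      by (simp add: power_add mult_ac)
  qed
  then show ?thesis by (subst (asm) summable_iff_shift)
qed

lemma bessel_E_deriv: "(bessel_E a has_real_derivative - bessel_E (a + 1) t) (at t)"
proof -
  let ?c = "\<lambda>m. (-1) ^ m * rGamma (real m + a + 1) / fact m"
  have "((\<lambda>t. \<Sum>m. ?c m * t ^ m) has_real_derivative (\<Sum>m. diffs ?c m * t ^ m)) (at t)"
    by (rule termdiffs_strong_converges_everywhere) (rule summable_bessel_E)
  also have "(\<Sum>m. diffs ?c m * t ^ m) = (\<Sum>m. - (((-1) ^ m * rGamma (real m + (a + 1) + 1) / fact m) * t ^ m))"
    by (simp add: diffs_def add_ac del: of_nat_Suc) (simp add: field_simps)
  also have "\<dots> = - bessel_E (a + 1) t"
    unfolding bessel_E_def by (rule suminf_minus[OF summable_bessel_E])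
  finally show ?thesis unfolding bessel_E_def[abs_def] .
qed

text \<open>Coefficientwise this is (m + a) rGamma (m + a + 1) = rGamma (m + a); the factor m shifts
  the series by one index and produces - t \<open>bessel_E (a + 1) t\<close>.\<close>

lemma bessel_E_rec: "bessel_E (a - 1) t = a * bessel_E a t - t * bessel_E (a + 1) t"
proof -
  let ?c = "\<lambda>a m. (-1) ^ m * rGamma (real m + a + 1) / fact m :: real"
  have s: "(\<lambda>m. ?c a m * t ^ m) sums bessel_E a t" for a
    unfolding bessel_E_def using summable_sums[OF summable_bessel_E] .
  have "(\<lambda>m. - t * (?c (a + 1) m * t ^ m)) sums (- t * bessel_E (a + 1) t)"
    by (intro sums_mult s)
  moreover have "real (Suc m) * (?c a (Suc m) * t ^ Suc m) = - t * (?c (a + 1) m * t ^ m)" for m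
    by (simp add: add_ac del: of_nat_Suc) (simp add: field_simps)
  then have "(\<lambda>m. - t * (?c (a + 1) m * t ^ m)) = (\<lambda>m. real (Suc m) * (?c a (Suc m) * t ^ Suc m))" by metis
  ultimately have "(\<lambda>m. real (Suc m) * (?c a (Suc m) * t ^ Suc m)) sums (- t * bessel_E (a + 1) t)"
    by (simp only:)
  then have "(\<lambda>m. real m * (?c a m * t ^ m)) sums (- t * bessel_E (a + 1) t)"
    by (subst (asm) sums_Suc_iff) simp
  from sums_add[OF sums_mult[OF s, of a a] this]
  have "(\<lambda>m. (real m + a) * (?c a m * t ^ m)) sums (a * bessel_E a t - t * bessel_E (a + 1) t)"
    by (simp only: distrib_right add.commute mult_minus_left add_uminus_conv_diff)
  moreover have "(real m + a) * (?c a m * t ^ m) = ?c (a - 1) m * t ^ m" for m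
    using rGamma_plus1[of "real m + a"] by (simp add: add_ac)
  then have "(\<lambda>m. (real m + a) * (?c a m * t ^ m)) = (\<lambda>m. ?c (a - 1) m * t ^ m)" by (rule ext)
  ultimately show ?thesis using s[of "a - 1"] by (simp only: sums_unique2)
qed

lemma bessel_E_0: "bessel_E a 0 = rGamma (a + 1)"
  unfolding bessel_E_def by (subst powser_zero) simp

lemma continuous_on_bessel_E: "continuous_on A (bessel_E a)"
  by (intro continuous_at_imp_continuous_on ballI) (rule DERIV_isCont[OF bessel_E_deriv])

section \<open>Recurrences for Bessel functions and for Lambda_k\<close>

lemma bessel_J_eq_E:
  assumes "x > 0"
  shows "bessel_J a x = (x / 2) powr a * bessel_E a ((x / 2)\<^sup>2)"
proof -
  have "(x / 2) powr (2 * real m + a) = (x / 2) powr a * ((x / 2)\<^sup>2) ^ m" for m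
    using assms powr_realpow[of "x / 2" "2 * m"] by (simp add: powr_add power_mult)
  then have "bessel_J a x = (\<Sum>m. (x / 2) powr a * (((-1) ^ m * rGamma (real m + a + 1) / fact m) * ((x / 2)\<^sup>2) ^ m))"
    unfolding bessel_J_def by (simp add: mult_ac)
  then show ?thesis unfolding bessel_E_def by (simp only: suminf_mult[OF summable_bessel_E])
qed

lemma bessel_J_rec:
  assumes "x > 0"
  shows "bessel_J (a - 1) x + bessel_J (a + 1) x = 2 * a / x * bessel_J a x"
  using assms unfolding bessel_J_eq_E[OF assms] bessel_E_rec
  by (simp add: powr_add powr_diff field_simps power2_eq_square)

text \<open>The three-term recurrence eliminates the order nu + k - 1, leaving a quadratic form in
  two consecutive Bessel values; the difference of neighbouring Lambdas then involves only three of
  them.\<close>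

lemma Lambda_eq:
  assumes "\<rho> > 0"
  shows "Lambda d k \<rho> = \<rho> / 2 * ((Jn d k \<rho>)\<^sup>2 + (Jn d (k + 1) \<rho>)\<^sup>2) - (bessel_nu d + k) * (Jn d k \<rho> * Jn d (k + 1) \<rho>)"
proof -
  have "bessel_J (bessel_nu d + real k - 1) \<rho> = 2 * (bessel_nu d + k) / \<rho> * Jn d k \<rho> - Jn d (real k + 1) \<rho>"
    using bessel_J_rec[OF assms, of "bessel_nu d + k"] by (simp add: Jn_def add_ac)
  then show ?thesis
    using assms by (simp add: Lambda_def Jn_def add_ac) (simp add: field_simps power2_eq_square)
qed

lemma Jn_rec:
  assumes "\<rho> > 0"
  shows "Jn d (k + 2) \<rho> = 2 * (bessel_nu d + k + 1) / \<rho> * Jn d (k + 1) \<rho> - Jn d k \<rho>"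
  using bessel_J_rec[OF assms, of "bessel_nu d + k + 1"] by (simp add: Jn_def algebra_simps)

lemma Lambda_diff1:
  assumes "\<rho> > 0"
  shows "Lambda d k \<rho> - Lambda d (k + 1) \<rho> = Jn d k \<rho> * Jn d (k + 1) \<rho>"
proof -
  define J0 J1 J2 where J: "J0 = Jn d k \<rho>" "J1 = Jn d (k + 1) \<rho>" "J2 = Jn d (k + 2) \<rho>"
  have e: "Lambda d k \<rho> = \<rho> / 2 * (J0\<^sup>2 + J1\<^sup>2) - (bessel_nu d + k) * (J0 * J1)"
     "Lambda d (k + 1) \<rho> = \<rho> / 2 * (J1\<^sup>2 + J2\<^sup>2) - (bessel_nu d + k + 1) * (J1 * J2)"
    using Lambda_eq[OF assms, of d k] Lambda_eq[OF assms, of d "k + 1"] by (simp_all add: J add_ac)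
  have "\<rho> * (J0 + J2) = 2 * (bessel_nu d + k + 1) * J1"
    using Jn_rec[OF assms, of d k] assms by (simp add: J field_simps)
  \<comment> \<open>Multiplying by J0 - J2 produces rho (J0^2 - J2^2), which is twice the square
    part of the difference of the Lambdas.\<close>
  then have "\<rho> * (J0 + J2) * (J0 - J2) = 2 * (bessel_nu d + k + 1) * J1 * (J0 - J2)" by simp
  then show ?thesis unfolding e J(1,2)[symmetric] by (simp add: field_simps power2_eq_square)
qed

lemma Lambda_diff2:
  assumes "\<rho> > 0"
  shows "Lambda d k \<rho> - Lambda d (k + 2) \<rho> = 2 * (bessel_nu d + k + 1) / \<rho> * (Jn d (k + 1) \<rho>)\<^sup>2"
proof -
  have "Lambda d k \<rho> - Lambda d (k + 2) \<rho> = Jn d (k + 1) \<rho> * (Jn d k \<rho> + Jn d (k + 2) \<rho>)"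
    using Lambda_diff1[OF assms, of d k] Lambda_diff1[OF assms, of d "k + 1"] by (simp add: algebra_simps)
  then show ?thesis unfolding of_nat_add of_nat_numeral Jn_rec[OF assms] by (simp add: power2_eq_square)
qed

text \<open>For N = 2a + 2 and r > 0 this is (r/2)^2 (J_a^2 - J_{a-1} J_{a+1}), Lommel's
  antiderivative of (r/2) J_a(r)^2. Writing it with \<open>bessel_E\<close> and a natural power
  makes it differentiable at r = 0 too.\<close>

definition bessel_int :: "real \<Rightarrow> nat \<Rightarrow> real \<Rightarrow> real" where
  "bessel_int a N r = (r / 2) ^ N * ((bessel_E a ((r / 2)\<^sup>2))\<^sup>2
     - bessel_E (a - 1) ((r / 2)\<^sup>2) * bessel_E (a + 1) ((r / 2)\<^sup>2))"

lemma bessel_int_deriv: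
  assumes N: "real N = 2 * a + 2" "N > 0"
  shows "(bessel_int a N has_real_derivative (r / 2) ^ (N - 1) * (bessel_E a ((r / 2)\<^sup>2))\<^sup>2) (at r)"
proof -
  define s where "s = r / 2"
  obtain n where n: "N = Suc n" using N by (cases N) auto
  have E: "((\<lambda>r. bessel_E b ((r / 2)\<^sup>2)) has_real_derivative - (bessel_E (b + 1) (s\<^sup>2) * s)) (at r)" for b
  proof -
    have "((\<lambda>r. (r / 2)\<^sup>2) has_real_derivative s) (at r)"
      by (auto intro!: derivative_eq_intros simp: s_def)
    from DERIV_chain2[OF bessel_E_deriv this] show ?thesis by (simp add: s_def)
  qed
  have P: "((\<lambda>r. (r / 2) ^ N) has_real_derivative (a + 1) * s ^ n) (at r)"
  proof -
    have "((\<lambda>r. (r / 2) ^ Suc n) has_real_derivative real (Suc n) * (1 / 2) * s ^ n) (at r)"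
      by (auto intro!: derivative_eq_intros simp: s_def simp del: power_Suc)
    then show ?thesis unfolding n
      by (rule DERIV_cong) (use N(1) n in \<open>simp add: algebra_simps\<close>)
  qed
  have "(bessel_int a N has_real_derivative (a + 1) * s ^ n * ((bessel_E a (s\<^sup>2))\<^sup>2 - bessel_E (a - 1) (s\<^sup>2) * bessel_E (a + 1) (s\<^sup>2))
     + s ^ N * (2 * bessel_E a (s\<^sup>2) * - (bessel_E (a + 1) (s\<^sup>2) * s)
        - (- (bessel_E (a - 1 + 1) (s\<^sup>2) * s) * bessel_E (a + 1) (s\<^sup>2)
            + bessel_E (a - 1) (s\<^sup>2) * - (bessel_E (a + 1 + 1) (s\<^sup>2) * s)))) (at r)"
    unfolding bessel_int_def[abs_def] power2_eq_square[of "bessel_E _ _"]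
    by (rule DERIV_cong, rule DERIV_mult, rule P, rule DERIV_diff, rule DERIV_mult, rule E, rule E, rule DERIV_mult, rule E, rule E)
       (simp add: s_def algebra_simps)
  \<comment> \<open>With Ea, Eb, Ec, Ed standing for the values of \<open>bessel_E\<close> at the
    orders a, a - 1, a + 1, a + 2, the claim is polynomial algebra modulo two instances of
    \<open>bessel_E_rec\<close>.\<close>
  moreover have "(a + 1) * s ^ n * (Ea\<^sup>2 - Eb * Ec)
     + s ^ N * (2 * Ea * - (Ec * s) - (- (Ea * s) * Ec + Eb * - (Ed * s))) = s ^ n * Ea\<^sup>2"
    if "Ea = (a + 1) * Ec - s\<^sup>2 * Ed" "Eb = a * Ea - s\<^sup>2 * Ec" for Ea Eb Ec Ed
  proof -
    have "(a + 1) * (Ea\<^sup>2 - Eb * Ec) + s * (2 * Ea * - (Ec * s) - (- (Ea * s) * Ec + Eb * - (Ed * s)))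
      = (a + 1) * Ea\<^sup>2 - Eb * ((a + 1) * Ec - s\<^sup>2 * Ed) - Ea * (s\<^sup>2 * Ec)"
      by (simp add: power2_eq_square algebra_simps)
    also have "\<dots> = Ea * ((a + 1) * Ea - s\<^sup>2 * Ec - Eb)"
      unfolding that(1)[symmetric] by (simp add: power2_eq_square algebra_simps)
    also have "\<dots> = Ea\<^sup>2" unfolding that(2) by (simp add: power2_eq_square algebra_simps)
    finally have "s ^ n * ((a + 1) * (Ea\<^sup>2 - Eb * Ec) + s * (2 * Ea * - (Ec * s) - (- (Ea * s) * Ec + Eb * - (Ed * s)))) = s ^ n * Ea\<^sup>2"
      by simp
    then show ?thesis by (simp add: n algebra_simps)
  qed
  note this[OF bessel_E_rec[of "a + 1", simplified] bessel_E_rec[of a]]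
  ultimately show ?thesis by (simp add: n s_def)
qed

text \<open>The products J_a^2 and J_{a-1} J_{a+1} carry the same power of rho / 2, and 2 (nu + k) +
  2 is the natural number d + 2k.\<close>

lemma Lambda_eq_bessel_int:
  assumes "\<rho> > 0" "d \<ge> 1"
  shows "\<rho> / 2 * Lambda d k \<rho> = bessel_int (bessel_nu d + k) (d + 2 * k) \<rho>"
proof -
  define a where "a = bessel_nu d + k"
  define x where "x = \<rho> / 2"
  have x: "x > 0" using assms by (simp add: x_def)
  have p: "x powr a * x powr a * (x * x) = x ^ (d + 2 * k)"
  proof -
    have "x powr a * x powr a * (x * x) = x powr (2 * a + 2)"
    proof -
      have "2 * a + 2 = a + a + 2" by simp
      then show ?thesis using x by (simp only: powr_add powr_numeral[OF less_imp_le] power2_eq_square)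
    qed
    also have "2 * a + 2 = real (d + 2 * k)" by (simp add: a_def bessel_nu_def)
    finally show ?thesis using x by (simp add: powr_realpow del: of_nat_add)
  qed
  have m: "x powr (a - 1) * x powr (a + 1) = x powr a * x powr a"
    using x by (simp flip: powr_add)
  have "\<rho> / 2 * Lambda d k \<rho> = x * x * ((x powr a)\<^sup>2 * (bessel_E a (x\<^sup>2))\<^sup>2 -
     (x powr (a - 1) * x powr (a + 1)) * (bessel_E (a - 1) (x\<^sup>2) * bessel_E (a + 1) (x\<^sup>2)))"
    unfolding Lambda_def bessel_J_eq_E[OF assms(1)] by (simp add: a_def x_def power_mult_distrib algebra_simps)
  also have "\<dots> = (x powr a * x powr a * (x * x)) * ((bessel_E a (x\<^sup>2))\<^sup>2 - bessel_E (a - 1) (x\<^sup>2) * bessel_E (a + 1) (x\<^sup>2))"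
    unfolding m by (simp add: power2_eq_square algebra_simps)
  finally show ?thesis unfolding p unfolding bessel_int_def a_def[symmetric] x_def[symmetric] .
qed

lemma Lambda_integral:
  assumes "\<rho> > 0" "d \<ge> 1"
  shows "(LINT r:{0..\<rho>}|lborel. (r / 2) ^ (d + 2 * k - 1) * (bessel_E (bessel_nu d + k) ((r / 2)\<^sup>2))\<^sup>2) = \<rho> / 2 * Lambda d k \<rho>"
proof -
  have "(LINT r:{0..\<rho>}|lborel. (r / 2) ^ (d + 2 * k - 1) * (bessel_E (bessel_nu d + k) ((r / 2)\<^sup>2))\<^sup>2) =
    bessel_int (bessel_nu d + k) (d + 2 * k) \<rho> - bessel_int (bessel_nu d + k) (d + 2 * k) 0"
    unfolding set_lebesgue_integral_def
  proof (rule integral_FTC_Icc)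
    show "(bessel_int (bessel_nu d + k) (d + 2 * k) has_vector_derivative
        (x / 2) ^ (d + 2 * k - 1) * (bessel_E (bessel_nu d + k) ((x / 2)\<^sup>2))\<^sup>2) (at x within {0..\<rho>})" for x
      unfolding has_real_derivative_iff_has_vector_derivative[symmetric]
      by (rule has_field_derivative_at_within, rule bessel_int_deriv) (use assms in \<open>auto simp: bessel_nu_def\<close>)
    show "continuous_on {0..\<rho>} (\<lambda>x. (x / 2) ^ (d + 2 * k - 1) * (bessel_E (bessel_nu d + k) ((x / 2)\<^sup>2))\<^sup>2)"
      by (intro continuous_intros continuous_on_compose2[OF continuous_on_bessel_E[of UNIV]]) auto
  qed (use assms in auto)
  also have "bessel_int (bessel_nu d + k) (d + 2 * k) 0 = 0" using assms by (simp add: bessel_int_def)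
  finally show ?thesis using Lambda_eq_bessel_int[OF assms] by simp
qed

text \<open>Lommel's antiderivative vanishes at 0 and is nondecreasing, having a square in its
  derivative. It increases strictly near 0 because \<open>bessel_E a 0\<close> = 1 / Gamma (a + 1) >
  0.\<close>

lemma Lambda_pos:
  assumes "\<rho> > 0" "d \<ge> 1"
  shows "Lambda d k \<rho> > 0"
proof -
  define a where "a = bessel_nu d + k"
  define h where "h = bessel_int a (d + 2 * k)"
  have dh: "(h has_real_derivative (r / 2) ^ (d + 2 * k - 1) * (bessel_E a ((r / 2)\<^sup>2))\<^sup>2) (at r)" for r
    unfolding h_def by (rule bessel_int_deriv) (use assms in \<open>auto simp: bessel_nu_def a_def\<close>)
  have "isCont (\<lambda>r. bessel_E a ((r / 2)\<^sup>2)) 0"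
    by (rule isCont_o2[OF _ DERIV_isCont[OF bessel_E_deriv]]) (intro continuous_intros, simp)
  moreover have "a + 1 > 0" using assms by (simp add: a_def bessel_nu_def)
  then have "bessel_E a ((0 / 2)\<^sup>2) > 0" by (simp add: bessel_E_0 rGamma_inverse_Gamma)
  ultimately have "\<forall>\<^sub>F r in at 0. bessel_E a ((r / 2)\<^sup>2) > 0"
    unfolding isCont_def by (rule order_tendstoD)
  then obtain \<delta> where \<delta>: "\<delta> > 0" "\<And>r. r \<noteq> 0 \<Longrightarrow> dist r 0 < \<delta> \<Longrightarrow> bessel_E a ((r / 2)\<^sup>2) > 0"
    unfolding eventually_at by blast
  define e where "e = min \<delta> \<rho>"
  have e: "e > 0" "e \<le> \<delta>" "e \<le> \<rho>" using \<delta> assms by (auto simp: e_def)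
  have "h 0 < h e"
  proof (rule DERIV_pos_imp_increasing_open[OF e(1)])
    fix r assume "0 < r" "r < e"
    then have "bessel_E a ((r / 2)\<^sup>2) > 0" using \<delta>(2)[of r] e by simp
    with \<open>0 < r\<close> have "(r / 2) ^ (d + 2 * k - 1) * (bessel_E a ((r / 2)\<^sup>2))\<^sup>2 > 0" by simp
    with dh[of r] show "\<exists>y. DERIV h r :> y \<and> y > 0" by blast
  next
    show "continuous_on {0..e} h" by (intro continuous_at_imp_continuous_on ballI DERIV_isCont[OF dh])
  qed
  also have "h e \<le> h \<rho>"
  proof (rule DERIV_nonneg_imp_nondecreasing[OF e(3)])
    fix r assume "e \<le> r" "r \<le> \<rho>"
    then have "(r / 2) ^ (d + 2 * k - 1) * (bessel_E a ((r / 2)\<^sup>2))\<^sup>2 \<ge> 0" using e by simp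
    with dh[of r] show "\<exists>y. DERIV h r :> y \<and> y \<ge> 0" by blast
  qed
  also have "h 0 = 0" using assms by (simp add: h_def bessel_int_def)
  finally have "\<rho> / 2 * Lambda d k \<rho> > 0" using Lambda_eq_bessel_int[OF assms, of k] by (simp add: h_def a_def)
  then show ?thesis using assms by (simp add: zero_less_mult_iff)
qed

text \<open>By \<open>Lambda_eq\<close> a common zero would make Lambda_k vanish.\<close>

lemma Jn_no_common_zero:
  fixes k :: nat
  assumes "\<rho> > 0" "d \<ge> 1"
  shows "Jn d k \<rho> \<noteq> 0 \<or> Jn d (k + 1) \<rho> \<noteq> 0"
  using Lambda_pos[OF assms, of k] Lambda_eq[OF assms(1), of d k] by auto

text \<open>The decrements in steps of two are multiples of c_k = (nu + k + 1) J_{nu+k+1}^2, so c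
  tends to 0. The weight nu + k + 1 in c is what controls the growing coefficient of the mixed term
  in \<open>Lambda_eq\<close>.\<close>

lemma Lambda_tendsto_0:
  assumes \<rho>: "\<rho> > 0" and d: "d \<ge> 2"
  shows "(\<lambda>k. Lambda d k \<rho>) \<longlonglongrightarrow> 0"
proof -
  define c where "c = (\<lambda>k. (bessel_nu d + real k + 1) * (Jn d (k + 1) \<rho>)\<^sup>2)"
  have nu: "bessel_nu d \<ge> 0" using d by (simp add: bessel_nu_def)
  have diff: "Lambda d k \<rho> - Lambda d (k + 2) \<rho> = 2 / \<rho> * c k" for k
    using Lambda_diff2[OF \<rho>, of d k] by (simp add: c_def)
  have c0: "c k \<ge> 0" for k using nu by (simp add: c_def)
  have c: "c \<longlonglongrightarrow> 0"
  proof -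
    \<comment> \<open>Adding neighbours turns steps of two into steps of one: M is decreasing and
      bounded below, hence convergent, and its successive differences are the c_k up to the factor 2
      / rho.\<close>
    define M where "M = (\<lambda>k. Lambda d k \<rho> + Lambda d (k + 1) \<rho>)"
    have Mdiff: "M k - M (Suc k) = 2 / \<rho> * c k" for k using diff[of k] by (simp add: M_def)
    have "decseq M" 
    proof (rule decseq_SucI)
      show "M (Suc k) \<le> M k" for k
        using Mdiff[of k] mult_nonneg_nonneg[OF _ c0[of k], of "2 / \<rho>"] \<rho> by simp
    qed
    moreover have "M k \<ge> 0" for k
      using Lambda_pos[OF \<rho>, of d k] Lambda_pos[OF \<rho>, of d "k + 1"] d by (simp add: M_def)
    ultimately obtain L where "M \<longlonglongrightarrow> L" using decseq_convergent[of M 0] by blast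
    from tendsto_mult_left[OF tendsto_diff[OF this LIMSEQ_Suc[OF this]], of "\<rho> / 2"]
    have "(\<lambda>k. \<rho> / 2 * (M k - M (Suc k))) \<longlonglongrightarrow> 0" by simp
    also have "(\<lambda>k. \<rho> / 2 * (M k - M (Suc k))) = c" using \<rho> by (simp add: Mdiff fun_eq_iff)
    finally show ?thesis .
  qed
  \<comment> \<open>The first summand bounds the squares in \<open>Lambda_eq\<close>, by J^2 <= c_k,
    which uses nu >= 0; the second bounds the mixed term, by - J K <= J^2 + K^2.\<close>
  define b where "b = (\<lambda>k. \<rho> / 2 * (c k + c (Suc k)) + (c k + c (Suc k)))"
  have b: "b \<longlonglongrightarrow> 0" unfolding b_def
    using LIMSEQ_Suc[OF c] c by (auto intro!: tendsto_eq_intros)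
  have "Lambda d (Suc k) \<rho> \<le> b k" for k
  proof -
    define J K where J: "J = Jn d (k + 1) \<rho>" "K = Jn d (k + 2) \<rho>"
    have "J\<^sup>2 \<le> c k" "K\<^sup>2 \<le> c (Suc k)"
      using nu mult_right_mono[of 1 "bessel_nu d + real k + 1" "J\<^sup>2"] mult_right_mono[of 1 "bessel_nu d + real k + 2" "K\<^sup>2"]
      by (simp_all add: c_def J add_ac)
    then have 1: "\<rho> / 2 * (J\<^sup>2 + K\<^sup>2) \<le> \<rho> / 2 * (c k + c (Suc k))" using \<rho> by (intro mult_left_mono) auto
    have "- (J * K) \<le> J\<^sup>2 + K\<^sup>2" 
      using zero_le_power2[of "J + K"] zero_le_power2[of J] zero_le_power2[of K] unfolding power2_sum by linarith
    then have "(bessel_nu d + k + 1) * - (J * K) \<le> (bessel_nu d + k + 1) * (J\<^sup>2 + K\<^sup>2)"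
      using nu by (intro mult_left_mono) auto
    also have "\<dots> \<le> (bessel_nu d + k + 1) * J\<^sup>2 + (bessel_nu d + k + 2) * K\<^sup>2"
      by (simp add: algebra_simps)
    also have "\<dots> = c k + c (Suc k)" by (simp add: c_def J add_ac)
    finally have 2: "- ((bessel_nu d + k + 1) * (J * K)) \<le> c k + c (Suc k)" by simp
    have "Lambda d (Suc k) \<rho> = \<rho> / 2 * (J\<^sup>2 + K\<^sup>2) - (bessel_nu d + k + 1) * (J * K)"
      using Lambda_eq[OF \<rho>, of d "Suc k"] by (simp add: J add_ac)
    with 1 2 show ?thesis by (simp add: b_def)
  qed
  then have "(\<lambda>k. Lambda d (Suc k) \<rho>) \<longlonglongrightarrow> 0"
    using less_imp_le[OF Lambda_pos[OF \<rho>]] d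
    by (intro tendsto_sandwich[OF _ _ tendsto_const b] always_eventually allI) simp_all
  then show ?thesis by (rule LIMSEQ_imp_Suc)
qed

section \<open>Spherical harmonics\<close>

definition multi_indices :: "nat \<Rightarrow> ('a::euclidean_space \<Rightarrow> nat) set" where
  "multi_indices k = {\<alpha>. (\<forall>b. b \<notin> Basis \<longrightarrow> \<alpha> b = 0) \<and> (\<Sum>b\<in>Basis. \<alpha> b) = k}"

definition monomial :: "('a::euclidean_space \<Rightarrow> nat) \<Rightarrow> 'a \<Rightarrow> complex" where
  "monomial \<alpha> x = (\<Prod>b\<in>Basis. complex_of_real (x \<bullet> b) ^ \<alpha> b)"

lemma hom_poly_altdef: "hom_poly k P \<longleftrightarrow> (\<exists>c. \<forall>x. P x = (\<Sum>\<alpha>\<in>multi_indices k. c \<alpha> * monomial \<alpha> x))"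
  by (simp add: hom_poly_def multi_indices_def monomial_def)

lemma finite_multi_indices: "finite (multi_indices k :: ('a::euclidean_space \<Rightarrow> nat) set)"
proof (rule finite_subset)
  show "multi_indices k \<subseteq> {\<alpha>::'a \<Rightarrow> nat. \<forall>b. (b \<in> Basis \<longrightarrow> \<alpha> b \<in> {..k}) \<and> (b \<notin> Basis \<longrightarrow> \<alpha> b = 0)}"
    using member_le_sum[of _ "Basis :: 'a set"] by (fastforce simp: multi_indices_def)
  show "finite {\<alpha>::'a \<Rightarrow> nat. \<forall>b. (b \<in> Basis \<longrightarrow> \<alpha> b \<in> {..k}) \<and> (b \<notin> Basis \<longrightarrow> \<alpha> b = 0)}"
    by (rule finite_set_of_finite_funs) auto
qed

lemma homog_monomial: "\<alpha> \<in> multi_indices k \<Longrightarrow> homog k (monomial \<alpha>)"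
proof -
  assume "\<alpha> \<in> multi_indices k"
  moreover have "homog (\<Sum>b\<in>Basis. \<alpha> b * Suc 0) (\<lambda>x. \<Prod>b\<in>Basis. complex_of_real (x \<bullet> b) ^ \<alpha> b)"
    by (intro homog_prod homog_power homog_inner)
  ultimately show ?thesis by (simp add: multi_indices_def monomial_def[abs_def])
qed

lemma monomial_upd:
  assumes "b \<in> Basis"
  shows "monomial (\<alpha>(b := Suc (\<alpha> b))) x = complex_of_real (x \<bullet> b) * monomial \<alpha> x"
  using assms by (simp add: monomial_def prod.remove[of Basis b])

lemma hom_poly_iff_homog: "hom_poly k P \<longleftrightarrow> homog k P"
proof
  assume "hom_poly k P"
  then obtain c where "P = (\<lambda>x. \<Sum>\<alpha>\<in>multi_indices k. c \<alpha> * monomial \<alpha> x)"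
    unfolding hom_poly_altdef by auto
  then show "homog k P" by (simp only:) (intro homog_sum homog_cmult homog_monomial)
next
  assume "homog k P"
  then show "hom_poly k P"
  proof (induction rule: homog.induct)
    case (homog_const c)
    have "multi_indices 0 = {\<lambda>b::'a. 0::nat}" by (auto simp: multi_indices_def fun_eq_iff)
    then show ?case unfolding hom_poly_altdef by (intro exI[of _ "\<lambda>_. c"]) (simp add: monomial_def)
  next
    case (homog_zero n)
    show ?case unfolding hom_poly_altdef by (intro exI[of _ "\<lambda>_. 0"]) simp
  next
    case (homog_add n P Q)
    then obtain c d where "\<And>x. P x = (\<Sum>\<alpha>\<in>multi_indices n. c \<alpha> * monomial \<alpha> x)"
      "\<And>x. Q x = (\<Sum>\<alpha>\<in>multi_indices n. d \<alpha> * monomial \<alpha> x)" unfolding hom_poly_altdef by blast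
    then show ?case unfolding hom_poly_altdef
      by (intro exI[of _ "\<lambda>\<alpha>. c \<alpha> + d \<alpha>"]) (simp add: sum.distrib distrib_right)
  next
    case (homog_coord_mult n P b)
    then obtain c where c: "\<And>x. P x = (\<Sum>\<alpha>\<in>multi_indices n. c \<alpha> * monomial \<alpha> x)"
      unfolding hom_poly_altdef by blast
    \<comment> \<open>\<open>up\<close> is multiplication of a monomial by the coordinate b, and
      \<open>dn\<close> is its left inverse, used to carry coefficients over; monomials outside the
      image of \<open>up\<close> get coefficient 0.\<close>
    define up where "up = (\<lambda>\<alpha>::'a \<Rightarrow> nat. \<alpha>(b := Suc (\<alpha> b)))"
    define dn where "dn = (\<lambda>\<alpha>::'a \<Rightarrow> nat. \<alpha>(b := \<alpha> b - 1))"
    have dn_up: "dn (up \<alpha>) = \<alpha>" for \<alpha> by (auto simp: up_def dn_def)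
    then have inj: "inj_on up A" for A by (metis inj_on_def)
    have up: "up ` multi_indices n \<subseteq> multi_indices (Suc n)"
      using homog_coord_mult(2) by (auto simp: up_def multi_indices_def sum.remove[of Basis b])
    have "complex_of_real (x \<bullet> b) * P x =
        (\<Sum>\<alpha>\<in>multi_indices (Suc n). (if \<alpha> \<in> up ` multi_indices n then c (dn \<alpha>) else 0) * monomial \<alpha> x)" for x
    proof -
      have "complex_of_real (x \<bullet> b) * P x = (\<Sum>\<alpha>\<in>multi_indices n. c (dn (up \<alpha>)) * monomial (up \<alpha>) x)"
      proof -
        have "monomial (up \<alpha>) x = complex_of_real (x \<bullet> b) * monomial \<alpha> x" for \<alpha>
          unfolding up_def by (rule monomial_upd[OF homog_coord_mult(2)])
        then show ?thesis unfolding c dn_up sum_distrib_left by (simp add: mult_ac)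
      qed
      also have "\<dots> = (\<Sum>\<alpha>\<in>up ` multi_indices n. c (dn \<alpha>) * monomial \<alpha> x)"
        by (subst sum.reindex[OF inj]) (simp add: o_def)
      also have "\<dots> = (\<Sum>\<alpha>\<in>multi_indices (Suc n). (if \<alpha> \<in> up ` multi_indices n then c (dn \<alpha>) else 0) * monomial \<alpha> x)"
        using up by (intro sum.mono_neutral_cong_left finite_multi_indices) auto
      finally show ?thesis .
    qed
    then show ?case unfolding hom_poly_altdef
      by (intro exI[of _ "\<lambda>\<alpha>. if \<alpha> \<in> up ` multi_indices n then c (dn \<alpha>) else 0"]) blast
  qed
qed

section \<open>Harmonic polynomials and the decomposition of polynomials on the sphere\<close>

lemma partial2_homog: "homog n P \<Longrightarrow> partial2 P b x = ddir b (ddir b P) x"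
  unfolding partial2_def
  by (simp add: vector_derivative_at[OF homog_has_ddir] vector_derivative_at[OF homog_has_ddir_0[OF homog_ddir]])

lemma harmonic_iff_lap: "homog n P \<Longrightarrow> harmonic P \<longleftrightarrow> lap P = (\<lambda>x. 0)"
  by (auto simp: harmonic_def lap_def fun_eq_iff partial2_homog)

definition harm :: "nat \<Rightarrow> ('a::euclidean_space \<Rightarrow> complex) \<Rightarrow> bool" where
  "harm k P \<longleftrightarrow> homog k P \<and> lap P = (\<lambda>x. 0)"

text \<open>Members of \<open>SH k\<close> are constrained on the sphere only, whereas derivatives
  need the polynomial on the whole space; arguments about \<open>SH\<close> therefore pick a
  \<open>harm\<close> representative.\<close>

lemma SH_iff: "f \<in> SH k \<longleftrightarrow> (\<exists>P. harm k P \<and> (\<forall>x. norm x = 1 \<longrightarrow> f x = P x))"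
  by (auto simp: SH_def harm_def hom_poly_iff_homog harmonic_iff_lap)

lemma harm_SH: "harm k P \<Longrightarrow> P \<in> SH k"
  by (auto simp: SH_iff)

lemma harm_add: "harm k P \<Longrightarrow> harm k Q \<Longrightarrow> harm k (\<lambda>x. P x + Q x)"
  by (auto simp: harm_def lap_add intro: homog_add)

lemma harm_cmult: "harm k P \<Longrightarrow> harm k (\<lambda>x. c * P x)"
  by (auto simp: harm_def lap_cmult intro: homog_cmult)

lemma harm_zero: "harm k (\<lambda>x. 0)"
  by (simp add: harm_def homog_zero lap_def[abs_def])

lemma harm_cnj: "harm k P \<Longrightarrow> harm k (\<lambda>x. cnj (P x))"
  by (auto simp: harm_def lap_cnj intro: homog_cnj)

lemma SH_zero: "(\<lambda>x. 0) \<in> SH k"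
  using harm_SH[OF harm_zero] .

text \<open>Choose q of degree n - 2 such that |x|^2 q and p have the same Laplacian. Then p - |x|^2
  q is harmonic, and on the sphere |x|^2 q is q, to which induction applies.\<close>

lemma harmonic_decomposition:
  "homog n (p :: 'a::euclidean_space \<Rightarrow> complex) \<Longrightarrow>
     \<exists>g. (\<forall>k\<le>n. g k \<in> SH k) \<and> (\<forall>x. norm x = 1 \<longrightarrow> p x = (\<Sum>k\<le>n. g k x))"
proof (induction n arbitrary: p rule: less_induct)
  case (less n)
  show ?case
  proof (cases "n < 2")
    case True
    then have "harm n p" using less.prems lap_homog_less_2 by (auto simp: harm_def)
    then show ?thesis
    proof (intro exI conjI allI impI)
      show "(if k = n then p else (\<lambda>x. 0)) \<in> SH k" for k
        using \<open>harm n p\<close> by (simp add: SH_zero harm_SH)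
      show "p x = (\<Sum>k\<le>n. (if k = n then p else (\<lambda>x. 0)) x)" for x
        by (simp add: if_distrib[of "\<lambda>f. f _"] if_distribR)
    qed
  next
    case False
    then have n: "n - 2 < n" "2 + (n - 2) = n" by auto
    obtain q where q: "homog (n - 2) q" "\<And>x. lap (\<lambda>x. normsq x * q x) x = lap p x"
      using lap_normsq_surj[OF homog_lap[OF less.prems], of 0] by auto
    have hq: "homog n (\<lambda>x. normsq x * q x)" using homog_mult[OF homog_normsq q(1)] n by simp
    have y: "harm n (\<lambda>x. p x - normsq x * q x)"
      using less.prems hq by (simp add: harm_def homog_diff lap_diff q(2))
    obtain g where g: "\<And>k. k \<le> n - 2 \<Longrightarrow> g k \<in> SH k" "\<And>x. norm x = 1 \<Longrightarrow> q x = (\<Sum>k\<le>n-2. g k x)"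
      using less.IH[OF n(1) q(1)] by blast
    \<comment> \<open>Index n - 1 receives the zero function, because q contributes only up to
      degree n - 2.\<close>
    define g' where "g' = (\<lambda>k. if k = n then (\<lambda>x. p x - normsq x * q x) else if k \<le> n - 2 then g k else (\<lambda>x. 0))"
    have "p x = (\<Sum>k\<le>n. g' k x)" if x: "norm x = 1" for x
    proof -
      have "(\<Sum>k\<le>n. g' k x) = g' n x + (\<Sum>k\<in>{..n} - {n}. g' k x)" by (subst sum.remove[of _ n]) auto
      also have "(\<Sum>k\<in>{..n} - {n}. g' k x) = (\<Sum>k\<le>n-2. g k x)"
        using n by (intro sum.mono_neutral_cong_right) (auto simp: g'_def)
      finally show ?thesis using g(2)[OF x] x by (simp add: g'_def normsq_def)
    qed
    moreover have "\<forall>k\<le>n. g' k \<in> SH k" using y g by (auto simp: g'_def harm_SH SH_zero)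
    ultimately show ?thesis by blast
  qed
qed

lemma integrable_homog: "homog n P \<Longrightarrow> integrable sphere_measure P"
  by (intro integrable_sphere_continuous continuous_on_homog)

text \<open>Euler's identity writes k P as the sum of x_b d_b P. Integrating each term against Q by
  parts leaves the product of gradients, since the second derivatives of P add up to its Laplacian.
  The right side is symmetric in P and Q.\<close>

lemma harm_mult_integral:
  assumes P: "harm k (P :: 'a::euclidean_space \<Rightarrow> complex)" and Q: "homog l Q"
  shows "of_nat (k + l + DIM('a) - 2) * of_nat k * (LINT x|sphere_measure. P x * Q x)
     = (LINT x|sphere_measure. (\<Sum>b\<in>Basis. ddir b P x * ddir b Q x))"
proof (cases k)
  case 0
  then show ?thesis using P by (simp add: harm_def ddir_homog_0)
next
  case (Suc m)
  have P': "homog (Suc m) P" "lap P = (\<lambda>x. 0)" using P Suc by (auto simp: harm_def)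
  note D = homog_ddir'[OF P'(1)]
  define M where "M = (of_nat (k + l + DIM('a) - 2) :: complex)"
  have M: "M = of_nat (m + l + DIM('a) - 1)" by (simp add: M_def Suc)
  have i1: "integrable sphere_measure (\<lambda>x. complex_of_real (x \<bullet> b) * (ddir b P x * Q x))" for b
    by (rule integrable_homog[OF homog_inner_mult[OF homog_mult[OF D Q]]])
  have i2: "integrable sphere_measure (\<lambda>x. ddir b (ddir b P) x * Q x)" for b
    by (rule integrable_homog[OF homog_mult[OF homog_ddir[OF D] Q]])
  have i3: "integrable sphere_measure (\<lambda>x. ddir b P x * ddir b Q x)" for b
    by (rule integrable_homog[OF homog_mult[OF D homog_ddir[OF Q]]])
  have "M * of_nat k * (LINT x|sphere_measure. P x * Q x)
     = M * (LINT x|sphere_measure. (\<Sum>b\<in>Basis. complex_of_real (x \<bullet> b) * (ddir b P x * Q x)))"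
  proof -
    have "of_nat k * (P x * Q x) = (\<Sum>b\<in>Basis. complex_of_real (x \<bullet> b) * (ddir b P x * Q x))" for x
    proof -
      have "of_nat k * P x = (\<Sum>b\<in>Basis. complex_of_real (x \<bullet> b) * ddir b P x)"
        unfolding Suc using euler_homog[OF P'(1), of x] ddir_basis[OF P'(1), of x x] by simp
      then have "of_nat k * P x * Q x = (\<Sum>b\<in>Basis. complex_of_real (x \<bullet> b) * ddir b P x) * Q x"
        by (rule arg_cong)
      then show ?thesis by (simp only: sum_distrib_right mult.assoc)
    qed
    then show ?thesis by (simp only: mult.assoc integral_mult_right_zero[symmetric])
  qed
  also have "\<dots> = (\<Sum>b\<in>Basis. M * (LINT x|sphere_measure. complex_of_real (x \<bullet> b) * (ddir b P x * Q x)))"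
    by (simp add: i1 sum_distrib_left)
  also have "\<dots> = (\<Sum>b\<in>Basis. LINT x|sphere_measure. ddir b P x * ddir b Q x + ddir b (ddir b P) x * Q x)"
    unfolding M sphere_integration_by_parts[OF homog_mult[OF D Q]] ddir_mult[OF D Q] ..
  also have "\<dots> = (LINT x|sphere_measure. (\<Sum>b\<in>Basis. ddir b P x * ddir b Q x)) + (LINT x|sphere_measure. (\<Sum>b\<in>Basis. ddir b (ddir b P) x) * Q x)"
    by (simp add: i2 i3 sum.distrib sum_distrib_right)
  also have "(\<lambda>x. \<Sum>b\<in>Basis. ddir b (ddir b P) x) = (\<lambda>x. 0)"
    using P'(2) unfolding lap_def[abs_def] .
  finally show ?thesis by (simp add: M_def fun_eq_iff)
qed

text \<open>Exchanging P and Q in \<open>harm_mult_integral\<close> gives (k - l) (k + l + d - 2) I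
  = 0; the second factor is nonzero because k + l >= 1 and d >= 2.\<close>

lemma harm_orthogonal:
  assumes "harm k (P :: 'a::euclidean_space \<Rightarrow> complex)" "harm l Q" "k \<noteq> l" "DIM('a) \<ge> 2"
  shows "(LINT x|sphere_measure. P x * Q x) = 0"
proof -
  define I where "I = (LINT x|sphere_measure. P x * Q x)"
  define M where "M = (of_nat (k + l + DIM('a) - 2) :: complex)"
  have "k + l + DIM('a) - 2 \<noteq> 0" using assms by auto
  then have M: "M \<noteq> 0" unfolding M_def of_nat_eq_0_iff .
  have "M * of_nat k * I = M * of_nat l * I"
    using harm_mult_integral[OF assms(1), of l Q] harm_mult_integral[OF assms(2), of k P] assms(1,2)
    by (simp add: harm_def M_def I_def mult.commute add_ac)
  then show ?thesis using M assms(3) by (simp add: I_def[symmetric])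
qed

section \<open>Moments of spherical harmonics and the Hecke-Bochner formula\<close>

definition sphere_const :: "nat \<Rightarrow> real" where
  "sphere_const d = real d * unit_ball_vol d * Gamma (d / 2)"

text \<open>\<open>sphere_const\<close> is the surface area of the sphere times Gamma (d / 2): with
  \<open>bessel_E\<close> of order nu at 0 equal to 1 / Gamma (d / 2), this normalises the transform
  of the constant 1 at the origin.\<close>

lemma sphere_const_eq: "d \<ge> 1 \<Longrightarrow> sphere_const d = 2 * pi powr (d / 2)"
proof -
  assume d: "d \<ge> 1"
  have g: "Gamma (real d / 2 + 1) = d / 2 * Gamma (d / 2)"
    using Gamma_plus1[of "d / 2 :: real"] d by (auto simp: nonpos_Ints_def)
  have "Gamma (real d / 2) > 0" using d by (intro Gamma_real_pos) simp
  then have "Gamma (real d / 2) \<noteq> 0" by linarith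
  then show ?thesis using d unfolding sphere_const_def unit_ball_vol_def g by simp
qed

text \<open>Funk-Hecke coefficient of t^n on H_k: the closed solution of the recursion that
  integration by parts gives for the moments of (x . xi)^n.\<close>

definition hecke :: "nat \<Rightarrow> nat \<Rightarrow> nat \<Rightarrow> real" where
  "hecke d n k = (if k \<le> n \<and> even (n - k)
     then sphere_const d * fact n * rGamma ((real n + real k + real d) / 2) / (2 ^ n * fact ((n - k) div 2)) else 0)"

lemma hecke_plus: "hecke d (k + 2 * m) k = sphere_const d * fact (k + 2 * m) * rGamma (real m + real k + real d / 2) / (2 ^ (k + 2 * m) * fact m)"
  by (simp add: hecke_def add_divide_distrib algebra_simps)

lemma hecke_eq_0: "(\<And>m. n \<noteq> k + 2 * m) \<Longrightarrow> hecke d n k = 0"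
  unfolding hecke_def by (metis dvdE le_add_diff_inverse)

text \<open>The three terms are multiples of one quantity C, and the claim becomes n = k + 2m. At n
  = 1 the truncated index n - 2 is met with the factor n - 1 = 0.\<close>

lemma hecke_rec:
  assumes n: "n \<ge> 1"
  shows "(real n + real k + real d - 2) * hecke d n k =
    (if k = 0 then 0 else real k * hecke d (n - 1) (k - 1)) + (real n - 1) * hecke d (n - 2) k"
proof (cases "\<exists>m. n = k + 2 * m")
  case False
  have "hecke d n k = 0" using False by (intro hecke_eq_0) blast
  moreover have "hecke d (n - 1) (k - 1) = 0" if "k \<noteq> 0"
  proof (rule hecke_eq_0)
    fix m
    have "n - 1 = k - 1 + 2 * m \<Longrightarrow> n = k + 2 * m" using n that by linarith
    then show "n - 1 \<noteq> k - 1 + 2 * m" using False by blast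
  qed
  moreover have "(real n - 1) * hecke d (n - 2) k = 0"
  proof (cases "n = 1")
    case False
    then have "hecke d (n - 2) k = 0" using \<open>\<nexists>m. n = k + 2 * m\<close> n
      by (intro hecke_eq_0 notI) (metis Suc_1 Suc_leI add.assoc add_2_eq_Suc' le_add_diff_inverse2 le_neq_implies_less mult_Suc_right add.commute)
    then show ?thesis by simp
  qed simp
  ultimately show ?thesis by auto
next
  case True
  then obtain m where m: "n = k + 2 * m" by blast
  define g where "g = rGamma (real m + real k + real d / 2 - 1)"
  have g: "g = (real m + real k + real d / 2 - 1) * rGamma (real m + real k + real d / 2)"
    unfolding g_def using rGamma_plus1[of "real m + real k + real d / 2 - 1"] by simp
  \<comment> \<open>The three terms below are 2 n C, 2 k C and 4 m C.\<close>
  define C where "C = sphere_const d * fact (n - 1) * g / (2 ^ n * fact m)"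
  have fn: "fact n = real n * fact (n - 1)" using n by (simp add: fact_reduce)
  have "(real n + real k + real d - 2) * hecke d n k = 2 * real n * C"
    unfolding m hecke_plus C_def g using fn[unfolded m] by (simp add: field_simps)
  moreover have "(if k = 0 then 0 else real k * hecke d (n - 1) (k - 1)) = 2 * real k * C"
  proof (cases k)
    case (Suc j)
    then have *: "n - 1 = j + 2 * m" "n = Suc (j + 2 * m)" using m by auto
    show ?thesis unfolding C_def g_def *(1) using Suc by (simp add: *(2) hecke_plus add_ac) (simp add: field_simps)
  qed simp
  moreover have "(real n - 1) * hecke d (n - 2) k = 4 * real m * C"
  proof (cases m)
    case 0
    show ?thesis
    proof (cases "n = 1")
      case False
      with n m 0 have "hecke d (n - 2) k = 0" by (intro hecke_eq_0) linarith
      with 0 show ?thesis by simp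
    qed (use 0 in simp)
  next
    case (Suc j)
    then have *: "n - 2 = k + 2 * j" "n - 1 = Suc (k + 2 * j)" "n = Suc (Suc (k + 2 * j))" using m by auto
    have 1: "fact m = real (Suc j) * fact j" unfolding Suc by (rule fact_Suc)
    have 2: "fact (n - 1) = (real n - 1) * fact (k + 2 * j)" unfolding *(2) by (simp add: *(3))
    have 3: "hecke d (n - 2) k = sphere_const d * fact (k + 2 * j) * g / (2 ^ (k + 2 * j) * fact j)"
      unfolding *(1) hecke_plus g_def Suc by (simp add: add_ac)
    have 4: "(2::real) ^ n = 4 * 2 ^ (k + 2 * j)" by (simp add: *(3))
    have "4 * real m * C = 4 * real (Suc j) * (sphere_const d * ((real n - 1) * fact (k + 2 * j)) * g /
        (4 * 2 ^ (k + 2 * j) * (real (Suc j) * fact j)))"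
      unfolding C_def 1 2 4 by (simp only: Suc)
    then show ?thesis unfolding 3 by (simp del: of_nat_Suc)
  qed
  ultimately show ?thesis using m by (simp add: algebra_simps)
qed

lemma homog_0_const: "homog 0 P \<Longrightarrow> P x = P y"
  using homog_scaleR[of 0 P 0 x] homog_scaleR[of 0 P 0 y] by simp

lemma hecke_0_0:
  assumes "d \<ge> 1"
  shows "hecke d 0 0 = real d * unit_ball_vol d"
proof -
  have "Gamma (real d / 2) > 0" using assms by (intro Gamma_real_pos) simp
  then show ?thesis by (simp add: hecke_def sphere_const_def rGamma_inverse_Gamma)
qed

lemma homog_inner_power: "homog n (\<lambda>x. complex_of_real (x \<bullet> v) ^ n)"
  using homog_power[OF homog_inner, of n v] by simp

lemma ddir_inner_power:
  "ddir v (\<lambda>x. complex_of_real (x \<bullet> w) ^ n) x = of_nat n * complex_of_real (v \<bullet> w) * complex_of_real (x \<bullet> w) ^ (n - 1)"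
proof (induction n)
  case (Suc n)
  have "ddir v (\<lambda>x. complex_of_real (x \<bullet> w) ^ Suc n) x = complex_of_real (x \<bullet> w) * ddir v (\<lambda>x. complex_of_real (x \<bullet> w) ^ n) x
     + complex_of_real (v \<bullet> w) * complex_of_real (x \<bullet> w) ^ n"
    by (simp add: ddir_inner_mult[OF homog_inner_power])
  then show ?case unfolding Suc.IH by (cases n) (simp_all add: algebra_simps)
qed simp

text \<open>Integrating one factor x . xi by parts gives a recursion, since the derivative of Y along xi is
  again harmonic, of degree k - 1, and takes the value k Y(xi) at xi by Euler's identity.\<close>
lemma hecke_integral:
  assumes d: "DIM('a) \<ge> 2"
  shows "harm k (Y :: 'a::euclidean_space \<Rightarrow> complex) \<Longrightarrow>
    (LINT x|sphere_measure. complex_of_real (x \<bullet> \<xi>) ^ n * Y x)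
      = complex_of_real (hecke DIM('a) n k * norm \<xi> ^ (n - k)) * Y \<xi>"
proof (induction n arbitrary: k Y rule: less_induct)
  case (less n)
  have Y: "homog k Y" "lap Y = (\<lambda>x. 0)" using less.prems by (auto simp: harm_def)
  show ?case
  proof (cases "n = 0")
    case True
    \<comment> \<open>For n = 0 the left side is the integral of Y: the surface area times the value
      of Y in degree 0, and 0 in every other degree by orthogonality to the constant 1.\<close>
    show ?thesis
    proof (cases "k = 0")
      case k: True
      have "(LINT x|sphere_measure. Y x) = (LINT x|(sphere_measure :: 'a measure). Y \<xi>)"
      proof (rule Bochner_Integration.integral_cong[OF refl])
        show "Y x = Y \<xi>" for x by (rule homog_0_const[OF Y(1)[unfolded k]])
      qed
      also have "\<dots> = complex_of_real (DIM('a) * unit_ball_vol DIM('a)) * Y \<xi>"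
        by (simp add: measure_sphere_measure_space scaleR_conv_of_real)
      finally show ?thesis using True k d by (simp add: hecke_0_0)
    next
      case False
      have "harm 0 (\<lambda>x::'a. 1)" by (simp add: harm_def homog_const lap_def[abs_def])
      from harm_orthogonal[OF less.prems this False d] show ?thesis
        using True False by (simp add: hecke_eq_0)
    qed
  next
    case False
    then obtain p where p: "n = Suc p" by (cases n) auto
    define I where "I = (LINT x|sphere_measure. complex_of_real (x \<bullet> \<xi>) ^ n * Y x)"
    define A where "A = (LINT x|sphere_measure. complex_of_real (x \<bullet> \<xi>) ^ p * ddir \<xi> Y x)"
    define B where "B = (LINT x|sphere_measure. complex_of_real (x \<bullet> \<xi>) ^ (p - 1) * Y x)"
    have hq: "homog (p + k) (\<lambda>x. complex_of_real (x \<bullet> \<xi>) ^ p * Y x)"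
      by (intro homog_mult homog_inner_power Y)
    have i1: "integrable sphere_measure (\<lambda>x. complex_of_real (x \<bullet> \<xi>) ^ p * ddir \<xi> Y x)"
      by (rule integrable_homog[OF homog_mult[OF homog_inner_power homog_ddir[OF Y(1)]]])
    have i2: "integrable sphere_measure (\<lambda>x. complex_of_real (x \<bullet> \<xi>) ^ (p - 1) * Y x)"
      by (rule integrable_homog[OF homog_mult[OF homog_inner_power Y(1)]])
    have "of_nat (p + k + DIM('a) - 1) * I
       = of_nat (p + k + DIM('a) - 1) * (LINT x|sphere_measure. complex_of_real (x \<bullet> \<xi>) * (complex_of_real (x \<bullet> \<xi>) ^ p * Y x))"
      by (simp add: I_def p mult.assoc)
    also have "\<dots> = integral\<^sup>L sphere_measure (\<lambda>x. complex_of_real (x \<bullet> \<xi>) ^ p * ddir \<xi> Y x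
        + of_nat p * complex_of_real (\<xi> \<bullet> \<xi>) * (complex_of_real (x \<bullet> \<xi>) ^ (p - 1) * Y x))"
      unfolding sphere_integration_by_parts[OF hq] ddir_mult[OF homog_inner_power Y(1)] ddir_inner_power
      by (simp add: mult.assoc)
    also have "\<dots> = A + of_nat p * complex_of_real (\<xi> \<bullet> \<xi>) * B"
      unfolding A_def B_def by (subst Bochner_Integration.integral_add) (use i1 i2 in auto)
    also have "A = complex_of_real ((if k = 0 then 0 else k * hecke DIM('a) (n - 1) (k - 1)) * norm \<xi> ^ (n - k)) * Y \<xi>"
    proof (cases k)
      case 0
      then show ?thesis using Y by (simp add: A_def ddir_homog_0)
    next
      case (Suc j)
      have "harm j (ddir \<xi> Y)" using Y Suc homog_ddir'[of j Y] lap_ddir[OF Y(1)] by (simp add: harm_def)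
      from less.IH[OF _ this, of p] show ?thesis
        using p Suc euler_homog[OF Y(1), of \<xi>] by (simp add: A_def)
    qed
    also have "of_nat p * complex_of_real (\<xi> \<bullet> \<xi>) * B
       = complex_of_real ((real n - 1) * hecke DIM('a) (n - 2) k * norm \<xi> ^ (n - k)) * Y \<xi>"
    proof (cases p)
      case 0
      then show ?thesis using p by simp
    next
      case (Suc j)
      have B: "B = complex_of_real (hecke DIM('a) (n - 2) k * norm \<xi> ^ (n - 2 - k)) * Y \<xi>"
        using less.IH[OF _ less.prems, of "n - 2"] p Suc by (simp add: B_def)
      \<comment> \<open>If k > n - 2, the exponent n - 2 - k is truncated and the powers need not
        match, but then \<open>hecke\<close> vanishes.\<close>
      have "hecke DIM('a) (n - 2) k * (norm \<xi> ^ (n - 2 - k) * (\<xi> \<bullet> \<xi>)) = hecke DIM('a) (n - 2) k * norm \<xi> ^ (n - k)"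
      proof (cases "k \<le> n - 2")
        case True
        then have "n - k = n - 2 - k + 2" using p Suc by auto
        then show ?thesis by (simp only: power_add power2_norm_eq_inner)
      next
        case False
        then show ?thesis by (simp add: hecke_def)
      qed
      then have e: "complex_of_real (real p * (hecke DIM('a) (n - 2) k * (norm \<xi> ^ (n - 2 - k) * (\<xi> \<bullet> \<xi>)))) * Y \<xi>
          = complex_of_real (real p * (hecke DIM('a) (n - 2) k * norm \<xi> ^ (n - k))) * Y \<xi>"
        by (simp only:)
      have "of_nat p * complex_of_real (\<xi> \<bullet> \<xi>) * B = complex_of_real (real p * (hecke DIM('a) (n - 2) k * (norm \<xi> ^ (n - 2 - k) * (\<xi> \<bullet> \<xi>)))) * Y \<xi>"
        unfolding B by (simp add: mult_ac)
      also note e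
      finally show ?thesis using p by (simp add: mult.assoc)
    qed
    also have "complex_of_real ((if k = 0 then 0 else k * hecke DIM('a) (n - 1) (k - 1)) * norm \<xi> ^ (n - k)) * Y \<xi>
       + complex_of_real ((real n - 1) * hecke DIM('a) (n - 2) k * norm \<xi> ^ (n - k)) * Y \<xi>
       = complex_of_real ((real n + real k + real DIM('a) - 2) * hecke DIM('a) n k * norm \<xi> ^ (n - k)) * Y \<xi>"
      using hecke_rec[of n k "DIM('a)"] p
      by (simp only: of_real_add[symmetric] distrib_right[symmetric])
    also have "\<dots> = of_nat (p + k + DIM('a) - 1) * (complex_of_real (hecke DIM('a) n k * norm \<xi> ^ (n - k)) * Y \<xi>)"
    proof -
      have "real n + real k + real DIM('a) - 2 = real (p + k + DIM('a) - 1)" using d p by simp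
      then show ?thesis by (simp add: mult.assoc)
    qed
    finally have eq: "of_nat (p + k + DIM('a) - 1) * I = of_nat (p + k + DIM('a) - 1) * (complex_of_real (hecke DIM('a) n k * norm \<xi> ^ (n - k)) * Y \<xi>)" .
    have "p + k + DIM('a) - 1 \<noteq> 0" using d by auto
    then have ne: "(of_nat (p + k + DIM('a) - 1) :: complex) \<noteq> 0" unfolding of_nat_eq_0_iff .
    from eq[unfolded mult_left_cancel[OF ne]] show ?thesis unfolding I_def .
  qed
qed

text \<open>Expanding the exponential reduces the transform to the moments of
  \<open>hecke_integral\<close>. Only n = k + 2m survives, where (-i/2)^n = (-i/2)^k (-1/4)^m, so
  the series resums to \<open>bessel_E\<close> at (|xi|/2)^2.\<close>

lemma fourier_ext_harm:
  assumes d: "DIM('a) \<ge> 2" and Y: "harm k (Y :: 'a::euclidean_space \<Rightarrow> complex)"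
  shows "fourier_ext Y \<xi> = complex_of_real (sphere_const DIM('a) * bessel_E (bessel_nu DIM('a) + k) ((norm \<xi> / 2)\<^sup>2))
     * ((- \<i> / 2) ^ k * Y \<xi>)"
proof -
  define f where "f = (\<lambda>n x. (- \<i>) ^ n / fact n * (complex_of_real (x \<bullet> \<xi>) ^ n * Y x))"
  have hY: "homog k Y" using Y by (simp add: harm_def)
  have fi: "integrable sphere_measure (f n)" for n
    unfolding f_def by (intro integrable_mult_right integrable_homog[OF homog_mult[OF homog_inner_power hY]])
  have iY: "integrable sphere_measure Y" by (rule integrable_homog[OF hY])
  have nf: "norm (f n x) \<le> norm (Y x) * (norm \<xi> ^ n / fact n)" if "norm x = 1" for n x
  proof -
    have "\<bar>x \<bullet> \<xi>\<bar> \<le> norm \<xi>" using Cauchy_Schwarz_ineq2[of x \<xi>] that by simp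
    then have "\<bar>x \<bullet> \<xi>\<bar> ^ n / fact n * norm (Y x) \<le> norm \<xi> ^ n / fact n * norm (Y x)"
      by (intro mult_right_mono divide_right_mono power_mono) auto
    then show ?thesis by (simp add: f_def norm_mult norm_power norm_divide mult_ac)
  qed
  have se: "summable (\<lambda>n. norm \<xi> ^ n / fact n)"
    using summable_exp[of "norm \<xi>"] by (simp add: field_simps)
  have "(\<lambda>n. integral\<^sup>L sphere_measure (f n)) sums (LINT x|sphere_measure. (\<Sum>n. f n x))"
  proof (rule sums_integral[OF fi])
    show "AE x in sphere_measure. summable (\<lambda>n. norm (f n x))"
      using nf by (intro AE_I2 summable_comparison_test'[OF summable_mult[OF se]]) auto
    show "summable (\<lambda>n. LINT x|sphere_measure. norm (f n x))"
    proof (rule summable_comparison_test'[OF summable_mult[OF se]])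
      fix n
      have "(LINT x|sphere_measure. norm (f n x)) \<le> (LINT x|sphere_measure. norm (Y x) * (norm \<xi> ^ n / fact n))"
        using nf fi iY by (intro integral_mono integrable_norm integrable_mult_left) auto
      then show "norm (LINT x|sphere_measure. norm (f n x)) \<le> (LINT x|sphere_measure. norm (Y x)) * (norm \<xi> ^ n / fact n)"
        by simp
    qed
  qed
  also have "(LINT x|sphere_measure. (\<Sum>n. f n x)) = fourier_ext Y \<xi>"
    unfolding fourier_ext_def
  proof (intro Bochner_Integration.integral_cong refl)
    fix x
    have "(\<lambda>n. (- \<i> * complex_of_real (x \<bullet> \<xi>)) ^ n /\<^sub>R fact n) sums exp (- \<i> * complex_of_real (x \<bullet> \<xi>))"
      by (rule exp_converges)
    from sums_mult[OF this, of "Y x"]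
    have "(\<lambda>n. Y x * ((- \<i> * complex_of_real (x \<bullet> \<xi>)) ^ n /\<^sub>R fact n)) sums (Y x * exp (- \<i> * complex_of_real (x \<bullet> \<xi>)))" .
    moreover have "f n x = Y x * ((- \<i> * complex_of_real (x \<bullet> \<xi>)) ^ n /\<^sub>R fact n)" for n
      unfolding f_def power_mult_distrib[of "- \<i>" "complex_of_real (x \<bullet> \<xi>)"] by (simp add: scaleR_conv_of_real field_simps)
    ultimately have "(\<lambda>n. f n x) sums (Y x * exp (- \<i> * complex_of_real (x \<bullet> \<xi>)))"
      by (simp only:)
    then show "(\<Sum>n. f n x) = Y x * exp (- \<i> * complex_of_real (x \<bullet> \<xi>))" by (rule sums_unique[symmetric])
  qed
  also have "(\<lambda>n. integral\<^sup>L sphere_measure (f n)) =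
     (\<lambda>n. (- \<i>) ^ n / fact n * (complex_of_real (hecke DIM('a) n k * norm \<xi> ^ (n - k)) * Y \<xi>))"
    unfolding f_def by (simp add: hecke_integral[OF d Y])
  finally have S: "(\<lambda>n. (- \<i>) ^ n / fact n * (complex_of_real (hecke DIM('a) n k * norm \<xi> ^ (n - k)) * Y \<xi>))
     sums fourier_ext Y \<xi>" .
  have "(\<lambda>m. (- \<i>) ^ (k + 2 * m) / fact (k + 2 * m) *
      (complex_of_real (hecke DIM('a) (k + 2 * m) k * norm \<xi> ^ (k + 2 * m - k)) * Y \<xi>)) sums fourier_ext Y \<xi>"
  proof (rule sums_mono_reindex[THEN iffD2, OF _ _ S])
    show "strict_mono (\<lambda>m. k + 2 * m)" by (simp add: strict_mono_def)
    show "(- \<i>) ^ n / fact n * (complex_of_real (hecke DIM('a) n k * norm \<xi> ^ (n - k)) * Y \<xi>) = 0"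
      if "n \<notin> range (\<lambda>m. k + 2 * m)" for n
    proof -
      have "hecke DIM('a) n k = 0" using that by (intro hecke_eq_0) auto
      then show ?thesis by simp
    qed
  qed
  moreover have "(- \<i>) ^ (k + 2 * m) / fact (k + 2 * m) *
      (complex_of_real (hecke DIM('a) (k + 2 * m) k * norm \<xi> ^ (k + 2 * m - k)) * Y \<xi>)
    = complex_of_real (((-1) ^ m * rGamma (real m + (bessel_nu DIM('a) + k) + 1) / fact m) * ((norm \<xi> / 2)\<^sup>2) ^ m)
      * (complex_of_real (sphere_const DIM('a)) * ((- \<i> / 2) ^ k * Y \<xi>))" for m
  proof -
    have 1: "real m + (bessel_nu DIM('a) + k) + 1 = real m + real k + real DIM('a) / 2" by (simp add: bessel_nu_def)
    have 2: "(- \<i>) ^ (k + 2 * m) = (- \<i>) ^ k * (-1) ^ m" by (simp add: power_add power_mult)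
    have 3: "((norm \<xi> / 2)\<^sup>2) ^ m = norm \<xi> ^ (2 * m) / 4 ^ m" by (simp add: power_divide power_mult)
    have 4: "(2::real) ^ (k + 2 * m) = 2 ^ k * 4 ^ m" unfolding power_add power_mult by simp
    have 5: "(- \<i> / 2) ^ k = (- \<i>) ^ k / 2 ^ k" by (rule power_divide)
    obtain R where R: "R = rGamma (real m + real k + real DIM('a) / 2)" by blast
    show ?thesis unfolding hecke_plus 1 2 3 4 5 R[symmetric] by (simp add: field_simps)
  qed
  ultimately have 1: "(\<lambda>m. complex_of_real (((-1) ^ m * rGamma (real m + (bessel_nu DIM('a) + k) + 1) / fact m) * ((norm \<xi> / 2)\<^sup>2) ^ m)
      * (complex_of_real (sphere_const DIM('a)) * ((- \<i> / 2) ^ k * Y \<xi>))) sums fourier_ext Y \<xi>"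
    by (simp only:)
  have "(\<lambda>m. complex_of_real (((-1) ^ m * rGamma (real m + (bessel_nu DIM('a) + k) + 1) / fact m) * ((norm \<xi> / 2)\<^sup>2) ^ m)
      * (complex_of_real (sphere_const DIM('a)) * ((- \<i> / 2) ^ k * Y \<xi>)))
     sums (complex_of_real (bessel_E (bessel_nu DIM('a) + k) ((norm \<xi> / 2)\<^sup>2)) * (complex_of_real (sphere_const DIM('a)) * ((- \<i> / 2) ^ k * Y \<xi>)))"
    unfolding bessel_E_def by (intro sums_mult2 sums_of_real summable_sums summable_bessel_E)
  from sums_unique2[OF 1 this] show ?thesis by (simp add: mult_ac)
qed

section \<open>The space of square integrable functions on the sphere\<close>

definition ip :: "('a::euclidean_space \<Rightarrow> complex) \<Rightarrow> ('a \<Rightarrow> complex) \<Rightarrow> complex" where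
  "ip f g = (LINT x|sphere_measure. f x * cnj (g x))"

definition nsq :: "('a::euclidean_space \<Rightarrow> complex) \<Rightarrow> real" where
  "nsq f = (LINT x|sphere_measure. (cmod (f x))\<^sup>2)"

lemma nsq_nonneg [simp]: "nsq f \<ge> 0"
  by (simp add: nsq_def)

lemma L2norm_eq: "L2norm f = sqrt (nsq f)"
  by (simp add: L2norm_def nsq_def)

lemma L2norm_power2 [simp]: "(L2norm f)\<^sup>2 = nsq f"
  by (simp add: L2norm_eq)

lemma ip_self: "ip f f = complex_of_real (nsq f)"
  unfolding ip_def nsq_def by (subst integral_complex_of_real[symmetric]) (simp only: complex_norm_square)

lemma cnj_ip: "cnj (ip f g) = ip g f"
  unfolding ip_def using Bochner_Integration.integral_cnj[of sphere_measure "\<lambda>x. f x * cnj (g x)"] by (simp add: mult.commute)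

lemma borel_measurable_cnj [measurable]:
  "g \<in> borel_measurable M \<Longrightarrow> (\<lambda>x. cnj (g x)) \<in> borel_measurable M"
  by (erule measurable_compose) (intro borel_measurable_continuous_onI continuous_intros)

lemma L2S_measurable: "L2S f \<Longrightarrow> f \<in> borel_measurable sphere_measure"
  by (simp add: L2S_def)

lemma L2S_integrable_mult:
  assumes "L2S f" "L2S g"
  shows "integrable sphere_measure (\<lambda>x. f x * cnj (g x))"
proof (rule Bochner_Integration.integrable_bound)
  show "integrable sphere_measure (\<lambda>x. (cmod (f x))\<^sup>2 + (cmod (g x))\<^sup>2)"
    using assms by (auto simp: L2S_def)
  show "(\<lambda>x. f x * cnj (g x)) \<in> borel_measurable sphere_measure"
    using assms[THEN L2S_measurable] by measurable
  have "cmod (f x) * cmod (g x) \<le> (cmod (f x))\<^sup>2 + (cmod (g x))\<^sup>2" for x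
    using zero_le_power2[of "cmod (f x) - cmod (g x)"] mult_nonneg_nonneg[OF norm_ge_zero[of "f x"] norm_ge_zero[of "g x"]]
    unfolding power2_diff by linarith
  then show "AE x in sphere_measure. norm (f x * cnj (g x)) \<le> norm ((cmod (f x))\<^sup>2 + (cmod (g x))\<^sup>2)"
    by (simp add: norm_mult)
qed

lemma L2S_cmult: "L2S f \<Longrightarrow> L2S (\<lambda>x. c * f x)"
  by (auto simp: L2S_def norm_mult power_mult_distrib)

lemma L2S_add:
  assumes "L2S f" "L2S g"
  shows "L2S (\<lambda>x. f x + g x)"
  unfolding L2S_def
proof
  have [measurable]: "f \<in> borel_measurable sphere_measure" "g \<in> borel_measurable sphere_measure"
    using assms by (auto simp: L2S_def)
  show "(\<lambda>x. f x + g x) \<in> borel_measurable sphere_measure" by measurable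
  show "integrable sphere_measure (\<lambda>x. (cmod (f x + g x))\<^sup>2)"
  proof (rule Bochner_Integration.integrable_bound)
    show "integrable sphere_measure (\<lambda>x. 2 * (cmod (f x))\<^sup>2 + 2 * (cmod (g x))\<^sup>2)"
      using assms by (auto simp: L2S_def)
    have "(cmod (f x + g x))\<^sup>2 \<le> 2 * (cmod (f x))\<^sup>2 + 2 * (cmod (g x))\<^sup>2" for x
    proof -
      have "(cmod (f x + g x))\<^sup>2 \<le> (cmod (f x) + cmod (g x))\<^sup>2"
        by (intro power_mono norm_triangle_ineq) auto
      also have "\<dots> \<le> 2 * (cmod (f x))\<^sup>2 + 2 * (cmod (g x))\<^sup>2"
        using zero_le_power2[of "cmod (f x) - cmod (g x)"] unfolding power2_diff power2_sum by linarith
      finally show ?thesis .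
    qed
    then show "AE x in sphere_measure. norm ((cmod (f x + g x))\<^sup>2) \<le> norm (2 * (cmod (f x))\<^sup>2 + 2 * (cmod (g x))\<^sup>2)"
      by simp
  qed measurable
qed

lemma L2S_diff: "L2S f \<Longrightarrow> L2S g \<Longrightarrow> L2S (\<lambda>x. f x - g x)"
  using L2S_add[of f "\<lambda>x. (-1) * g x"] L2S_cmult[of g "-1"] by simp

lemma L2S_zero: "L2S (\<lambda>x. 0)"
  by (simp add: L2S_def)

lemma L2S_sum: "(\<And>i. i \<in> A \<Longrightarrow> L2S (f i)) \<Longrightarrow> L2S (\<lambda>x. \<Sum>i\<in>A. f i x)"
  by (induction A rule: infinite_finite_induct) (auto intro: L2S_add L2S_zero)

lemma L2S_cong: "(\<And>x. norm x = 1 \<Longrightarrow> f x = g x) \<Longrightarrow> L2S f \<longleftrightarrow> L2S g"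
proof -
  assume *: "\<And>x. norm x = 1 \<Longrightarrow> f x = g x"
  have "f \<in> borel_measurable sphere_measure \<longleftrightarrow> g \<in> borel_measurable sphere_measure"
    by (rule measurable_cong) (simp add: *)
  moreover have "integrable sphere_measure (\<lambda>x. (cmod (f x))\<^sup>2) \<longleftrightarrow> integrable sphere_measure (\<lambda>x. (cmod (g x))\<^sup>2)"
    by (rule Bochner_Integration.integrable_cong) (simp_all add: *)
  ultimately show ?thesis by (simp add: L2S_def)
qed

lemma nsq_cong: "(\<And>x. norm x = 1 \<Longrightarrow> f x = f' x) \<Longrightarrow> nsq f = nsq f'"
  unfolding nsq_def by (intro Bochner_Integration.integral_cong) auto

lemma L2S_bounded:
  assumes "f \<in> borel_measurable sphere_measure" "\<And>x. norm x = 1 \<Longrightarrow> cmod (f x) \<le> C"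
  shows "L2S f"
  unfolding L2S_def
proof
  show "integrable sphere_measure (\<lambda>x. (cmod (f x))\<^sup>2)"
    using assms
    by (intro finite_measure.integrable_const_bound[OF finite_measure_sphere, where B="C\<^sup>2"]) (auto intro!: AE_I2 power_mono)
qed fact

lemma L2S_continuous:
  fixes f :: "'a::euclidean_space \<Rightarrow> complex"
  assumes "continuous_on UNIV f"
  shows "L2S f"
  unfolding L2S_def
  using assms by (auto intro!: borel_measurable_sphere_measureI borel_measurable_continuous_onI
    integrable_sphere_continuous continuous_intros)

lemma L2S_homog: "homog n P \<Longrightarrow> L2S P"
  by (intro L2S_continuous continuous_on_homog)

lemma ip_diff_left: "L2S f \<Longrightarrow> L2S g \<Longrightarrow> L2S h \<Longrightarrow> ip (\<lambda>x. f x - g x) h = ip f h - ip g h"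
  unfolding ip_def by (simp add: left_diff_distrib L2S_integrable_mult)

lemma ip_cmult_left: "ip (\<lambda>x. c * f x) h = c * ip f h"
  unfolding ip_def by (simp add: mult.assoc)

lemma ip_cmult_right: "ip f (\<lambda>x. c * g x) = cnj c * ip f g"
  unfolding ip_def by (simp add: mult.left_commute)

lemma ip_sum_left: "(\<And>i. i \<in> A \<Longrightarrow> L2S (f i)) \<Longrightarrow> L2S h \<Longrightarrow> ip (\<lambda>x. \<Sum>i\<in>A. f i x) h = (\<Sum>i\<in>A. ip (f i) h)"
  unfolding ip_def by (simp add: sum_distrib_right L2S_integrable_mult)

lemma ip_sum_right: "(\<And>i. i \<in> A \<Longrightarrow> L2S (f i)) \<Longrightarrow> L2S h \<Longrightarrow> ip h (\<lambda>x. \<Sum>i\<in>A. f i x) = (\<Sum>i\<in>A. ip h (f i))"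
  using arg_cong[OF ip_sum_left[of A f h], of cnj] by (simp add: cnj_ip cnj_sum)

lemma nsq_add:
  assumes "L2S f" "L2S g"
  shows "nsq (\<lambda>x. f x + g x) = nsq f + nsq g + 2 * Re (ip f g)"
proof -
  have "ip (\<lambda>x. f x + g x) (\<lambda>x. f x + g x) = ip f f + ip g f + ip f g + ip g g"
    unfolding ip_def
    using L2S_integrable_mult[OF assms(1) assms(1)] L2S_integrable_mult[OF assms(1) assms(2)]
      L2S_integrable_mult[OF assms(2) assms(1)] L2S_integrable_mult[OF assms(2) assms(2)]
    by (simp add: algebra_simps)
  then have "Re (ip (\<lambda>x. f x + g x) (\<lambda>x. f x + g x)) = nsq f + Re (ip g f) + Re (ip f g) + nsq g"
    by (simp add: ip_self)
  moreover have "Re (ip g f) = Re (ip f g)" using cnj_ip[of f g] by (metis complex_cnj cnj.simps(1))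
  ultimately show ?thesis by (simp add: ip_self)
qed

lemma nsq_cmult: "nsq (\<lambda>x. c * f x) = (cmod c)\<^sup>2 * nsq f"
  unfolding nsq_def by (simp add: norm_mult power_mult_distrib)

lemma nsq_add_orthogonal:
  assumes "L2S f" "L2S g" "ip f g = 0"
  shows "nsq (\<lambda>x. f x + g x) = nsq f + nsq g"
  using nsq_add[OF assms(1,2)] assms(3) by simp

lemma nsq_triangle:
  assumes "L2S f" "L2S g"
  shows "nsq (\<lambda>x. f x + g x) \<le> 2 * nsq f + 2 * nsq g"
proof -
  have "nsq (\<lambda>x. f x - g x) = nsq f + nsq g - 2 * Re (ip f g)"
    using nsq_add[OF assms(1) L2S_cmult[OF assms(2), of "-1"]] nsq_cmult[of "-1" g] ip_cmult_right[of f "-1" g] by simp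
  with nsq_add[OF assms] nsq_nonneg[of "\<lambda>x. f x - g x"] show ?thesis by linarith
qed

lemma nsq_eq_0_iff:
  assumes "L2S f"
  shows "nsq f = 0 \<longleftrightarrow> (AE x in sphere_measure. f x = 0)"
  using assms unfolding nsq_def L2S_def by (subst integral_nonneg_eq_0_iff_AE) auto

lemma nsq_sum_orthogonal:
  assumes "finite A" "\<And>i. i \<in> A \<Longrightarrow> L2S (f i)" "\<And>i j. i \<in> A \<Longrightarrow> j \<in> A \<Longrightarrow> i \<noteq> j \<Longrightarrow> ip (f i) (f j) = 0"
  shows "nsq (\<lambda>x. \<Sum>i\<in>A. f i x) = (\<Sum>i\<in>A. nsq (f i))"
  using assms
proof (induction A)
  case (insert a A)
  have "ip (f a) (\<lambda>x. \<Sum>i\<in>A. f i x) = 0"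
    using insert by (subst ip_sum_right) (auto intro!: sum.neutral)
  then show ?case using insert by (simp add: nsq_add_orthogonal L2S_sum)
qed (simp add: nsq_def)

text \<open>Cauchy-Schwarz against the constant 1, on a finite measure space.\<close>

lemma integral_norm_le_nsq:
  assumes "L2S (f :: 'a::euclidean_space \<Rightarrow> complex)"
  shows "integrable sphere_measure f"
    and "(LINT x|sphere_measure. cmod (f x))\<^sup>2 \<le> measure sphere_measure (sphere (0::'a) 1) * nsq f"
proof -
  have fm [measurable]: "f \<in> borel_measurable sphere_measure" using assms by (rule L2S_measurable)
  interpret finite_measure "sphere_measure :: 'a measure" by (rule finite_measure_sphere)
  have "integrable sphere_measure (\<lambda>x. (f x)\<^sup>2)"
  proof (rule Bochner_Integration.integrable_bound)
    show "integrable sphere_measure (\<lambda>x. (cmod (f x))\<^sup>2)" using assms by (simp add: L2S_def)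
  qed (auto simp: norm_power)
  then show i: "integrable sphere_measure f"
    by (rule square_integrable_imp_integrable[OF fm])
  define g where "g = (\<lambda>x. complex_of_real (cmod (f x)))"
  have g: "L2S g" "L2S (\<lambda>x::'a. 1)" using assms by (auto simp: L2S_def g_def)
  define I where "I = (LINT x|sphere_measure. cmod (f x))"
  define V where "V = measure sphere_measure (sphere (0::'a) 1)"
  have V: "V > 0" unfolding V_def measure_sphere_measure_space by simp
  have ig: "ip g (\<lambda>x. 1) = complex_of_real I" unfolding ip_def g_def I_def by simp
  have ng: "nsq g = nsq f" "nsq (\<lambda>x::'a. 1) = V" by (simp_all add: nsq_def g_def V_def)
  \<comment> \<open>I / V is the mean of |f|, the constant nearest to |f| in L2.\<close>
  have "0 \<le> nsq (\<lambda>x. g x + complex_of_real (- I / V) * 1)" by simp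
  also have "\<dots> = nsq f + (I / V)\<^sup>2 * V + 2 * (- I / V * I)"
  proof -
    have "(cmod (complex_of_real (- I / V)))\<^sup>2 = (I / V)\<^sup>2" unfolding norm_of_real by (simp add: power_divide)
    moreover have "Re (cnj (complex_of_real (- I / V)) * complex_of_real I) = - I / V * I"
      unfolding complex_cnj_complex_of_real of_real_mult[symmetric] Re_complex_of_real ..
    ultimately show ?thesis
      unfolding nsq_add[OF g(1) L2S_cmult[OF g(2)]] nsq_cmult ip_cmult_right ig ng by simp
  qed
  also have "\<dots> = nsq f - I\<^sup>2 / V" using V by (simp add: power2_eq_square field_simps)
  finally show "I\<^sup>2 \<le> V * nsq f" using V by (simp add: field_simps)
qed

section \<open>Bessel's inequality and projections to H_k\<close>

definition orthonormal :: "('a::euclidean_space \<Rightarrow> complex) set \<Rightarrow> bool" where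
  "orthonormal B \<longleftrightarrow> finite B \<and> (\<forall>b\<in>B. \<forall>c\<in>B. ip b c = (if b = c then 1 else 0))"

definition expand :: "('a::euclidean_space \<Rightarrow> complex) set \<Rightarrow> ('a \<Rightarrow> complex) \<Rightarrow> 'a \<Rightarrow> complex" where
  "expand B f = (\<lambda>x. \<Sum>b\<in>B. ip f b * b x)"

lemma L2S_expand: "(\<And>b. b \<in> B \<Longrightarrow> L2S b) \<Longrightarrow> L2S (expand B f)"
  unfolding expand_def by (intro L2S_sum L2S_cmult)

lemma ip_expand_left:
  assumes "\<And>b. b \<in> B \<Longrightarrow> L2S b" "L2S h"
  shows "ip (expand B f) h = (\<Sum>b\<in>B. ip f b * ip b h)"
  unfolding expand_def using assms by (subst ip_sum_left) (auto intro: L2S_cmult simp: ip_cmult_left)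

lemma ip_expand_residual:
  assumes "orthonormal B" "\<And>b. b \<in> B \<Longrightarrow> L2S b" "L2S f" "b \<in> B"
  shows "ip (\<lambda>x. f x - expand B f x) b = 0"
proof -
  have "(\<Sum>c\<in>B. ip f c * ip c b) = (\<Sum>c\<in>B. if c = b then ip f b else 0)"
    using assms by (intro sum.cong) (auto simp: orthonormal_def)
  also have "\<dots> = ip f b" using assms by (simp add: orthonormal_def)
  finally show ?thesis using assms
    by (simp add: ip_diff_left L2S_expand ip_expand_left)
qed

text \<open>Pythagoras: the residual is orthogonal to every b in B, hence to the expansion.\<close>

lemma bessel_inequality:
  assumes B: "orthonormal B" "\<And>b. b \<in> B \<Longrightarrow> L2S b" and f: "L2S f"
  shows "(\<Sum>b\<in>B. (cmod (ip f b))\<^sup>2) \<le> nsq f"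
proof -
  have p: "L2S (expand B f)" using L2S_expand[of B f] B by blast
  have r: "L2S (\<lambda>x. f x - expand B f x)" by (rule L2S_diff[OF f p])
  have "ip (\<lambda>x. f x - expand B f x) (expand B f) = (\<Sum>b\<in>B. cnj (ip f b) * ip (\<lambda>x. f x - expand B f x) b)"
    unfolding expand_def[of B f] using B r[unfolded expand_def[of B f]]
    by (subst ip_sum_right) (auto simp: ip_cmult_right intro: L2S_cmult)
  also have "\<dots> = 0" using ip_expand_residual[OF B f] by simp
  finally have "nsq (\<lambda>x. (f x - expand B f x) + expand B f x) = nsq (\<lambda>x. f x - expand B f x) + nsq (expand B f)"
    by (rule nsq_add_orthogonal[OF r p])
  then have "nsq (expand B f) \<le> nsq f" by simp
  also have "nsq (expand B f) = (\<Sum>b\<in>B. nsq (\<lambda>x. ip f b * b x))"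
    unfolding expand_def using B
    by (intro nsq_sum_orthogonal) (auto simp: orthonormal_def ip_cmult_left ip_cmult_right intro: L2S_cmult)
  also have "\<dots> = (\<Sum>b\<in>B. (cmod (ip f b))\<^sup>2)"
  proof (rule sum.cong[OF refl])
    fix b assume "b \<in> B"
    then have "complex_of_real (nsq b) = 1" using B(1) by (simp add: orthonormal_def flip: ip_self)
    then show "nsq (\<lambda>x. ip f b * b x) = (cmod (ip f b))\<^sup>2" by (simp add: nsq_cmult)
  qed
  finally show ?thesis .
qed

lemma hecke_diag_pos: "d \<ge> 1 \<Longrightarrow> hecke d k k > 0"
proof -
  assume d: "d \<ge> 1"
  have "Gamma ((real k + real k + real d) / 2) > 0" using d by (intro Gamma_real_pos) simp
  moreover have "sphere_const d > 0" using d by (simp add: sphere_const_eq)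
  ultimately show ?thesis by (simp add: hecke_def rGamma_inverse_Gamma)
qed

text \<open>Up to the factor \<open>hecke DIM('a) k k\<close>, the function (x . xi)^k acts on H_k
  as a reproducing kernel: pairing with it evaluates at xi.\<close>

lemma ip_inner_power_harm:
  assumes "DIM('a) \<ge> 2" "harm k (b :: 'a::euclidean_space \<Rightarrow> complex)"
  shows "ip (\<lambda>x. complex_of_real (x \<bullet> \<xi>) ^ k) b = complex_of_real (hecke DIM('a) k k) * cnj (b \<xi>)"
  unfolding ip_def using hecke_integral[OF assms(1) harm_cnj[OF assms(2)], of \<xi> k] by simp

lemma harm_L2S: "harm k P \<Longrightarrow> L2S P"
  by (auto simp: harm_def intro: L2S_homog)

text \<open>Bessel's inequality for the functions (x . xi)^k, integrated over xi in the sphere.\<close>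
lemma orthonormal_harm_card:
  fixes B :: "('a::euclidean_space \<Rightarrow> complex) set"
  assumes d: "DIM('a) \<ge> 2" and B: "orthonormal B" "\<And>b. b \<in> B \<Longrightarrow> harm k b"
  shows "(hecke DIM('a) k k)\<^sup>2 * card B \<le> (measure sphere_measure (sphere (0::'a) 1))\<^sup>2"
proof -
  define c where "c = hecke DIM('a) k k"
  define V where "V = measure sphere_measure (sphere (0::'a) 1)"
  have L: "L2S b" if "b \<in> B" for b using B(2)[OF that] by (rule harm_L2S)
  have le: "(\<Sum>b\<in>B. c\<^sup>2 * (cmod (b \<xi>))\<^sup>2) \<le> V" if \<xi>: "norm \<xi> = 1" for \<xi> :: 'a
  proof -
    let ?g = "\<lambda>x::'a. complex_of_real (x \<bullet> \<xi>) ^ k"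
    have g: "L2S ?g" by (rule L2S_homog[OF homog_inner_power])
    have "(\<Sum>b\<in>B. c\<^sup>2 * (cmod (b \<xi>))\<^sup>2) = (\<Sum>b\<in>B. (cmod (ip ?g b))\<^sup>2)"
      using ip_inner_power_harm[OF d B(2)] by (intro sum.cong) (simp_all add: c_def norm_mult power_mult_distrib)
    also have "\<dots> \<le> nsq ?g" by (rule bessel_inequality[OF B(1) L g])
    also have "nsq ?g \<le> (LINT x|(sphere_measure :: 'a measure). 1)"
      unfolding nsq_def
    proof (rule integral_mono)
      show "integrable sphere_measure (\<lambda>x. (cmod (?g x))\<^sup>2)" using g by (simp add: L2S_def)
      show "integrable sphere_measure (\<lambda>x::'a. 1::real)" by (rule integrable_sphere_continuous) simp
      fix x :: 'a assume "x \<in> space sphere_measure"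
      then have "\<bar>x \<bullet> \<xi>\<bar> \<le> 1" using Cauchy_Schwarz_ineq2[of x \<xi>] \<xi> by simp
      then show "(cmod (?g x))\<^sup>2 \<le> 1" by (simp add: norm_power power_le_one)
    qed
    also have "\<dots> = V" by (simp add: V_def)
    finally show ?thesis .
  qed
  have "(LINT \<xi>|sphere_measure. (\<Sum>b\<in>B. c\<^sup>2 * (cmod (b \<xi>))\<^sup>2)) \<le> (LINT \<xi>|(sphere_measure :: 'a measure). V)"
  proof (rule integral_mono)
    show "integrable sphere_measure (\<lambda>\<xi>. \<Sum>b\<in>B. c\<^sup>2 * (cmod (b \<xi>))\<^sup>2)"
      using L by (intro Bochner_Integration.integrable_sum integrable_mult_right) (simp add: L2S_def)
    show "integrable sphere_measure (\<lambda>x::'a. V)" by (rule integrable_sphere_continuous) simp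
  qed (use le in simp)
  also have "(LINT \<xi>|(sphere_measure :: 'a measure). V) = V\<^sup>2" by (simp add: V_def power2_eq_square)
  also have "(LINT \<xi>|sphere_measure. (\<Sum>b\<in>B. c\<^sup>2 * (cmod (b \<xi>))\<^sup>2)) = (\<Sum>b\<in>B. c\<^sup>2 * nsq b)"
    using L unfolding nsq_def by (subst Bochner_Integration.integral_sum) (auto simp: L2S_def)
  also have "\<dots> = (\<Sum>b\<in>B. c\<^sup>2)"
  proof (rule sum.cong[OF refl])
    fix b assume "b \<in> B"
    then have "complex_of_real (nsq b) = 1" using B(1) by (simp add: orthonormal_def flip: ip_self)
    then show "c\<^sup>2 * nsq b = c\<^sup>2" by simp
  qed
  finally show ?thesis by (simp add: c_def V_def mult.commute)
qed

lemma harm_expand: "(\<And>b. b \<in> B \<Longrightarrow> harm k b) \<Longrightarrow> harm k (expand B f)"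
  unfolding expand_def
  by (induction B rule: infinite_finite_induct) (simp_all add: harm_zero harm_add[OF harm_cmult])

lemma harm_diff: "harm k P \<Longrightarrow> harm k Q \<Longrightarrow> harm k (\<lambda>x. P x - Q x)"
  using harm_add[of k P "\<lambda>x. (-1) * Q x"] harm_cmult[of k Q "-1"] by simp

text \<open>The projection is the expansion with respect to an orthonormal family of maximal size.\<close>
lemma harm_projection_exists:
  assumes d: "DIM('a) \<ge> 2" and f: "L2S (f :: 'a::euclidean_space \<Rightarrow> complex)"
  shows "\<exists>p. harm k p \<and> (\<forall>w. harm k w \<longrightarrow> ip (\<lambda>x. f x - p x) w = 0)"
proof -
  let ?P = "\<lambda>B::('a \<Rightarrow> complex) set. orthonormal B \<and> (\<forall>b\<in>B. harm k b)"
  define c where "c = hecke DIM('a) k k"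
  have c: "c > 0" using d by (simp add: c_def hecke_diag_pos)
  obtain N where N: "(measure sphere_measure (sphere (0::'a) 1))\<^sup>2 / c\<^sup>2 \<le> real N" using real_arch_simple by blast
  have "card B < Suc N" if "?P B" for B
  proof -
    have "c\<^sup>2 * card B \<le> (measure sphere_measure (sphere (0::'a) 1))\<^sup>2"
      using orthonormal_harm_card[OF d, of B k] that by (simp add: c_def)
    also have "\<dots> \<le> c\<^sup>2 * real N" using N c by (simp add: field_simps)
    finally show ?thesis using c by simp
  qed
  then have "\<forall>B. ?P B \<longrightarrow> card B < Suc N" by blast
  moreover have "?P {}" by (simp add: orthonormal_def)
  ultimately have "\<exists>B. ?P B \<and> (\<forall>B'. ?P B' \<longrightarrow> card B' \<le> card B)"
    using ex_has_greatest_nat[of ?P "{}" card "Suc N"] by blast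
  then obtain B where B0: "?P B \<and> (\<forall>B'. ?P B' \<longrightarrow> card B' \<le> card B)" by (rule exE)
  have B: "orthonormal B" "\<And>b. b \<in> B \<Longrightarrow> harm k b" using B0 by auto
  have max: "?P B' \<Longrightarrow> card B' \<le> card B" for B' using B0 by blast
  have L: "L2S b" if "b \<in> B" for b using B(2)[OF that] by (rule harm_L2S)
  have E: "harm k (expand B g)" for g by (rule harm_expand[OF B(2)])
  \<comment> \<open>Maximality: if w had a residual of positive norm, the normalised residual could
    be added to B.\<close>
  have null: "nsq (\<lambda>x. w x - expand B w x) = 0" if w: "harm k w" for w
  proof (rule ccontr)
    define u where "u = (\<lambda>x. w x - expand B w x)"
    assume "nsq (\<lambda>x. w x - expand B w x) \<noteq> 0"
    then have n: "nsq u > 0" using nsq_nonneg[of u] by (simp add: u_def less_le)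
    have hu: "harm k u" unfolding u_def by (rule harm_diff[OF w E])
    have ub: "ip u b = 0" if "b \<in> B" for b
      unfolding u_def by (rule ip_expand_residual[OF B(1) L harm_L2S[OF w] that])
    define a where "a = complex_of_real (1 / sqrt (nsq u))"
    define v where "v = (\<lambda>x. a * u x)"
    have hv: "harm k v" unfolding v_def by (rule harm_cmult[OF hu])
    have vv: "ip v v = 1"
    proof -
      have "sqrt (nsq u) * sqrt (nsq u) = nsq u" using n by simp
      then have "1 / sqrt (nsq u) * (1 / sqrt (nsq u) * nsq u) = 1" using n by (simp add: field_simps)
      then have "complex_of_real (1 / sqrt (nsq u) * (1 / sqrt (nsq u) * nsq u)) = 1" by simp
      then show ?thesis
        unfolding v_def ip_cmult_left ip_cmult_right ip_self a_def complex_cnj_complex_of_real of_real_mult[symmetric] .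
    qed
    have vb: "ip v b = 0" "ip b v = 0" if "b \<in> B" for b
      using ub[OF that] cnj_ip[of u b] by (simp_all add: v_def ip_cmult_left ip_cmult_right)
    have "v \<notin> B" using vb vv by force
    moreover have "?P (insert v B)" using B hv vv vb by (auto simp: orthonormal_def)
    ultimately show False using max[of "insert v B"] B(1) by (simp add: orthonormal_def)
  qed
  \<comment> \<open>Here w is its own expansion plus a function u that vanishes almost everywhere;
    the residual of f is orthogonal to both.\<close>
  have "ip (\<lambda>x. f x - expand B f x) w = 0" if w: "harm k w" for w
  proof -
    define r where "r = (\<lambda>x. f x - expand B f x)"
    define u where "u = (\<lambda>x. w x - expand B w x)"
    have Lr: "L2S r" unfolding r_def by (rule L2S_diff[OF f harm_L2S[OF E]])
    have Lu: "L2S u" unfolding u_def by (rule L2S_diff[OF harm_L2S[OF w] harm_L2S[OF E]])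
    have "AE x in sphere_measure. u x = 0" using null[OF w] nsq_eq_0_iff[OF Lu] by (simp add: u_def)
    then have "AE x in sphere_measure. r x * cnj (u x) = 0" by eventually_elim simp
    then have ru: "ip r u = 0" unfolding ip_def by (rule integral_eq_zero_AE)
    have "ip b r = 0" if "b \<in> B" for b
      using ip_expand_residual[OF B(1) L f that] cnj_ip[of r b] by (simp add: r_def)
    then have "ip (expand B w) r = 0" using ip_expand_left[OF L Lr, where f = w] by simp
    moreover have "ip u r = ip w r - ip (expand B w) r"
      unfolding u_def by (rule ip_diff_left[OF harm_L2S[OF w] harm_L2S[OF E] Lr])
    ultimately have "ip w r = 0" using ru cnj_ip[of r u] by simp
    then show ?thesis using cnj_ip[of w r] by (simp add: r_def)
  qed
  then show ?thesis using E by blast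
qed

text \<open>Two admissible choices differ by an element of H_k orthogonal to H_k, so the difference
  has norm 0.\<close>

definition harm_proj :: "nat \<Rightarrow> ('a::euclidean_space \<Rightarrow> complex) \<Rightarrow> 'a \<Rightarrow> complex" where
  "harm_proj k f = (SOME p. harm k p \<and> (\<forall>w. harm k w \<longrightarrow> ip (\<lambda>x. f x - p x) w = 0))"

lemma harm_proj:
  assumes "DIM('a) \<ge> 2" "L2S (f :: 'a::euclidean_space \<Rightarrow> complex)"
  shows "harm k (harm_proj k f)" "harm k w \<Longrightarrow> ip (\<lambda>x. f x - harm_proj k f x) w = 0"
  using someI_ex[OF harm_projection_exists[OF assms, of k]] unfolding harm_proj_def by blast+

lemma harm_orthogonal_ip:
  assumes "DIM('a) \<ge> 2" "harm k (P :: 'a::euclidean_space \<Rightarrow> complex)" "harm l Q" "k \<noteq> l"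
  shows "ip P Q = 0"
  unfolding ip_def by (rule harm_orthogonal[OF assms(2) harm_cnj[OF assms(3)] assms(4,1)])

text \<open>Pythagoras for f - sum g_k = r + sum (p_k - g_k), where the residual r is orthogonal to
  every H_k with k in K. This one identity yields the partial sums in Parseval's identity, the best
  approximation and the distance.\<close>

lemma nsq_approx:
  assumes d: "DIM('a) \<ge> 2" and f: "L2S (f :: 'a::euclidean_space \<Rightarrow> complex)"
    and K: "finite K" and g: "\<And>k. k \<in> K \<Longrightarrow> harm k (g k)"
  shows "nsq (\<lambda>x. f x - (\<Sum>k\<in>K. g k x)) =
    nsq f - (\<Sum>k\<in>K. nsq (harm_proj k f)) + (\<Sum>k\<in>K. nsq (\<lambda>x. harm_proj k f x - g k x))"
proof -
  define p where "p = (\<lambda>k. harm_proj k f)"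
  have p: "harm k (p k)" for k unfolding p_def by (rule harm_proj[OF d f])
  define r where "r = (\<lambda>x. f x - (\<Sum>k\<in>K. p k x))"
  have Ls: "L2S (\<lambda>x. \<Sum>k\<in>K. p k x)" by (intro L2S_sum harm_L2S[OF p])
  have Lr: "L2S r" unfolding r_def by (rule L2S_diff[OF f Ls])
  have orth: "ip r w = 0" if "k \<in> K" "harm k w" for k w
  proof -
    have Lw: "L2S w" by (rule harm_L2S[OF that(2)])
    have "ip r w = ip f w - (\<Sum>j\<in>K. ip (p j) w)"
      unfolding r_def using ip_diff_left[OF f Ls Lw] ip_sum_left[of K p w] harm_L2S[OF p] Lw by simp
    also have "(\<Sum>j\<in>K. ip (p j) w) = (\<Sum>j\<in>K. if j = k then ip (p k) w else 0)"
      using harm_orthogonal_ip[OF d p that(2)] by (intro sum.cong) auto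
    also have "\<dots> = ip (p k) w" using K that by simp
    also have "ip f w - ip (p k) w = ip (\<lambda>x. f x - p k x) w"
      by (rule ip_diff_left[symmetric, OF f harm_L2S[OF p] Lw])
    also have "\<dots> = 0" unfolding p_def by (rule harm_proj(2)[OF d f that(2)])
    finally show ?thesis .
  qed
  have main: "nsq (\<lambda>x. f x - (\<Sum>k\<in>K. g k x)) = nsq r + (\<Sum>k\<in>K. nsq (\<lambda>x. p k x - g k x))"
    if g: "\<And>k. k \<in> K \<Longrightarrow> harm k (g k)" for g
  proof -
    define h where "h = (\<lambda>k x. p k x - g k x)"
    have h: "harm k (h k)" if "k \<in> K" for k unfolding h_def by (rule harm_diff[OF p g[OF that]])
    have "nsq (\<lambda>x. f x - (\<Sum>k\<in>K. g k x)) = nsq (\<lambda>x. r x + (\<Sum>k\<in>K. h k x))"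
      by (simp add: r_def h_def sum_subtractf)
    also have "\<dots> = nsq r + nsq (\<lambda>x. \<Sum>k\<in>K. h k x)"
    proof (rule nsq_add_orthogonal[OF Lr])
      show "L2S (\<lambda>x. \<Sum>k\<in>K. h k x)" by (intro L2S_sum harm_L2S[OF h])
      show "ip r (\<lambda>x. \<Sum>k\<in>K. h k x) = 0"
        using ip_sum_right[of K h r] harm_L2S[OF h] Lr orth h by simp
    qed
    also have "nsq (\<lambda>x. \<Sum>k\<in>K. h k x) = (\<Sum>k\<in>K. nsq (h k))"
      by (rule nsq_sum_orthogonal[OF K harm_L2S[OF h]]) (use harm_orthogonal_ip[OF d h h] in auto)
    finally show ?thesis by (simp add: h_def)
  qed
  \<comment> \<open>The choice g = 0 determines the norm of the residual.\<close>
  have "nsq f = nsq r + (\<Sum>k\<in>K. nsq (p k))" using main[of "\<lambda>k x. 0", OF harm_zero] by simp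
  with main[of g, OF g] show ?thesis by (simp add: p_def)
qed

section \<open>Completeness of the spherical harmonics\<close>

text \<open>Requiring the summands to vanish beyond N allows two such sums to be padded to a common
  length.\<close>

definition harm_sum :: "('a::euclidean_space \<Rightarrow> complex) \<Rightarrow> bool" where
  "harm_sum h \<longleftrightarrow> (\<exists>N g. (\<forall>k. harm k (g k)) \<and> (\<forall>k>N. g k = (\<lambda>x. 0)) \<and> (\<forall>x. norm x = 1 \<longrightarrow> h x = (\<Sum>k\<le>N. g k x)))"

lemma harm_sum_add:
  assumes "harm_sum f" "harm_sum g"
  shows "harm_sum (\<lambda>x. f x + g x)"
proof -
  obtain N a M b where a: "\<And>k. harm k (a k)" "\<And>k. k > N \<Longrightarrow> a k = (\<lambda>x. 0)" "\<And>x. norm x = 1 \<Longrightarrow> f x = (\<Sum>k\<le>N. a k x)"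
    and b: "\<And>k. harm k (b k)" "\<And>k. k > M \<Longrightarrow> b k = (\<lambda>x. 0)" "\<And>x. norm x = 1 \<Longrightarrow> g x = (\<Sum>k\<le>M. b k x)"
    using assms unfolding harm_sum_def by blast
  have "(\<Sum>k\<le>N. a k x) = (\<Sum>k\<le>max N M. a k x)" "(\<Sum>k\<le>M. b k x) = (\<Sum>k\<le>max N M. b k x)" for x
    using a(2) b(2) by (intro sum.mono_neutral_left; auto)+
  then show ?thesis unfolding harm_sum_def
    by (intro exI[of _ "max N M"] exI[of _ "\<lambda>k x. a k x + b k x"]) (auto simp: a b harm_add sum.distrib)
qed

lemma harm_sum_cmult: "harm_sum f \<Longrightarrow> harm_sum (\<lambda>x. c * f x)"
  unfolding harm_sum_def
proof (elim exE conjE)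
  fix N g assume "\<forall>k. harm k (g k)" "\<forall>k>N. g k = (\<lambda>x. 0)" "\<forall>x. norm x = 1 \<longrightarrow> f x = (\<Sum>k\<le>N. g k x)"
  then show "\<exists>N g. (\<forall>k. harm k (g k)) \<and> (\<forall>k>N. g k = (\<lambda>x. 0)) \<and> (\<forall>x. norm x = 1 \<longrightarrow> c * f x = (\<Sum>k\<le>N. g k x))"
    by (intro exI[of _ N] exI[of _ "\<lambda>k x. c * g k x"]) (auto simp: harm_cmult sum_distrib_left)
qed

lemma harm_sum_homog:
  assumes "homog n p"
  shows "harm_sum p"
proof -
  obtain g where g: "\<And>k. k \<le> n \<Longrightarrow> g k \<in> SH k" "\<And>x. norm x = 1 \<Longrightarrow> p x = (\<Sum>k\<le>n. g k x)"
    using harmonic_decomposition[OF assms] by blast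
  then have "\<forall>k. \<exists>P. k \<le> n \<longrightarrow> harm k P \<and> (\<forall>x. norm x = 1 \<longrightarrow> g k x = P x)" unfolding SH_iff by blast
  then obtain P where P: "\<And>k. k \<le> n \<Longrightarrow> harm k (P k)" "\<And>k x. k \<le> n \<Longrightarrow> norm x = 1 \<Longrightarrow> g k x = P k x" by metis
  show ?thesis unfolding harm_sum_def
    by (intro exI[of _ n] exI[of _ "\<lambda>k. if k \<le> n then P k else (\<lambda>x. 0)"])
       (auto simp: P g harm_zero)
qed

text \<open>Inhomogeneous polynomials, the link between the polynomial functions of the
  Stone-Weierstrass theorem and \<open>homog\<close>.\<close>

inductive poly_fun :: "('a::euclidean_space \<Rightarrow> complex) \<Rightarrow> bool" where
  poly_fun_homog: "homog n P \<Longrightarrow> poly_fun P"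
| poly_fun_add: "poly_fun P \<Longrightarrow> poly_fun Q \<Longrightarrow> poly_fun (\<lambda>x. P x + Q x)"

lemma poly_fun_mult_homog: "poly_fun Q \<Longrightarrow> homog n P \<Longrightarrow> poly_fun (\<lambda>x. P x * Q x)"
proof (induction rule: poly_fun.induct)
  case (poly_fun_homog m Q)
  then show ?case by (intro poly_fun.poly_fun_homog[of "n + m"] homog_mult)
next
  case (poly_fun_add Q R)
  then show ?case using poly_fun.poly_fun_add by (simp add: distrib_left)
qed

lemma poly_fun_mult: "poly_fun P \<Longrightarrow> poly_fun Q \<Longrightarrow> poly_fun (\<lambda>x. P x * Q x)"
proof (induction rule: poly_fun.induct)
  case (poly_fun_homog m P)
  then show ?case by (intro poly_fun_mult_homog)
next
  case (poly_fun_add P R)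
  then show ?case using poly_fun.poly_fun_add by (simp add: distrib_right)
qed

lemma poly_fun_real_polynomial:
  "real_polynomial_function (r :: 'a::euclidean_space \<Rightarrow> real) \<Longrightarrow> poly_fun (\<lambda>x. complex_of_real (r x))"
proof (induction rule: real_polynomial_function.induct)
  case (linear f)
  then interpret bounded_linear f .
  have "f x = x \<bullet> (\<Sum>b\<in>Basis. f b *\<^sub>R b)" for x
  proof -
    have "f x = f (\<Sum>b\<in>Basis. (x \<bullet> b) *\<^sub>R b)" by (simp add: euclidean_representation)
    also have "\<dots> = (\<Sum>b\<in>Basis. (x \<bullet> b) * f b)" by (simp add: sum scale)
    finally show ?thesis by (simp add: inner_sum_right mult.commute)
  qed
  then have "(\<lambda>x. complex_of_real (f x)) = (\<lambda>x. complex_of_real (x \<bullet> (\<Sum>b\<in>Basis. f b *\<^sub>R b)))" by metis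
  then show ?case using poly_fun_homog[OF homog_inner] by metis
next
  case (const c)
  show ?case by (rule poly_fun_homog[OF homog_const])
next
  case (add f g)
  then show ?case using poly_fun_add by simp
next
  case (mult f g)
  then show ?case using poly_fun_mult by simp
qed

lemma harm_sum_poly_fun: "poly_fun P \<Longrightarrow> harm_sum P"
  by (induction rule: poly_fun.induct) (auto intro: harm_sum_homog harm_sum_add)

lemma harm_sum_polynomial_function:
  assumes "polynomial_function (p :: 'a::euclidean_space \<Rightarrow> complex)"
  shows "harm_sum p"
proof -
  have "real_polynomial_function (Re \<circ> p)" "real_polynomial_function (Im \<circ> p)"
    using assms bounded_linear_Re bounded_linear_Im unfolding polynomial_function_def by blast+
  then have "poly_fun (\<lambda>x. complex_of_real (Re (p x)))" "poly_fun (\<lambda>x. complex_of_real (Im (p x)))"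
    by (auto dest: poly_fun_real_polynomial)
  then have "harm_sum (\<lambda>x. complex_of_real (Re (p x)) + \<i> * complex_of_real (Im (p x)))"
    by (intro harm_sum_add harm_sum_cmult harm_sum_poly_fun)
  then show ?thesis by (simp flip: complex_eq)
qed

text \<open>The L2 closure of the finite sums of spherical harmonics. It is shown to contain
  continuous functions, indicators, simple functions and finally every square integrable
  function.\<close>

definition harm_approx :: "('a::euclidean_space \<Rightarrow> complex) \<Rightarrow> bool" where
  "harm_approx f \<longleftrightarrow> L2S f \<and> (\<forall>e>0. \<exists>h. harm_sum h \<and> nsq (\<lambda>x. f x - h x) < e)"

lemma L2S_harm_sum: "harm_sum h \<Longrightarrow> L2S h"
proof -
  assume "harm_sum h"
  then obtain N g where g: "\<And>k. harm k (g k)" "\<And>x. norm x = 1 \<Longrightarrow> h x = (\<Sum>k\<le>N. g k x)"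
    unfolding harm_sum_def by blast
  have "L2S (\<lambda>x. \<Sum>k\<le>N. g k x)" by (intro L2S_sum harm_L2S[OF g(1)])
  then show "L2S h" using L2S_cong[of h "\<lambda>x. \<Sum>k\<le>N. g k x", OF g(2)] by blast
qed

lemma harm_approx_limit:
  assumes f: "L2S f" and lim: "\<And>e. e > 0 \<Longrightarrow> \<exists>g. harm_approx g \<and> nsq (\<lambda>x. f x - g x) < e"
  shows "harm_approx f"
  unfolding harm_approx_def
proof (intro conjI allI impI f)
  fix e :: real assume "e > 0"
  then obtain g where g: "harm_approx g" "nsq (\<lambda>x. f x - g x) < e / 4" using lim[of "e / 4"] by auto
  then obtain h where h: "harm_sum h" "nsq (\<lambda>x. g x - h x) < e / 4" using \<open>e > 0\<close> unfolding harm_approx_def by (metis divide_pos_pos zero_less_numeral)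
  have "nsq (\<lambda>x. (f x - g x) + (g x - h x)) \<le> 2 * nsq (\<lambda>x. f x - g x) + 2 * nsq (\<lambda>x. g x - h x)"
    using g(1) by (intro nsq_triangle L2S_diff f L2S_harm_sum[OF h(1)]) (simp_all add: harm_approx_def)
  then have "nsq (\<lambda>x. f x - h x) < e" using g h by simp
  with h show "\<exists>h. harm_sum h \<and> nsq (\<lambda>x. f x - h x) < e" by blast
qed

lemma harm_approx_add:
  assumes "harm_approx f" "harm_approx g"
  shows "harm_approx (\<lambda>x. f x + g x)"
  unfolding harm_approx_def
proof (intro conjI allI impI)
  have L: "L2S f" "L2S g" using assms by (auto simp: harm_approx_def)
  then show "L2S (\<lambda>x. f x + g x)" by (rule L2S_add)
  fix e :: real assume "e > 0"
  then have "e / 4 > 0" by simp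
  then obtain h k where h: "harm_sum h" "nsq (\<lambda>x. f x - h x) < e / 4" "harm_sum k" "nsq (\<lambda>x. g x - k x) < e / 4"
    using assms unfolding harm_approx_def by meson
  have "nsq (\<lambda>x. (f x - h x) + (g x - k x)) \<le> 2 * nsq (\<lambda>x. f x - h x) + 2 * nsq (\<lambda>x. g x - k x)"
    by (intro nsq_triangle L2S_diff L L2S_harm_sum h)
  also have "(\<lambda>x. (f x - h x) + (g x - k x)) = (\<lambda>x. (f x + g x) - (h x + k x))" by (simp add: algebra_simps)
  finally have "nsq (\<lambda>x. (f x + g x) - (h x + k x)) < e" using h by simp
  then show "\<exists>h. harm_sum h \<and> nsq (\<lambda>x. (f x + g x) - h x) < e" using harm_sum_add[OF h(1,3)] by blast
qed

lemma harm_approx_cmult: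
  assumes "harm_approx f"
  shows "harm_approx (\<lambda>x. c * f x)"
  unfolding harm_approx_def
proof (intro conjI allI impI)
  show "L2S (\<lambda>x. c * f x)" using assms by (auto simp: harm_approx_def intro: L2S_cmult)
  fix e :: real assume e: "e > 0"
  then have "e / ((cmod c)\<^sup>2 + 1) > 0" by (simp add: add_nonneg_pos)
  then obtain h where h: "harm_sum h" "nsq (\<lambda>x. f x - h x) < e / ((cmod c)\<^sup>2 + 1)"
    using assms unfolding harm_approx_def by meson
  have "nsq (\<lambda>x. c * f x - c * h x) = (cmod c)\<^sup>2 * nsq (\<lambda>x. f x - h x)"
    using nsq_cmult[of c "\<lambda>x. f x - h x"] by (simp add: right_diff_distrib)
  also have "\<dots> \<le> ((cmod c)\<^sup>2 + 1) * nsq (\<lambda>x. f x - h x)" by (intro mult_right_mono) auto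
  also have "\<dots> < e" using h(2) by (simp add: pos_less_divide_eq add_nonneg_pos mult.commute)
  finally show "\<exists>h. harm_sum h \<and> nsq (\<lambda>x. c * f x - h x) < e" using harm_sum_cmult[OF h(1)] by blast
qed

lemma harm_approx_sum: "(\<And>i. i \<in> A \<Longrightarrow> harm_approx (f i)) \<Longrightarrow> harm_approx (\<lambda>x. \<Sum>i\<in>A. f i x)"
proof (induction A rule: infinite_finite_induct)
  case (insert a A)
  then show ?case by (simp add: harm_approx_add)
qed (auto intro!: harm_approx_cmult[of _ 0, simplified] exI[of _ "\<lambda>x. 0"] harm_sum_homog[OF homog_zero] simp: harm_approx_def L2S_zero nsq_def)

lemma harm_approx_cong:
  assumes "harm_approx f" "\<And>x. norm x = 1 \<Longrightarrow> f x = g x"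
  shows "harm_approx g"
proof -
  have "nsq (\<lambda>x. f x - h x) = nsq (\<lambda>x. g x - h x)" for h by (rule nsq_cong) (simp add: assms)
  then show ?thesis using assms(1) L2S_cong[of f g, OF assms(2)] by (simp add: harm_approx_def)
qed

lemma nsq_le_const:
  assumes "L2S (f :: 'a::euclidean_space \<Rightarrow> complex)" "\<And>x. norm x = 1 \<Longrightarrow> cmod (f x) \<le> e"
  shows "nsq f \<le> measure sphere_measure (sphere (0::'a) 1) * e\<^sup>2"
proof -
  have "nsq f \<le> (LINT x|(sphere_measure :: 'a measure). e\<^sup>2)"
    unfolding nsq_def
  proof (rule integral_mono)
    show "integrable sphere_measure (\<lambda>x. (cmod (f x))\<^sup>2)" using assms by (simp add: L2S_def)
    show "integrable sphere_measure (\<lambda>x::'a. e\<^sup>2)" by (rule integrable_sphere_continuous) simp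
  qed (use assms(2) in \<open>auto intro: power_mono\<close>)
  then show ?thesis by simp
qed

lemma harm_approx_continuous:
  fixes f :: "'a::euclidean_space \<Rightarrow> complex"
  assumes "continuous_on UNIV f"
  shows "harm_approx f"
  unfolding harm_approx_def
proof (intro conjI allI impI)
  show f: "L2S f" by (rule L2S_continuous[OF assms])
  define V where "V = measure sphere_measure (sphere (0::'a) 1)"
  have V: "V \<ge> 0" by (simp add: V_def)
  fix e :: real assume e: "e > 0"
  \<comment> \<open>A uniform error below delta costs at most V delta^2 = e V / (V + 1) < e in
    \<open>nsq\<close>.\<close>
  define \<delta> where "\<delta> = sqrt (e / (V + 1))"
  have \<delta>: "\<delta> > 0" using e V by (simp add: \<delta>_def)
  have \<delta>2: "\<delta>\<^sup>2 = e / (V + 1)" using e V by (simp add: \<delta>_def)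
  obtain p where p: "polynomial_function p" "\<And>x. x \<in> sphere 0 1 \<Longrightarrow> norm (f x - p x) < \<delta>"
    using Stone_Weierstrass_polynomial_function[OF compact_sphere[of 0 1] continuous_on_subset[OF assms subset_UNIV] \<delta>] by blast
  have "nsq (\<lambda>x. f x - p x) \<le> V * \<delta>\<^sup>2" unfolding V_def
    using p(2) by (intro nsq_le_const L2S_diff f L2S_harm_sum harm_sum_polynomial_function p(1)) (auto intro: less_imp_le)
  also have "\<dots> < e" unfolding \<delta>2 using e V by (simp add: field_simps)
  finally show "\<exists>h. harm_sum h \<and> nsq (\<lambda>x. f x - h x) < e" using harm_sum_polynomial_function[OF p(1)] by blast
qed

text \<open>Regularity gives a compact K inside A and an open U around A with U - K of measure below
  e. A Urysohn function between K and U differs from the indicator of A only on U - K, and there by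
  at most 1.\<close>

lemma harm_approx_indicator:
  fixes A :: "'a::euclidean_space set"
  assumes A: "A \<in> sets borel"
  shows "harm_approx (\<lambda>x. complex_of_real (indicator A x))"
proof (rule harm_approx_limit)
  have iA: "(\<lambda>x. complex_of_real (indicator B x)) \<in> borel_measurable sphere_measure" if "B \<in> sets borel" for B :: "'a set"
  proof -
    note [measurable] = that
    show ?thesis by (intro borel_measurable_sphere_measureI) measurable
  qed
  show L: "L2S (\<lambda>x. complex_of_real (indicator A x))"
    by (rule L2S_bounded[OF iA[OF A], of 1]) (auto simp: indicator_def)
  fix e :: real assume e: "e > 0"
  \<comment> \<open>Regularity is stated for measures on the Borel sets of the whole space, so the
    surface measure is pushed forward there.\<close>
  define M where "M = distr (sphere_measure :: 'a measure) borel (\<lambda>x. x)"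
  have idm: "(\<lambda>x. x) \<in> borel_measurable (sphere_measure :: 'a measure)"
    by (intro borel_measurable_sphere_measureI) simp
  interpret S: finite_measure "sphere_measure :: 'a measure" by (rule finite_measure_sphere)
  interpret M: finite_measure M unfolding M_def by (rule S.finite_measure_distr[OF idm])
  have sM: "sets M = sets borel" by (simp add: M_def)
  have fin: "emeasure M (space M) \<noteq> \<infinity>" by simp
  have "emeasure M A < emeasure M A + ennreal (e / 2)" using e by (simp add: M.emeasure_eq_measure ennreal_less_iff flip: ennreal_plus)
  then obtain U where U: "A \<subseteq> U" "open U" "emeasure M U < emeasure M A + ennreal (e / 2)"
    using outer_regular[OF sM fin A] by (auto simp: INF_less_iff)
  have "\<exists>K. K \<subseteq> A \<and> compact K \<and> emeasure M A < emeasure M K + ennreal (e / 2)"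
  \<comment> \<open>\<open>inner_regular\<close> states a supremum: if no compact K came within e /
    2, the measure of A itself would be at most that of A minus e / 2.\<close>
  proof (rule ccontr)
    assume "\<not> ?thesis"
    then have "emeasure M K + ennreal (e / 2) \<le> emeasure M A" if "K \<subseteq> A" "compact K" for K
      using that by (meson not_less)
    then have m: "measure M K + e / 2 \<le> measure M A" if "K \<subseteq> A" "compact K" for K
      using that e by (simp add: M.emeasure_eq_measure ennreal_le_iff flip: ennreal_plus)
    have "emeasure M K \<le> ennreal (measure M A - e / 2)" if "K \<subseteq> A" "compact K" for K
      unfolding M.emeasure_eq_measure by (rule ennreal_leI) (use m[OF that] in simp)
    then have "emeasure M A \<le> ennreal (measure M A - e / 2)"
      unfolding inner_regular[OF sM fin A] by (intro SUP_least) blast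
    moreover have "measure M A \<ge> e / 2"
      using m[of "{}"] by simp
    ultimately show False using e by (simp add: M.emeasure_eq_measure)
  qed
  then obtain K where K: "K \<subseteq> A" "compact K" "emeasure M A < emeasure M K + ennreal (e / 2)" by blast
  have "K \<inter> - U = {}" using K U by auto
  then obtain \<phi> :: "'a \<Rightarrow> real" where \<phi>: "continuous_on UNIV \<phi>" "\<And>x. \<phi> x \<in> closed_segment 1 0"
      "\<And>x. x \<in> K \<Longrightarrow> \<phi> x = 1" "\<And>x. x \<in> - U \<Longrightarrow> \<phi> x = 0"
    using Urysohn[OF compact_imp_closed[OF K(2)] closed_Compl[OF U(2)]] by metis
  have \<phi>01: "0 \<le> \<phi> x" "\<phi> x \<le> 1" for x using \<phi>(2)[of x] by (auto simp: closed_segment_eq_real_ivl)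
  have cont: "continuous_on UNIV (\<lambda>x. complex_of_real (\<phi> x))" using \<phi>(1) by (intro continuous_intros)
  have bK: "K \<in> sets borel" "U \<in> sets borel" by (rule borel_compact[OF K(2)], rule borel_open[OF U(2)])
  have "nsq (\<lambda>x. complex_of_real (indicator A x) - complex_of_real (\<phi> x)) \<le> (LINT x|(sphere_measure :: 'a measure). indicator (U - K) x)"
    unfolding nsq_def
  proof (rule integral_mono)
    show "integrable sphere_measure (\<lambda>x. (cmod (complex_of_real (indicator A x) - complex_of_real (\<phi> x)))\<^sup>2)"
      using L2S_diff[OF L L2S_continuous[OF cont]] by (simp add: L2S_def)
    have "(\<lambda>x. indicator (U - K) x :: real) \<in> borel_measurable sphere_measure"
      using bK by (intro borel_measurable_sphere_measureI) auto
    then show "integrable sphere_measure (\<lambda>x. indicator (U - K) x :: real)"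
      by (intro S.integrable_const_bound[where B=1]) (auto simp: indicator_def)
    fix x :: 'a
    have "(cmod (complex_of_real (indicator A x - \<phi> x)))\<^sup>2 \<le> indicator (U - K) x"
    proof (cases "x \<in> U - K")
      case True
      then show ?thesis unfolding norm_of_real using \<phi>01[of x] by (auto simp: indicator_def abs_square_le_1 abs_le_iff power_le_one)
    next
      case False
      then have "x \<in> K \<or> x \<in> - U" by auto
      then show ?thesis using \<phi>(3,4)[of x] K U by (auto simp: indicator_def)
    qed
    then show "(cmod (complex_of_real (indicator A x) - complex_of_real (\<phi> x)))\<^sup>2 \<le> indicator (U - K) x" by simp
  qed
  also have "\<dots> = measure M (U - K)"
  proof -
    have "(LINT x|(sphere_measure :: 'a measure). indicator (U - K) x) = (LINT x|M. indicator (U - K) x :: real)"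
      unfolding M_def using bK idm by (subst integral_distr) auto
    then show ?thesis using bK by (simp add: sM)
  qed
  also have "\<dots> = measure M U - measure M K"
    using bK K U by (intro M.finite_measure_Diff) (auto simp: sM)
  also have "\<dots> < e"
  proof -
    have "measure M U < measure M A + e / 2" "measure M A < measure M K + e / 2"
      using U(3) K(3) e by (auto simp: M.emeasure_eq_measure ennreal_less_iff simp flip: ennreal_plus)
    then show ?thesis by simp
  qed
  finally show "\<exists>g. harm_approx g \<and> nsq (\<lambda>x. complex_of_real (indicator A x) - g x) < e"
    using harm_approx_continuous[OF cont] by blast
qed

text \<open>Simple functions converging pointwise with |s_i| <= 2 |f| converge in L2 by dominated
  convergence, and each is a finite combination of indicators.\<close>

lemma L2S_harm_approx:
  fixes f :: "'a::euclidean_space \<Rightarrow> complex"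
  assumes f: "L2S f"
  shows "harm_approx f"
proof (rule harm_approx_limit[OF f])
  obtain s where s0: "\<forall>i. simple_function sphere_measure (s i)"
      "\<forall>x\<in>space sphere_measure. (\<lambda>i. s i x) \<longlonglongrightarrow> f x"
      "\<forall>i. \<forall>x\<in>space sphere_measure. dist (s i x) 0 \<le> 2 * dist (f x) 0"
    using borel_measurable_implies_sequence_metric[OF L2S_measurable[OF f], of 0] by blast
  then have s: "\<And>i. simple_function sphere_measure (s i)" "\<And>x. norm x = 1 \<Longrightarrow> (\<lambda>i. s i x) \<longlonglongrightarrow> f x"
      "\<And>i x. norm x = 1 \<Longrightarrow> dist (s i x) 0 \<le> 2 * dist (f x) 0"
    by auto
  have sm: "s i \<in> borel_measurable sphere_measure" for i by (rule borel_measurable_simple_function[OF s(1)])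
  have fm: "f \<in> borel_measurable sphere_measure" by (rule L2S_measurable[OF f])
  have ap: "harm_approx (s i)" for i
  proof (rule harm_approx_cong)
    have mem: "s i -` {y} \<inter> space sphere_measure \<in> sets borel" for y
    proof -
      have "s i -` {y} \<inter> space sphere_measure \<in> sets (sphere_measure :: 'a measure)"
        by (rule simple_functionD(2)[OF s(1)])
      then show ?thesis by (simp add: sets_sphere_measure sets_restrict_space_iff)
    qed
    show "harm_approx (\<lambda>x. \<Sum>y\<in>s i ` space sphere_measure. y * complex_of_real (indicator (s i -` {y} \<inter> space sphere_measure) x))"
      by (intro harm_approx_sum harm_approx_cmult harm_approx_indicator mem)
    fix x :: 'a assume "norm x = 1"
    then have x: "x \<in> space sphere_measure" by simp
    have "(\<Sum>y\<in>s i ` space sphere_measure. y * complex_of_real (indicator (s i -` {y} \<inter> space sphere_measure) x))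
        = (\<Sum>y\<in>s i ` space sphere_measure. indicator (s i -` {y} \<inter> space sphere_measure) x *\<^sub>R y)"
      by (rule sum.cong[OF refl]) (simp only: scaleR_conv_of_real mult.commute)
    also have "\<dots> = s i x"
      by (rule simple_function_indicator_representation_banach[OF s(1) x, symmetric])
    finally show "(\<Sum>y\<in>s i ` space sphere_measure. y * complex_of_real (indicator (s i -` {y} \<inter> space sphere_measure) x)) = s i x" .
  qed
  have "(\<lambda>i. nsq (\<lambda>x. f x - s i x)) \<longlonglongrightarrow> (LINT x|(sphere_measure :: 'a measure). 0)"
    unfolding nsq_def
  \<comment> \<open>The constant 9 is (1 + 2)^2, from |f - s_i| <= |f| + 2 |f|.\<close>
  proof (rule integral_dominated_convergence[where w = "\<lambda>x. 9 * (cmod (f x))\<^sup>2"])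
    show "integrable sphere_measure (\<lambda>x. 9 * (cmod (f x))\<^sup>2)" using f by (simp add: L2S_def)
    show "(\<lambda>x. (cmod (f x - s i x))\<^sup>2) \<in> borel_measurable sphere_measure" for i using sm fm by measurable
    show "AE x in sphere_measure. (\<lambda>i. (cmod (f x - s i x))\<^sup>2) \<longlonglongrightarrow> 0"
    proof (rule AE_I2)
      fix x :: 'a assume "x \<in> space sphere_measure"
      then have "(\<lambda>i. s i x) \<longlonglongrightarrow> f x" using s(2)[of x] by simp
      then have "(\<lambda>i. (cmod (f x - s i x))\<^sup>2) \<longlonglongrightarrow> (cmod (f x - f x))\<^sup>2" by (intro tendsto_intros)
      then show "(\<lambda>i. (cmod (f x - s i x))\<^sup>2) \<longlonglongrightarrow> 0"
        by (simp only: diff_self norm_zero power_zero_numeral)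
    qed
    show "AE x in sphere_measure. norm ((cmod (f x - s i x))\<^sup>2) \<le> 9 * (cmod (f x))\<^sup>2" for i
    proof (rule AE_I2)
      fix x :: 'a assume "x \<in> space sphere_measure"
      then have "cmod (s i x) \<le> 2 * cmod (f x)" using s(3)[of x i] by simp
      then have "cmod (f x - s i x) \<le> 3 * cmod (f x)" using norm_triangle_ineq4[of "f x" "s i x"] by linarith
      then have "(cmod (f x - s i x))\<^sup>2 \<le> (3 * cmod (f x))\<^sup>2" by (intro power_mono) auto
      then show "norm ((cmod (f x - s i x))\<^sup>2) \<le> 9 * (cmod (f x))\<^sup>2" by (simp add: power_mult_distrib)
    qed
  qed simp
  then have lim: "(\<lambda>i. nsq (\<lambda>x. f x - s i x)) \<longlonglongrightarrow> 0" by simp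
  fix e :: real assume "e > 0"
  then obtain i where "nsq (\<lambda>x. f x - s i x) < e"
    using order_tendstoD(2)[OF lim, of e] by (auto dest: eventually_happens)
  with ap show "\<exists>g. harm_approx g \<and> nsq (\<lambda>x. f x - g x) < e" by blast
qed

text \<open>The partial sums stay below \<open>nsq f\<close> because residuals have non-negative
  norm. Conversely, a finite sum of harmonics within e of f is beaten by the projections of the same
  degrees.\<close>

lemma parseval:
  assumes d: "DIM('a) \<ge> 2" and f: "L2S (f :: 'a::euclidean_space \<Rightarrow> complex)"
  shows "(\<lambda>k. nsq (harm_proj k f)) sums nsq f"
proof -
  have le: "(\<Sum>k<n. nsq (harm_proj k f)) \<le> nsq f" for n
    using nsq_approx[OF d f, of "{..<n}" "\<lambda>k. harm_proj k f"] harm_proj(1)[OF d f] nsq_nonneg[of "\<lambda>x. f x - (\<Sum>k<n. harm_proj k f x)"]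
    by (simp add: nsq_def[of "\<lambda>x. 0"])
  have sm: "summable (\<lambda>k. nsq (harm_proj k f))"
    by (rule summableI_nonneg_bounded[OF nsq_nonneg le])
  have "nsq f \<le> suminf (\<lambda>k. nsq (harm_proj k f))"
  proof (rule field_le_epsilon)
    fix e :: real assume "e > 0"
    then obtain h where h: "harm_sum h" "nsq (\<lambda>x. f x - h x) < e" using L2S_harm_approx[OF f] by (auto simp: harm_approx_def)
    then obtain N g where g: "\<And>k. harm k (g k)" "\<And>x. norm x = 1 \<Longrightarrow> h x = (\<Sum>k\<le>N. g k x)"
      unfolding harm_sum_def by blast
    have "nsq (\<lambda>x. f x - (\<Sum>k\<le>N. g k x)) = nsq (\<lambda>x. f x - h x)" by (rule nsq_cong) (simp add: g(2))
    moreover have "(\<Sum>k\<le>N. nsq (\<lambda>x. harm_proj k f x - g k x)) \<ge> 0" by (intro sum_nonneg) simp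
    ultimately have "nsq f \<le> (\<Sum>k\<le>N. nsq (harm_proj k f)) + e"
      using nsq_approx[OF d f, of "{..N}" g] g(1) h(2) by simp
    also have "(\<Sum>k\<le>N. nsq (harm_proj k f)) \<le> suminf (\<lambda>k. nsq (harm_proj k f))"
      by (intro sum_le_suminf sm) auto
    finally show "nsq f \<le> suminf (\<lambda>k. nsq (harm_proj k f)) + e" by simp
  qed
  moreover have "suminf (\<lambda>k. nsq (harm_proj k f)) \<le> nsq f" by (rule suminf_le_const[OF sm le])
  ultimately show ?thesis using sm by (simp add: sums_iff)
qed

section \<open>The energy of a function\<close>

text \<open>The bound is uniform in xi: it turns L2 convergence into pointwise convergence of
  transforms and also provides the dominating constant on the ball.\<close>

lemma cmod_fourier_ext:
  assumes "L2S (f :: 'a::euclidean_space \<Rightarrow> complex)"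
  shows "(cmod (fourier_ext f \<xi>))\<^sup>2 \<le> measure sphere_measure (sphere (0::'a) 1) * nsq f"
proof -
  have "cmod (fourier_ext f \<xi>) \<le> (LINT x|sphere_measure. cmod (f x * exp (- \<i> * complex_of_real (x \<bullet> \<xi>))))"
    unfolding fourier_ext_def by (rule integral_norm_bound)
  also have "\<dots> = (LINT x|sphere_measure. cmod (f x))" by (simp add: norm_mult)
  finally have "(cmod (fourier_ext f \<xi>))\<^sup>2 \<le> (LINT x|sphere_measure. cmod (f x))\<^sup>2" by (intro power_mono) auto
  also have "\<dots> \<le> measure sphere_measure (sphere (0::'a) 1) * nsq f" by (rule integral_norm_le_nsq(2)[OF assms])
  finally show ?thesis .
qed

lemma integrable_fourier:
  assumes "L2S f"
  shows "integrable sphere_measure (\<lambda>x. f x * exp (- \<i> * complex_of_real (x \<bullet> \<xi>)))"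
proof (rule Bochner_Integration.integrable_bound[OF integral_norm_le_nsq(1)[OF assms]])
  have [measurable]: "f \<in> borel_measurable sphere_measure" by (rule L2S_measurable[OF assms])
  have [measurable]: "(\<lambda>x. exp (- \<i> * complex_of_real (x \<bullet> \<xi>))) \<in> borel_measurable sphere_measure"
    by (intro borel_measurable_sphere_measureI borel_measurable_continuous_onI continuous_intros)
  show "(\<lambda>x. f x * exp (- \<i> * complex_of_real (x \<bullet> \<xi>))) \<in> borel_measurable sphere_measure" by measurable
qed (simp add: norm_mult)

lemma fourier_ext_diff: "L2S f \<Longrightarrow> L2S g \<Longrightarrow> fourier_ext (\<lambda>x. f x - g x) \<xi> = fourier_ext f \<xi> - fourier_ext g \<xi>"
  unfolding fourier_ext_def left_diff_distrib by (intro Bochner_Integration.integral_diff integrable_fourier)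

lemma fourier_ext_sum: "(\<And>i. i \<in> A \<Longrightarrow> L2S (f i)) \<Longrightarrow> fourier_ext (\<lambda>x. \<Sum>i\<in>A. f i x) \<xi> = (\<Sum>i\<in>A. fourier_ext (f i) \<xi>)"
  unfolding fourier_ext_def sum_distrib_right by (intro Bochner_Integration.integral_sum integrable_fourier)

definition radial :: "nat \<Rightarrow> nat \<Rightarrow> real \<Rightarrow> complex" where
  "radial d k r = complex_of_real (sphere_const d * bessel_E (bessel_nu d + k) ((r / 2)\<^sup>2)) * (- \<i> / 2) ^ k"

lemma fourier_ext_harm': "DIM('a) \<ge> 2 \<Longrightarrow> harm k (Y :: 'a::euclidean_space \<Rightarrow> complex) \<Longrightarrow>
    fourier_ext Y \<xi> = radial DIM('a) k (norm \<xi>) * Y \<xi>"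
  by (simp add: fourier_ext_harm radial_def)

lemma continuous_on_radial: "continuous_on A (radial d k)"
  unfolding radial_def[abs_def]
  by (intro continuous_intros continuous_on_compose2[OF continuous_on_bessel_E[of UNIV]]) auto

text \<open>The squared constants are 4 pi^d and 4^(-k), and r^(d+2k-1) is 2^(d+2k-1) times the same
  power of r / 2; together they give 2 (2 pi)^d, and Lommel's integral contributes rho / 2 times
  Lambda_k.\<close>

lemma radial_integral:
  assumes "\<rho> > 0" "d \<ge> 1"
  shows "(LINT r:{0..\<rho>}|lborel. complex_of_real (r ^ (k + k + d - 1)) * (radial d k r * cnj (radial d k r)))
     = complex_of_real ((2 * pi) ^ d * \<rho> * Lambda d k \<rho>)"
proof -
  have C: "(sphere_const d)\<^sup>2 = 4 * pi ^ d"
  proof -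
    have "(pi powr (d / 2))\<^sup>2 = pi powr (d / 2 + d / 2)" by (simp only: power2_eq_square powr_add)
    also have "\<dots> = pi ^ d" by (simp add: powr_realpow)
    finally show ?thesis using assms by (simp add: sphere_const_eq power_mult_distrib)
  qed
  have "complex_of_real (r ^ (k + k + d - 1)) * (radial d k r * cnj (radial d k r)) =
     complex_of_real (2 * (2 * pi) ^ d * ((r / 2) ^ (d + 2 * k - 1) * (bessel_E (bessel_nu d + k) ((r / 2)\<^sup>2))\<^sup>2))" for r
  proof -
    define E where "E = bessel_E (bessel_nu d + k) ((r / 2)\<^sup>2)"
    have n: "cmod ((- \<i> / 2) ^ k) = (1 / 2) ^ k" by (simp add: norm_power norm_divide)
    have "radial d k r * cnj (radial d k r) = complex_of_real ((cmod (radial d k r))\<^sup>2)"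
      by (rule complex_norm_square[symmetric])
    also have "(cmod (radial d k r))\<^sup>2 = (sphere_const d)\<^sup>2 * E\<^sup>2 * ((1 / 2) ^ k)\<^sup>2"
      unfolding radial_def E_def[symmetric] norm_mult n norm_of_real by (simp add: power_mult_distrib)
    finally have 1: "radial d k r * cnj (radial d k r) = complex_of_real ((sphere_const d)\<^sup>2 * E\<^sup>2 * ((1 / 2) ^ k)\<^sup>2)" .
    have "k + k + d - 1 = d + 2 * k - 1" by simp
    moreover have "r ^ (d + 2 * k - 1) = 2 ^ (d + 2 * k - 1) * (r / 2) ^ (d + 2 * k - 1)" by (simp add: power_divide)
    moreover have "(2::real) ^ (d + 2 * k - 1) * (4 * ((1 / 2) ^ k)\<^sup>2) = 2 * 2 ^ d"
    proof -
      have "d + 2 * k - 1 + 1 = d + 2 * k" using assms by simp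
      then have "(2::real) ^ (d + 2 * k - 1) * 2 = 2 ^ d * (2 ^ k)\<^sup>2" 
        by (metis power_add power_one_right power_mult mult.commute)
      moreover have "((2::real) ^ k)\<^sup>2 * ((1 / 2) ^ k)\<^sup>2 = 1" by (simp add: power_one_over flip: power_mult_distrib)
      ultimately show ?thesis by (simp add: algebra_simps) (metis mult.assoc mult.commute mult.right_neutral)
    qed
    ultimately have "r ^ (k + k + d - 1) * ((sphere_const d)\<^sup>2 * E\<^sup>2 * ((1 / 2) ^ k)\<^sup>2) = 2 * (2 * pi) ^ d * ((r / 2) ^ (d + 2 * k - 1) * E\<^sup>2)"
      unfolding C power_mult_distrib by (simp add: mult_ac)
    then show ?thesis unfolding 1 of_real_mult[symmetric] E_def by (rule arg_cong)
  qed
  then have "(LINT r:{0..\<rho>}|lborel. complex_of_real (r ^ (k + k + d - 1)) * (radial d k r * cnj (radial d k r)))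
     = complex_of_real (LINT r:{0..\<rho>}|lborel. 2 * (2 * pi) ^ d * ((r / 2) ^ (d + 2 * k - 1) * (bessel_E (bessel_nu d + k) ((r / 2)\<^sup>2))\<^sup>2))"
    by (simp only: set_integral_complex_of_real)
  also have "\<dots> = complex_of_real (2 * (2 * pi) ^ d * (\<rho> / 2 * Lambda d k \<rho>))"
    by (simp only: set_integral_mult_right Lambda_integral[OF assms])
  finally show ?thesis by simp
qed

text \<open>Reconciles the open ball of \<open>energy\<close> with the closed ball of the polar
  coordinates.\<close>

lemma AE_lborel_norm_neq:
  assumes "\<rho> > 0"
  shows "AE x in lborel. norm (x :: 'a::euclidean_space) \<noteq> \<rho>"
proof -
  have "emeasure lborel (cball (0::'a) \<rho> - ball 0 \<rho>) = emeasure lborel (cball (0::'a) \<rho>) - emeasure lborel (ball (0::'a) \<rho>)"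
    using assms by (intro emeasure_Diff) (auto simp: emeasure_ball)
  also have "\<dots> = 0" using assms by (simp add: emeasure_ball emeasure_cball)
  finally have "cball (0::'a) \<rho> - ball 0 \<rho> \<in> null_sets lborel" by (intro null_setsI) auto
  then show ?thesis by (rule AE_I'[of "cball 0 \<rho> - ball 0 \<rho>"]) auto
qed

lemma borel_measurable_indicator_cmod:
  assumes [measurable]: "g \<in> borel_measurable M" "A \<in> sets M"
  shows "(\<lambda>x. indicat_real A x *\<^sub>R (cmod (g x))\<^sup>2) \<in> borel_measurable M"
  by measurable

text \<open>The product of p_k with the conjugate of p_l is homogeneous of degree k + l, so polar
  coordinates split off the factor \<open>ip (p k) (p l)\<close>. The mixed terms vanish and the
  diagonal ones are radial integrals.\<close>

lemma energy_harm_sum: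
  fixes p :: "nat \<Rightarrow> 'a::euclidean_space \<Rightarrow> complex"
  assumes d: "DIM('a) \<ge> 2" and \<rho>: "\<rho> > 0" and K: "finite K" and p: "\<And>k. harm k (p k)"
  shows "(LINT x:ball 0 \<rho>|lborel. (cmod (\<Sum>k\<in>K. radial DIM('a) k (norm x) * p k x))\<^sup>2)
    = (2 * pi) ^ DIM('a) * \<rho> * (\<Sum>k\<in>K. Lambda DIM('a) k \<rho> * nsq (p k))"
proof -
  define u where "u = (\<lambda>x. \<Sum>k\<in>K. radial DIM('a) k (norm x) * p k x)"
  define t where "t = (\<lambda>k l x. (radial DIM('a) k (norm x) * cnj (radial DIM('a) l (norm x))) * (p k x * cnj (p l x)))"
  have contp: "continuous_on UNIV (p k)" for k using p[of k] by (auto simp: harm_def intro: continuous_on_homog)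
  have contr: "continuous_on UNIV (\<lambda>x::'a. radial DIM('a) k (norm x))" for k
    by (intro continuous_on_compose2[OF continuous_on_radial[of UNIV]] continuous_intros) auto
  have contu: "continuous_on UNIV u" unfolding u_def by (intro continuous_intros contp contr)
  have contt: "continuous_on UNIV (t k l)" for k l unfolding t_def by (intro continuous_intros contp contr)
  have tint: "(LINT x:cball 0 \<rho>|lborel. t k l x) = (if k = l then complex_of_real ((2 * pi) ^ DIM('a) * \<rho> * Lambda DIM('a) k \<rho> * nsq (p k)) else 0)" for k l
  proof -
    have h: "homog (k + l) (\<lambda>x. p k x * cnj (p l x))"
      using p by (intro homog_mult homog_cnj) (auto simp: harm_def)
    have "(LINT x:cball 0 \<rho>|lborel. t k l x) = (LINT r:{0..\<rho>}|lborel. complex_of_real (r ^ (k + l + DIM('a) - 1)) * (radial DIM('a) k r * cnj (radial DIM('a) l r))) * ip (p k) (p l)"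
      unfolding t_def ip_def using \<rho>
      by (intro polar_homog[OF h] continuous_intros continuous_on_radial) auto
    then show ?thesis
      using radial_integral[OF \<rho>, of "DIM('a)" k] d harm_orthogonal_ip[OF d p p, of k l] by (auto simp: ip_self)
  qed
  have "complex_of_real (LINT x:ball 0 \<rho>|lborel. (cmod (u x))\<^sup>2) = complex_of_real (LINT x:cball 0 \<rho>|lborel. (cmod (u x))\<^sup>2)"
  proof -
    have [measurable]: "u \<in> borel_measurable borel" by (rule borel_measurable_continuous_onI[OF contu])
    have "(LINT x:ball 0 \<rho>|lborel. (cmod (u x))\<^sup>2) = (LINT x:cball 0 \<rho>|lborel. (cmod (u x))\<^sup>2)"
      unfolding set_lebesgue_integral_def
    proof (rule integral_cong_AE)
      show "AE x in lborel. indicat_real (ball 0 \<rho>) x *\<^sub>R (cmod (u x))\<^sup>2 = indicat_real (cball 0 \<rho>) x *\<^sub>R (cmod (u x))\<^sup>2"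
        using AE_lborel_norm_neq[OF \<rho>] by eventually_elim (auto simp: indicator_def)
    qed (auto simp del: real_scaleR_def intro!: borel_measurable_indicator_cmod)
    then show ?thesis by simp
  qed
  also have "\<dots> = (LINT x:cball 0 \<rho>|lborel. u x * cnj (u x))"
    by (simp only: set_integral_complex_of_real[symmetric] complex_norm_square)
  also have "\<dots> = (LINT x|lborel. (\<Sum>k\<in>K. \<Sum>l\<in>K. indicator (cball 0 \<rho>) x *\<^sub>R t k l x))"
    unfolding set_lebesgue_integral_def
    by (intro Bochner_Integration.integral_cong refl) (simp add: u_def t_def sum_product mult_ac flip: scaleR_sum_right)
  also have "\<dots> = (\<Sum>k\<in>K. \<Sum>l\<in>K. LINT x:cball 0 \<rho>|lborel. t k l x)"
  proof -
    have "integrable lborel (\<lambda>x. indicator (cball 0 \<rho>) x *\<^sub>R t k l x)" for k l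
      by (intro borel_integrable_compact continuous_on_subset[OF contt]) auto
    then show ?thesis unfolding set_lebesgue_integral_def by simp
  qed
  also have "\<dots> = (\<Sum>k\<in>K. complex_of_real ((2 * pi) ^ DIM('a) * \<rho> * Lambda DIM('a) k \<rho> * nsq (p k)))"
    unfolding tint by (intro sum.cong refl) (simp add: K)
  also have "\<dots> = complex_of_real ((2 * pi) ^ DIM('a) * \<rho> * (\<Sum>k\<in>K. Lambda DIM('a) k \<rho> * nsq (p k)))"
    by (simp add: sum_distrib_left mult.assoc)
  finally show ?thesis unfolding of_real_eq_iff u_def .
qed

text \<open>The partial sums F_n converge to f in L2, hence their transforms converge pointwise;
  these are bounded uniformly on the ball, so the energies converge by dominated
  convergence.\<close>

lemma energy_sums:
  fixes f :: "'a::euclidean_space \<Rightarrow> complex"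
  assumes d: "DIM('a) \<ge> 2" and \<rho>: "\<rho> > 0" and f: "L2S f"
  shows "(\<lambda>k. Lambda DIM('a) k \<rho> * nsq (harm_proj k f)) sums energy f \<rho>"
proof -
  define p where "p = (\<lambda>k. harm_proj k f)"
  have p: "harm k (p k)" for k unfolding p_def by (rule harm_proj[OF d f])
  define V where "V = measure sphere_measure (sphere (0::'a) 1)"
  define F where "F = (\<lambda>n x. \<Sum>k<n. p k x)"
  have LF: "L2S (F n)" for n unfolding F_def by (intro L2S_sum harm_L2S[OF p])
  have nF: "nsq (\<lambda>x. f x - F n x) = nsq f - (\<Sum>k<n. nsq (p k))" for n
    using nsq_approx[OF d f, of "{..<n}" p] p by (simp add: F_def p_def nsq_def[of "\<lambda>x. 0"])
  have "(\<lambda>n. nsq f - (\<Sum>k<n. nsq (p k))) \<longlonglongrightarrow> nsq f - nsq f"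
    using parseval[OF d f] unfolding sums_def p_def by (intro tendsto_intros)
  then have lim: "(\<lambda>n. nsq (\<lambda>x. f x - F n x)) \<longlonglongrightarrow> 0" by (simp add: nF)
  have nFle: "nsq (F n) \<le> nsq f" for n
  proof -
    have "nsq (F n) = (\<Sum>k<n. nsq (p k))"
      unfolding F_def using harm_orthogonal_ip[OF d p p] by (intro nsq_sum_orthogonal harm_L2S[OF p]) auto
    then show ?thesis using nF[of n] nsq_nonneg[of "\<lambda>x. f x - F n x"] by simp
  qed
  have ptw: "(\<lambda>n. fourier_ext (F n) x) \<longlonglongrightarrow> fourier_ext f x" for x
  proof -
    have "(\<lambda>n. (cmod (fourier_ext (\<lambda>x. f x - F n x) x))\<^sup>2) \<longlonglongrightarrow> 0"
    proof (rule tendsto_sandwich[OF _ _ tendsto_const])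
      show "(\<lambda>n. V * nsq (\<lambda>x. f x - F n x)) \<longlonglongrightarrow> 0" using tendsto_mult_right_zero[OF lim] .
      show "\<forall>\<^sub>F n in sequentially. (cmod (fourier_ext (\<lambda>x. f x - F n x) x))\<^sup>2 \<le> V * nsq (\<lambda>x. f x - F n x)"
        unfolding V_def by (intro always_eventually allI cmod_fourier_ext L2S_diff f LF)
    qed auto
    then have "(\<lambda>n. cmod (fourier_ext f x - fourier_ext (F n) x)) \<longlonglongrightarrow> 0"
      using tendsto_real_sqrt[of _ 0] by (fastforce simp: fourier_ext_diff[OF f LF])
    then have "(\<lambda>n. fourier_ext f x - fourier_ext (F n) x) \<longlonglongrightarrow> 0" by (rule tendsto_norm_zero_cancel)
    from tendsto_diff[OF tendsto_const[of "fourier_ext f x"] this] show ?thesis by simp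
  qed
  have FF: "fourier_ext (F n) x = (\<Sum>k<n. radial DIM('a) k (norm x) * p k x)" for n x
    unfolding F_def by (subst fourier_ext_sum) (auto simp: harm_L2S[OF p] fourier_ext_harm'[OF d p])
  have meas: "(\<lambda>x. fourier_ext (F n) x) \<in> borel_measurable borel" for n
  proof (rule borel_measurable_continuous_onI)
    have "continuous_on UNIV (p k)" for k using p[of k] by (auto simp: harm_def intro: continuous_on_homog)
    moreover have "continuous_on UNIV (\<lambda>x::'a. radial DIM('a) k (norm x))" for k
      by (intro continuous_on_compose2[OF continuous_on_radial[of UNIV]] continuous_intros) auto
    ultimately show "continuous_on UNIV (fourier_ext (F n))"
      unfolding FF[abs_def] by (intro continuous_intros)
  qed
  \<comment> \<open>Measurability of the transform of f comes from its being a pointwise limit of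
    continuous functions.\<close>
  have measf: "(\<lambda>x. fourier_ext f x) \<in> borel_measurable borel"
    by (rule borel_measurable_LIMSEQ_metric[OF meas]) (rule ptw)
  have "(\<lambda>n. LINT x|lborel. indicator (ball 0 \<rho>) x *\<^sub>R (cmod (fourier_ext (F n) x))\<^sup>2) \<longlonglongrightarrow>
     (LINT x|lborel. indicator (ball 0 \<rho>) x *\<^sub>R (cmod (fourier_ext f x))\<^sup>2)"
  proof (rule integral_dominated_convergence[where w = "\<lambda>x. V * nsq f * indicator (ball 0 \<rho>) x"])
    show "integrable lborel (\<lambda>x::'a. V * nsq f * indicator (ball 0 \<rho>) x)"
      using \<rho> by (intro integrable_mult_right integrable_real_indicator) (auto simp: emeasure_ball)
    show "AE x in lborel. (\<lambda>n. indicator (ball 0 \<rho>) x *\<^sub>R (cmod (fourier_ext (F n) x))\<^sup>2) \<longlonglongrightarrow> indicator (ball 0 \<rho>) x *\<^sub>R (cmod (fourier_ext f x))\<^sup>2"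
      by (intro AE_I2 tendsto_intros ptw)
    show "AE x in lborel. norm (indicator (ball 0 \<rho>) x *\<^sub>R (cmod (fourier_ext (F n) x))\<^sup>2) \<le> V * nsq f * indicator (ball 0 \<rho>) x" for n
    proof (rule AE_I2)
      fix x :: 'a
      have "(cmod (fourier_ext (F n) x))\<^sup>2 \<le> V * nsq (F n)" unfolding V_def by (rule cmod_fourier_ext[OF LF])
      also have "\<dots> \<le> V * nsq f" by (intro mult_left_mono nFle) (simp add: V_def)
      finally show "norm (indicator (ball 0 \<rho>) x *\<^sub>R (cmod (fourier_ext (F n) x))\<^sup>2) \<le> V * nsq f * indicator (ball 0 \<rho>) x"
        by (simp add: indicator_def)
    qed
  qed (use meas measf in \<open>auto simp del: real_scaleR_def intro!: borel_measurable_indicator_cmod\<close>)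
  moreover have "(LINT x|lborel. indicator (ball 0 \<rho>) x *\<^sub>R (cmod (fourier_ext (F n) x))\<^sup>2)
      = (2 * pi) ^ DIM('a) * \<rho> * (\<Sum>k<n. Lambda DIM('a) k \<rho> * nsq (p k))" for n
    using energy_harm_sum[OF d \<rho> _ p, of "{..<n}"] by (simp add: FF set_lebesgue_integral_def)
  ultimately have "(\<lambda>n. (2 * pi) ^ DIM('a) * \<rho> * (\<Sum>k<n. Lambda DIM('a) k \<rho> * nsq (p k))) \<longlonglongrightarrow>
     (LINT x|lborel. indicator (ball 0 \<rho>) x *\<^sub>R (cmod (fourier_ext f x))\<^sup>2)" by simp
  from tendsto_mult_left[OF this, of "1 / ((2 * pi) ^ DIM('a) * \<rho>)"]
  have "(\<lambda>n. \<Sum>k<n. Lambda DIM('a) k \<rho> * nsq (p k)) \<longlonglongrightarrow> 1 / ((2 * pi) ^ DIM('a) * \<rho>) * (LINT x|lborel. indicator (ball 0 \<rho>) x *\<^sub>R (cmod (fourier_ext f x))\<^sup>2)"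
    using \<rho> by simp
  moreover have "1 / ((2 * pi) ^ DIM('a) * \<rho>) * (LINT x|lborel. indicator (ball 0 \<rho>) x *\<^sub>R (cmod (fourier_ext f x))\<^sup>2) = energy f \<rho>"
    unfolding energy_def set_lebesgue_integral_def by simp
  ultimately show ?thesis unfolding sums_def p_def by simp
qed

section \<open>Sums of spaces H_k, distance and membership\<close>

definition HS :: "nat set \<Rightarrow> ('a::euclidean_space \<Rightarrow> complex) set" where
  "HS K = {\<lambda>x. \<Sum>k\<in>K. g k x | g. \<forall>k\<in>K. g k \<in> SH k}"

lemma HS_singleton: "HS {k} = SH k"
  unfolding HS_def by auto

text \<open>Disjointness lets one family of summands serve both index sets. Direct sums thus become
  index sets, and distance and membership depend only on which projections are discarded.\<close>

lemma HS_union: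
  assumes "finite A" "finite B" "A \<inter> B = {}"
  shows "HS (A \<union> B) = HS A \<oplus>\<^sub>S HS B"
proof (intro equalityI subsetI)
  fix h assume "h \<in> (HS (A \<union> B) :: ('a \<Rightarrow> complex) set)"
  then obtain g where "\<forall>k\<in>A \<union> B. g k \<in> SH k" "h = (\<lambda>x. \<Sum>k\<in>A \<union> B. g k x)" unfolding HS_def by blast
  then show "h \<in> HS A \<oplus>\<^sub>S HS B"
    unfolding HS_def dsum_def using assms by (fastforce simp: sum.union_disjoint)
next
  fix h assume "h \<in> (HS A \<oplus>\<^sub>S HS B :: ('a \<Rightarrow> complex) set)"
  then obtain g g' where g: "\<forall>k\<in>A. g k \<in> SH k" "\<forall>k\<in>B. g' k \<in> SH k"
    "h = (\<lambda>x. (\<Sum>k\<in>A. g k x) + (\<Sum>k\<in>B. g' k x))" unfolding HS_def dsum_def by blast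
  define u where "u = (\<lambda>k. if k \<in> A then g k else g' k)"
  have "(\<Sum>k\<in>A \<union> B. u k x) = (\<Sum>k\<in>A. g k x) + (\<Sum>k\<in>B. g' k x)" for x
    unfolding sum.union_disjoint[OF assms] using assms(3)
    by (intro arg_cong2[where f="(+)"] sum.cong) (auto simp: u_def)
  then have "h = (\<lambda>x. \<Sum>k\<in>A \<union> B. u k x)" using g(3) by simp
  moreover have "\<forall>k\<in>A \<union> B. u k \<in> SH k" using g by (auto simp: u_def)
  ultimately show "h \<in> HS (A \<union> B)" unfolding HS_def by blast
qed

lemma HS_2: "k \<noteq> l \<Longrightarrow> (SH k :: ('a::euclidean_space \<Rightarrow> complex) set) \<oplus>\<^sub>S SH l = HS {k, l}"
  using HS_union[of "{k}" "{l}", where 'a='a] by (simp add: HS_singleton insert_commute)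

lemma HS_3: "k \<noteq> l \<Longrightarrow> k \<noteq> m \<Longrightarrow> l \<noteq> m \<Longrightarrow> (HS {k, l} :: ('a::euclidean_space \<Rightarrow> complex) set) \<oplus>\<^sub>S SH m = HS {k, l, m}"
  using HS_union[of "{k, l}" "{m}", where 'a='a] by (simp add: HS_singleton insert_commute)

lemma SH_harm_choice:
  assumes "\<forall>k\<in>K. g k \<in> SH k"
  obtains P where "\<And>k. k \<in> K \<Longrightarrow> harm k (P k)" "\<And>k x. k \<in> K \<Longrightarrow> norm x = 1 \<Longrightarrow> g k x = P k x"
proof -
  have "\<forall>k. \<exists>P. k \<in> K \<longrightarrow> harm k P \<and> (\<forall>x. norm x = 1 \<longrightarrow> g k x = P x)" using assms unfolding SH_iff by blast
  then show ?thesis using that by metis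
qed

lemma nsq_HS:
  assumes d: "DIM('a) \<ge> 2" and f: "L2S (f :: 'a::euclidean_space \<Rightarrow> complex)" and K: "finite K"
    and h: "h \<in> HS K"
  shows "nsq (\<lambda>x. f x - h x) \<ge> nsq f - (\<Sum>k\<in>K. nsq (harm_proj k f))"
proof -
  obtain g where g: "\<forall>k\<in>K. g k \<in> SH k" "h = (\<lambda>x. \<Sum>k\<in>K. g k x)" using h unfolding HS_def by blast
  obtain P where P: "\<And>k. k \<in> K \<Longrightarrow> harm k (P k)" "\<And>k x. k \<in> K \<Longrightarrow> norm x = 1 \<Longrightarrow> g k x = P k x"
    using SH_harm_choice[OF g(1)] by blast
  have "nsq (\<lambda>x. f x - h x) = nsq (\<lambda>x. f x - (\<Sum>k\<in>K. P k x))"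
    by (rule nsq_cong) (simp add: g(2) P(2))
  also have "\<dots> \<ge> nsq f - (\<Sum>k\<in>K. nsq (harm_proj k f))"
    using nsq_approx[OF d f K, of P, OF P(1)] by (simp add: sum_nonneg)
  finally show ?thesis .
qed

lemma proj_HS:
  assumes d: "DIM('a) \<ge> 2" and f: "L2S (f :: 'a::euclidean_space \<Rightarrow> complex)" and K: "finite K"
  shows "(\<lambda>x. \<Sum>k\<in>K. harm_proj k f x) \<in> HS K"
    "nsq (\<lambda>x. f x - (\<Sum>k\<in>K. harm_proj k f x)) = nsq f - (\<Sum>k\<in>K. nsq (harm_proj k f))"
proof -
  show "(\<lambda>x. \<Sum>k\<in>K. harm_proj k f x) \<in> HS K"
    unfolding HS_def
    by (intro CollectI exI[of _ "\<lambda>k. harm_proj k f"] conjI refl ballI harm_SH harm_proj(1)[OF d f])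
  show "nsq (\<lambda>x. f x - (\<Sum>k\<in>K. harm_proj k f x)) = nsq f - (\<Sum>k\<in>K. nsq (harm_proj k f))"
    using nsq_approx[OF d f K, of "\<lambda>k. harm_proj k f"] harm_proj(1)[OF d f] by (simp add: nsq_def[of "\<lambda>x. 0"])
qed

text \<open>The infimum is a minimum, attained at the sum of the projections.\<close>

lemma L2dist_HS:
  assumes d: "DIM('a) \<ge> 2" and f: "L2S (f :: 'a::euclidean_space \<Rightarrow> complex)" and K: "finite K"
  shows "(L2dist f (HS K))\<^sup>2 = nsq f - (\<Sum>k\<in>K. nsq (harm_proj k f))"
proof -
  define r where "r = nsq f - (\<Sum>k\<in>K. nsq (harm_proj k f))"
  have "L2dist f (HS K) = sqrt r"
    unfolding L2dist_def
  proof (rule cInf_eq_minimum)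
    show "sqrt r \<in> {L2norm (\<lambda>\<omega>. f \<omega> - m \<omega>) |m. m \<in> HS K}"
      using proj_HS[OF d f K] unfolding L2norm_eq r_def by force
    show "sqrt r \<le> x" if "x \<in> {L2norm (\<lambda>\<omega>. f \<omega> - m \<omega>) |m. m \<in> HS K}" for x
      using that nsq_HS[OF d f K] unfolding L2norm_eq r_def by auto
  qed
  moreover have "r \<ge> 0" using nsq_nonneg[of "\<lambda>x. f x - (\<Sum>k\<in>K. harm_proj k f x)"]
    unfolding proj_HS(2)[OF d f K] r_def .
  ultimately show ?thesis unfolding r_def by simp
qed

lemma sums_restrict:
  fixes N :: "nat \<Rightarrow> real"
  assumes "finite K" "N sums s"
  shows "(\<lambda>k. if k \<in> K then 0 else N k) sums (s - (\<Sum>k\<in>K. N k))"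
proof -
  have "(\<lambda>k. if k \<in> K then N k else 0) sums (\<Sum>k\<in>K. N k)" using sums_If_finite_set[OF assms(1)] .
  from sums_diff[OF assms(2) this] show ?thesis by (simp add: if_distrib cong: if_cong)
qed

lemma L2dist_sums:
  assumes d: "DIM('a) \<ge> 2" and f: "L2S (f :: 'a::euclidean_space \<Rightarrow> complex)" and K: "finite K"
  shows "(\<lambda>k. if k \<in> K then 0 else nsq (harm_proj k f)) sums (L2dist f (HS K))\<^sup>2"
  unfolding L2dist_HS[OF assms] by (rule sums_restrict[OF K parseval[OF d f]])

lemma sums_nonneg_0_iff:
  fixes g :: "nat \<Rightarrow> real"
  assumes "g sums s" "\<And>n. g n \<ge> 0"
  shows "s = 0 \<longleftrightarrow> (\<forall>n. g n = 0)"
  using suminf_eq_zero_iff[of g] assms by (metis sums_summable sums_unique)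

text \<open>Membership up to null sets means distance 0, because the distance is attained; and that
  distance is a sum of the non-negative norms outside K.\<close>

lemma in_L2_HS_iff:
  assumes d: "DIM('a) \<ge> 2" and f: "L2S (f :: 'a::euclidean_space \<Rightarrow> complex)" and K: "finite K"
  shows "in_L2 f (HS K) \<longleftrightarrow> (\<forall>k. k \<notin> K \<longrightarrow> nsq (harm_proj k f) = 0)"
proof -
  have "in_L2 f (HS K) \<longleftrightarrow> (L2dist f (HS K))\<^sup>2 = 0"
  proof
    assume "in_L2 f (HS K)"
    then obtain m where m: "m \<in> HS K" "AE x in sphere_measure. f x = m x" unfolding in_L2_def by blast
    have "AE x in sphere_measure. (cmod (f x - m x))\<^sup>2 = 0" using m(2) by eventually_elim simp
    then have "nsq (\<lambda>x. f x - m x) = 0" unfolding nsq_def by (rule integral_eq_zero_AE)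
    then show "(L2dist f (HS K))\<^sup>2 = 0"
      using nsq_HS[OF d f K m(1)] zero_le_power2[of "L2dist f (HS K)"] unfolding L2dist_HS[OF assms] by linarith
  next
    assume "(L2dist f (HS K))\<^sup>2 = 0"
    then have n: "nsq (\<lambda>x. f x - (\<Sum>k\<in>K. harm_proj k f x)) = 0"
      unfolding L2dist_HS[OF assms] proj_HS(2)[OF assms] .
    have "L2S (\<lambda>x. f x - (\<Sum>k\<in>K. harm_proj k f x))"
      by (intro L2S_diff f L2S_sum harm_L2S[OF harm_proj(1)[OF d f]])
    from n[unfolded nsq_eq_0_iff[OF this]]
    have "AE x in sphere_measure. f x = (\<Sum>k\<in>K. harm_proj k f x)" by eventually_elim simp
    then show "in_L2 f (HS K)" unfolding in_L2_def by (rule bexI[OF _ proj_HS(1)[OF assms]])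
  qed
  also have "\<dots> \<longleftrightarrow> (\<forall>k. (if k \<in> K then 0 else nsq (harm_proj k f)) = 0)"
    by (rule sums_nonneg_0_iff[OF L2dist_sums[OF assms]]) simp
  finally show ?thesis by auto
qed

text \<open>The witness is (x_b + i x_c)^k for two distinct basis vectors, available since d >= 2.
  It is harmonic because its complex direction w is isotropic: 1 + i^2 = 0.\<close>

lemma harm_nonzero_exists:
  assumes d: "DIM('a::euclidean_space) \<ge> 2"
  obtains Y :: "'a::euclidean_space \<Rightarrow> complex" where "harm k Y" "nsq Y > 0"
proof -
  obtain b where b: "b \<in> (Basis :: 'a set)" using nonempty_Basis by blast
  have "card (Basis - {b}) > 0" using d b by (simp add: card_Diff_singleton)
  then obtain c where c: "c \<in> (Basis :: 'a set)" "c \<noteq> b" by (metis Diff_iff all_not_in_conv card_gt_0_iff insertCI)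
  define L where "L = (\<lambda>x::'a. complex_of_real (x \<bullet> b) + \<i> * complex_of_real (x \<bullet> c))"
  have L: "homog (Suc 0) L" unfolding L_def by (intro homog_add homog_cmult homog_inner)
  have hL: "homog n (\<lambda>x. L x ^ n)" for n using homog_power[OF L, of n] by simp
  define w where "w = (\<lambda>e. complex_of_real (e \<bullet> b) + \<i> * complex_of_real (e \<bullet> c))"
  have dL: "ddir e L = (\<lambda>x. w e)" for e
    unfolding L_def w_def
    by (subst ddir_add[OF homog_inner homog_cmult[OF homog_inner]]) (simp add: ddir_cmult[OF homog_inner])
  have dLn: "ddir e (\<lambda>x. L x ^ n) = (\<lambda>x. of_nat n * w e * L x ^ (n - 1))" for e n
  proof (induction n)
    case (Suc n)
    have "ddir e (\<lambda>x. L x ^ Suc n) = (\<lambda>x. L x * ddir e (\<lambda>x. L x ^ n) x + w e * L x ^ n)"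
      using ddir_mult[OF L hL[of n], of e] by (simp add: dL)
    then show ?case unfolding Suc.IH by (cases n) (auto simp: algebra_simps fun_eq_iff)
  qed simp
  have w2: "(\<Sum>e\<in>Basis. w e * w e) = 0"
  proof -
    have "w e * w e = (if e = b then 1 else 0) + (if e = c then -1 else 0)" if "e \<in> Basis" for e
      using that b c by (auto simp: w_def inner_Basis)
    then have "(\<Sum>e\<in>Basis. w e * w e) = (\<Sum>e\<in>Basis. (if e = b then 1 else 0) + (if e = c then -1 else 0))"
      by (intro sum.cong) auto
    also have "\<dots> = 0" using b c by (simp add: sum.distrib)
    finally show ?thesis .
  qed
  have "lap (\<lambda>x. L x ^ k) = (\<lambda>x. 0)"
  proof
    fix x
    have "ddir e (ddir e (\<lambda>x. L x ^ k)) x = w e * w e * (of_nat k * of_nat (k - 1) * L x ^ (k - 1 - 1))" for e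
    proof -
      have "ddir e (\<lambda>x. of_nat k * w e * L x ^ (k - 1)) x = of_nat k * w e * (of_nat (k - 1) * w e * L x ^ (k - 1 - 1))"
        by (subst ddir_cmult[OF hL]) (simp only: dLn)
      then show ?thesis unfolding dLn by (simp only: mult_ac)
    qed
    then show "lap (\<lambda>x. L x ^ k) x = 0" unfolding lap_def by (simp only: sum_distrib_right[symmetric] w2 mult_zero_left)
  qed
  then have Y: "harm k (\<lambda>x. L x ^ k)" by (simp add: harm_def hL)
  have "nsq (\<lambda>x. L x ^ k) \<noteq> 0"
  proof
    assume "nsq (\<lambda>x. L x ^ k) = 0"
    then have ae: "AE x in sphere_measure. L x ^ k = 0" using nsq_eq_0_iff[OF harm_L2S[OF Y]] by simp
    \<comment> \<open>Were Y null, its k-th moment in direction b would vanish, but that moment is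
      \<open>hecke DIM('a) k k\<close> times L(b)^k with L(b) = 1.\<close>
    have "(LINT x|sphere_measure. complex_of_real (x \<bullet> b) ^ k * L x ^ k) = 0"
      by (rule integral_eq_zero_AE) (use ae in eventually_elim, simp)
    then have "complex_of_real (hecke DIM('a) k k) * L b ^ k = 0"
      using hecke_integral[OF d Y, of b k] by simp
    moreover have "L b = 1" using b c by (simp add: L_def inner_Basis)
    ultimately show False using hecke_diag_pos[of "DIM('a)" k] d by simp
  qed
  then show ?thesis using that[OF Y] nsq_nonneg[of "\<lambda>x. L x ^ k"] by (simp add: less_le)
qed

text \<open>\<open>harm_proj\<close> is a choice, so its norms are found indirectly: membership in
  H_k kills all other components, and Parseval's identity fixes the remaining one.\<close>

lemma harm_proj_harm:
  assumes d: "DIM('a) \<ge> 2" and Y: "harm k (Y :: 'a::euclidean_space \<Rightarrow> complex)"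
  shows "nsq (harm_proj j Y) = (if j = k then nsq Y else 0)"
proof -
  have L: "L2S Y" by (rule harm_L2S[OF Y])
  have "in_L2 Y (HS {k})" unfolding in_L2_def HS_singleton using harm_SH[OF Y] by auto
  then have 0: "nsq (harm_proj j Y) = 0" if "j \<noteq> k" for j using in_L2_HS_iff[OF d L, of "{k}"] that by simp
  have "(\<lambda>j. nsq (harm_proj j Y)) sums nsq (harm_proj k Y)"
    using sums_finite[of "{k}" "\<lambda>j. nsq (harm_proj j Y)"] 0 by simp
  with parseval[OF d L] have "nsq Y = nsq (harm_proj k Y)" by (rule sums_unique2)
  with 0 show ?thesis by auto
qed

section \<open>Spectral gap\<close>

text \<open>M and T index the largest and the second largest value of L.\<close>
definition gap :: "(nat \<Rightarrow> real) \<Rightarrow> nat set \<Rightarrow> nat set \<Rightarrow> real \<Rightarrow> real \<Rightarrow> bool" where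
  "gap L M T C S \<longleftrightarrow> finite M \<and> finite T \<and> M \<noteq> {} \<and> T \<noteq> {} \<and> M \<inter> T = {} \<and> S > 0 \<and>
     (\<forall>k\<in>M. L k = C) \<and> (\<forall>k\<in>T. L k = C - S) \<and> (\<forall>k. k \<notin> M \<longrightarrow> k \<notin> T \<longrightarrow> L k < C - S)"

lemma gap_max: "gap L M T C S \<Longrightarrow> L k \<le> C"
  unfolding gap_def by (metis diff_ge_0_iff_ge diff_le_eq le_add_same_cancel1 less_imp_le order_trans order_refl add.commute less_eq_real_def)

lemma gap_other: "gap L M T C S \<Longrightarrow> k \<notin> M \<Longrightarrow> L k \<le> C - S"
  unfolding gap_def by (metis less_imp_le order_refl)

lemma Cd_eq:
  assumes d: "DIM('a::euclidean_space) \<ge> 2" and \<rho>: "\<rho> > 0"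
    and gap: "gap (\<lambda>k. Lambda DIM('a) k \<rho>) M T C S"
  shows "Cd \<rho> TYPE('a) = C"
  unfolding Cd_def
proof (rule cSup_eq_maximum)
  obtain k where k: "k \<in> M" using gap by (auto simp: gap_def)
  obtain Y :: "'a \<Rightarrow> complex" where Y: "harm k Y" "nsq Y > 0" using harm_nonzero_exists[OF d] by blast
  have L: "L2S Y" by (rule harm_L2S[OF Y(1)])
  have "(\<lambda>j. Lambda DIM('a) j \<rho> * nsq (harm_proj j Y)) sums (Lambda DIM('a) k \<rho> * nsq Y)"
    using sums_finite[of "{k}" "\<lambda>j. Lambda DIM('a) j \<rho> * nsq (harm_proj j Y)"] harm_proj_harm[OF d Y(1)] by simp
  then have "energy Y \<rho> = Lambda DIM('a) k \<rho> * nsq Y" using energy_sums[OF d \<rho> L] by (metis sums_unique2)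
  then have "C = energy Y \<rho> / (L2norm Y)\<^sup>2" using gap k Y(2) by (simp add: gap_def)
  moreover have "L2norm Y \<noteq> 0" using Y(2) by (simp add: L2norm_eq)
  ultimately show "C \<in> {energy f \<rho> / (L2norm f)\<^sup>2 | f :: 'a \<Rightarrow> complex. L2S f \<and> L2norm f \<noteq> 0}"
    using L by blast
next
  fix y assume "y \<in> {energy f \<rho> / (L2norm f)\<^sup>2 | f :: 'a \<Rightarrow> complex. L2S f \<and> L2norm f \<noteq> 0}"
  then obtain f :: "'a \<Rightarrow> complex" where f: "y = energy f \<rho> / nsq f" "L2S f" "L2norm f \<noteq> 0" by auto
  then have n: "nsq f > 0" using nsq_nonneg[of f] by (auto simp: L2norm_eq less_le)
  have "energy f \<rho> \<le> C * nsq f"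
    by (rule sums_le[OF _ energy_sums[OF d \<rho> f(2)] sums_mult[OF parseval[OF d f(2)]]])
       (intro mult_right_mono gap_max[OF gap] nsq_nonneg)
  then show "y \<le> C" using n f(1) by (simp add: divide_le_eq)
qed

text \<open>Deficit and distance are series in the same non-negative numbers N_k, so the
  inequalities hold term by term and equality means equality in every term. H_k with k in T tests
  the optimality of S; H_k with k tending to infinity tests that of C.\<close>

lemma spectral_gap:
  fixes \<rho> :: real
  assumes d: "DIM('a::euclidean_space) \<ge> 2" and \<rho>: "\<rho> > 0"
    and gap: "gap (\<lambda>k. Lambda DIM('a) k \<rho>) M T C S"
  shows "\<forall>f::'a \<Rightarrow> complex. L2S f \<longrightarrow>
          S * (L2dist f (HS M))\<^sup>2 \<le> deficit f \<rho> \<and> deficit f \<rho> \<le> Cd \<rho> TYPE('a) * (L2dist f (HS M))\<^sup>2"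
    and "\<forall>S'. (\<forall>f::'a \<Rightarrow> complex. L2S f \<longrightarrow> S' * (L2dist f (HS M))\<^sup>2 \<le> deficit f \<rho>) \<longrightarrow> S' \<le> S"
    and "\<forall>C'. (\<forall>f::'a \<Rightarrow> complex. L2S f \<longrightarrow> deficit f \<rho> \<le> C' * (L2dist f (HS M))\<^sup>2) \<longrightarrow> Cd \<rho> TYPE('a) \<le> C'"
    and "\<forall>f::'a \<Rightarrow> complex. L2S f \<longrightarrow> deficit f \<rho> = Cd \<rho> TYPE('a) * (L2dist f (HS M))\<^sup>2 \<longrightarrow> in_L2 f (HS M)"
    and "\<forall>f::'a \<Rightarrow> complex. L2S f \<longrightarrow> (S * (L2dist f (HS M))\<^sup>2 = deficit f \<rho> \<longleftrightarrow> in_L2 f (HS M \<oplus>\<^sub>S HS T))"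
proof -
  let ?L = "\<lambda>k. Lambda DIM('a) k \<rho>"
  note Cd = Cd_eq[OF d \<rho> gap]
  have M: "finite M" and T: "finite T" "T \<noteq> {}" and MT: "M \<inter> T = {}" and S: "S > 0"
    and LM: "\<And>k. k \<in> M \<Longrightarrow> ?L k = C" and LT: "\<And>k. k \<in> T \<Longrightarrow> ?L k = C - S"
    and LO: "\<And>k. k \<notin> M \<Longrightarrow> k \<notin> T \<Longrightarrow> ?L k < C - S"
    using gap by (auto simp: gap_def)
  have Lpos: "?L k > 0" for k using Lambda_pos[OF \<rho>] d by simp
  define N where "N = (\<lambda>k (f :: 'a \<Rightarrow> complex). nsq (harm_proj k f))"
  have N0: "N k f \<ge> 0" for k f by (simp add: N_def)
  have def: "(\<lambda>k. (C - ?L k) * N k f) sums deficit f \<rho>" if "L2S f" for f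
    using sums_diff[OF sums_mult[OF parseval[OF d that], of C] energy_sums[OF d \<rho> that]]
    by (simp add: deficit_def Cd N_def left_diff_distrib)
  have dist: "(\<lambda>k. a * (if k \<in> M then 0 else N k f)) sums (a * (L2dist f (HS M))\<^sup>2)" if "L2S f" for f a
    unfolding N_def by (rule sums_mult[OF L2dist_sums[OF d that M]])
  have low: "a * (if k \<in> M then 0 else N k f) \<le> (C - ?L k) * N k f" if "a = S" for a k f
    using gap_other[OF gap, of k] LM[of k] that N0[of k f] by (auto intro: mult_right_mono)
  have up: "(C - ?L k) * N k f \<le> C * (if k \<in> M then 0 else N k f)" for k f
    using Lpos[of k] LM[of k] N0[of k f] by (auto intro: mult_right_mono)
  show "\<forall>f::'a \<Rightarrow> complex. L2S f \<longrightarrow>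
          S * (L2dist f (HS M))\<^sup>2 \<le> deficit f \<rho> \<and> deficit f \<rho> \<le> Cd \<rho> TYPE('a) * (L2dist f (HS M))\<^sup>2"
    unfolding Cd using sums_le[OF low[OF refl] dist def] sums_le[OF up def dist] by blast
  have harm_def: "deficit Y \<rho> = (C - ?L k) * nsq Y" if Y: "harm k Y" for k and Y :: "'a \<Rightarrow> complex"
    using sums_unique2[OF def[OF harm_L2S[OF Y]], of "(C - ?L k) * nsq Y"]
      sums_finite[of "{k}" "\<lambda>j. (C - ?L j) * N j Y"] harm_proj_harm[OF d Y] by (simp add: N_def)
  have harm_dist: "(L2dist Y (HS M))\<^sup>2 = nsq Y" if Y: "harm k Y" "k \<notin> M" for k and Y :: "'a \<Rightarrow> complex"
    unfolding L2dist_HS[OF d harm_L2S[OF Y(1)] M] harm_proj_harm[OF d Y(1)] using Y(2) M by simp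
  show "\<forall>S'. (\<forall>f::'a \<Rightarrow> complex. L2S f \<longrightarrow> S' * (L2dist f (HS M))\<^sup>2 \<le> deficit f \<rho>) \<longrightarrow> S' \<le> S"
  proof (intro allI impI)
    fix S' assume *: "\<forall>f::'a \<Rightarrow> complex. L2S f \<longrightarrow> S' * (L2dist f (HS M))\<^sup>2 \<le> deficit f \<rho>"
    obtain k where k: "k \<in> T" "k \<notin> M" using T MT by blast
    obtain Y :: "'a \<Rightarrow> complex" where Y: "harm k Y" "nsq Y > 0" using harm_nonzero_exists[OF d] by blast
    have "S' * nsq Y \<le> S * nsq Y"
      using *[rule_format, OF harm_L2S[OF Y(1)]] unfolding harm_def[OF Y(1)] harm_dist[OF Y(1) k(2)] LT[OF k(1)] by simp
    then show "S' \<le> S" using Y(2) by simp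
  qed
  show "\<forall>C'. (\<forall>f::'a \<Rightarrow> complex. L2S f \<longrightarrow> deficit f \<rho> \<le> C' * (L2dist f (HS M))\<^sup>2) \<longrightarrow> Cd \<rho> TYPE('a) \<le> C'"
  proof (intro allI impI)
    fix C' assume *: "\<forall>f::'a \<Rightarrow> complex. L2S f \<longrightarrow> deficit f \<rho> \<le> C' * (L2dist f (HS M))\<^sup>2"
    have "C - ?L k \<le> C'" if k: "k \<notin> M" for k
    proof -
      obtain Y :: "'a \<Rightarrow> complex" where Y: "harm k Y" "nsq Y > 0" using harm_nonzero_exists[OF d] by blast
      have "(C - ?L k) * nsq Y \<le> C' * nsq Y"
        using *[rule_format, OF harm_L2S[OF Y(1)]] unfolding harm_def[OF Y(1)] harm_dist[OF Y(1) k] .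
      then show ?thesis using Y(2) by simp
    qed
    \<comment> \<open>Test functions of degree k in M have distance 0 and say nothing about C'; M
      being finite, all large degrees are available for the limit.\<close>
    moreover obtain n where "\<forall>k\<in>M. k < n" using M finite_nat_set_iff_bounded by blast
    ultimately have "\<exists>n. \<forall>k\<ge>n. C - ?L k \<le> C'" by (metis not_less)
    moreover have "(\<lambda>k. C - ?L k) \<longlonglongrightarrow> C - 0" by (intro tendsto_intros Lambda_tendsto_0[OF \<rho> d])
    ultimately show "Cd \<rho> TYPE('a) \<le> C'" unfolding Cd using LIMSEQ_le_const2 by fastforce
  qed
  show "\<forall>f::'a \<Rightarrow> complex. L2S f \<longrightarrow> deficit f \<rho> = Cd \<rho> TYPE('a) * (L2dist f (HS M))\<^sup>2 \<longrightarrow> in_L2 f (HS M)"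
  proof (intro allI impI)
    fix f :: "'a \<Rightarrow> complex" assume f: "L2S f" and eq: "deficit f \<rho> = Cd \<rho> TYPE('a) * (L2dist f (HS M))\<^sup>2"
    have "\<forall>k. C * (if k \<in> M then 0 else N k f) - (C - ?L k) * N k f = 0"
      using sums_nonneg_0_iff[OF sums_diff[OF dist[OF f, of C] def[OF f]]] up[of _ f] eq by (simp add: Cd)
    \<comment> \<open>Outside M the two terms differ by Lambda_k N_k, and Lambda_k > 0.\<close>
    then have "k \<notin> M \<Longrightarrow> ?L k * N k f = 0" for k by (auto simp: algebra_simps dest!: spec[of _ k])
    then have "k \<notin> M \<Longrightarrow> N k f = 0" for k using Lpos[of k] by fastforce
    then show "in_L2 f (HS M)" unfolding in_L2_HS_iff[OF d f M] by (simp add: N_def)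
  qed
  show "\<forall>f::'a \<Rightarrow> complex. L2S f \<longrightarrow> (S * (L2dist f (HS M))\<^sup>2 = deficit f \<rho> \<longleftrightarrow> in_L2 f (HS M \<oplus>\<^sub>S HS T))"
  proof (intro allI impI)
    fix f :: "'a \<Rightarrow> complex" assume f: "L2S f"
    have "S * (L2dist f (HS M))\<^sup>2 = deficit f \<rho> \<longleftrightarrow> (\<forall>k. (C - ?L k) * N k f - S * (if k \<in> M then 0 else N k f) = 0)"
    proof -
      have "(C - ?L k) * N k f - S * (if k \<in> M then 0 else N k f) \<ge> 0" for k
        using low[OF refl, of k f] by linarith
      from sums_nonneg_0_iff[OF sums_diff[OF def[OF f] dist[OF f, of S]] this]
      show ?thesis by (metis eq_iff_diff_eq_0)
    qed
    also have "\<dots> \<longleftrightarrow> (\<forall>k. k \<notin> M \<union> T \<longrightarrow> N k f = 0)"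
    proof (intro all_cong1)
      fix k
      consider "k \<in> M" | "k \<in> T" "k \<notin> M" | "k \<notin> M" "k \<notin> T" by blast
      then show "((C - ?L k) * N k f - S * (if k \<in> M then 0 else N k f) = 0) = (k \<notin> M \<union> T \<longrightarrow> N k f = 0)"
      proof cases
        case 3
        then have "C - ?L k - S \<noteq> 0" using LO[of k] by auto
        moreover have "(C - ?L k) * N k f - S * N k f = (C - ?L k - S) * N k f" by (simp add: algebra_simps)
        ultimately show ?thesis using 3 by simp
      qed (use LM[of k] LT[of k] in auto)
    qed
    also have "\<dots> \<longleftrightarrow> in_L2 f (HS M \<oplus>\<^sub>S HS T)"
      unfolding HS_union[OF M T(1) MT, symmetric] using in_L2_HS_iff[OF d f, of "M \<union> T"] M T by (simp add: N_def)
    finally show "S * (L2dist f (HS M))\<^sup>2 = deficit f \<rho> \<longleftrightarrow> in_L2 f (HS M \<oplus>\<^sub>S HS T)" .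
  qed
qed

text \<open>By monotonicity in steps of two, \<open>L n\<close> and \<open>L (n + 1)\<close>
  dominate all later values, one for each parity; so only finitely many indices have to be
  inspected.\<close>

lemma gapI:
  assumes "finite M" "finite T" "M \<noteq> {}" "T \<noteq> {}" "M \<inter> T = {}" "S > 0"
    "\<And>k. k \<in> M \<Longrightarrow> L k = C" "\<And>k. k \<in> T \<Longrightarrow> L k = C - S"
    "\<And>k. k < n \<Longrightarrow> k \<in> M \<or> k \<in> T \<or> L k < C - S" "L n < C - S" "L (n + 1) < C - S"
    and anti: "\<And>k. L (k + 2) \<le> L k"
  shows "gap L M T C S"
proof -
  have "L (n + 2 * j) \<le> L n \<and> L (n + 1 + 2 * j) \<le> L (n + 1)" for j
  proof (induction j)
    case (Suc j)
    have "n + 2 * Suc j = (n + 2 * j) + 2" "n + 1 + 2 * Suc j = (n + 1 + 2 * j) + 2" by auto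
    then show ?case using Suc anti[of "n + 2 * j"] anti[of "n + 1 + 2 * j"] by (metis order_trans)
  qed simp
  moreover have "\<exists>j. k = n + 2 * j \<or> k = n + 1 + 2 * j" if "k \<ge> n" for k
    using that by presburger
  ultimately have "L k < C - S" if "k \<ge> n" for k using that assms(10,11) by (metis le_less_trans)
  then show ?thesis unfolding gap_def using assms(1-9) by (metis not_less)
qed

text \<open>Zeros such as r = 0 in the case J 0 = 0 do not occur by Bourget's hypothesis, but this is not needed:
  there the second largest value is simply attained at three indices.\<close>
lemma spectral_cases:
  fixes J L c :: "nat \<Rightarrow> real" and h :: "nat set \<Rightarrow> 'b"
  assumes c: "\<And>k. c k > 0" and R: "\<And>k. J (k + 2) = c k * J (k + 1) - J k"
    and D: "\<And>k. L k - L (k + 1) = J k * J (k + 1)" and nz: "J 0 \<noteq> 0 \<or> J 1 \<noteq> 0"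
    and pq: "p = J 0 * J 1" "q = J 1 * J 2" "r = J 2 * J 3" "s = J 3 * J 4"
  shows "\<exists>M T C S. gap L M T C S
    \<and> M = (if p > 0 then {0} else if p < 0 then {1} else if J 0 = 0 then {0, 1} else {0, 1, 2})
    \<and> (p > 0 \<longrightarrow>
         (q > 0 \<longrightarrow> S = L 0 - L 1 \<and> h T = h {1})
       \<and> (q < 0 \<longrightarrow> S = L 0 - L 2 \<and> h T = h {2})
       \<and> (q = 0 \<longrightarrow> S = L 0 - L 1 \<and> S = L 0 - L 2 \<and> h T = h {1, 2, 3}))
    \<and> (p < 0 \<longrightarrow>
         (p + q + r > 0 \<longrightarrow> S = L 1 - L 0 \<and> h T = h {0})
       \<and> (p + q + r < 0 \<longrightarrow> S = L 1 - L 3 \<and> h T = h {3})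
       \<and> (p + q + r = 0 \<longrightarrow> S = L 1 - L 0 \<and> S = L 1 - L 3 \<and> h T = h {0, 3}))
    \<and> (J 0 = 0 \<longrightarrow>
         (r > 0 \<longrightarrow> S = L 0 - L 2 \<and> h T = h {2})
       \<and> (r < 0 \<longrightarrow> S = L 0 - L 3 \<and> h T = h {3}))
    \<and> (J 1 = 0 \<longrightarrow>
         (s > 0 \<longrightarrow> S = L 0 - L 3 \<and> h T = h {3})
       \<and> (s < 0 \<longrightarrow> S = L 0 - L 4 \<and> h T = h {4}))"
proof -
  have D2: "L k - L (k + 2) = c k * (J (k + 1))\<^sup>2" for k
  proof -
    have "L k - L (k + 2) = J (k + 1) * (J k + J (k + 2))"
      using D[of k] D[of "k + 1"] by (simp add: algebra_simps)
    also have "J k + J (k + 2) = c k * J (k + 1)" using R[of k] by simp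
    finally show ?thesis by (simp add: power2_eq_square)
  qed
  have le: "L (k + 2) \<le> L k" for k
    using D2[of k] mult_nonneg_nonneg[OF less_imp_le[OF c[of k]] zero_le_power2[of "J (k + 1)"]] by linarith
  have lt: "L (k + 2) < L k" if "J (k + 1) \<noteq> 0" for k
  proof -
    have "c k * (J (k + 1))\<^sup>2 > 0" using c[of k] that by simp
    then show ?thesis using D2[of k] by linarith
  qed
  \<comment> \<open>A zero of J at k + 2 makes J k a positive multiple of J (k + 1). Read backwards,
    a negative product excludes that zero, which is how strictness is obtained below.\<close>
  have same: "J k * J (k + 1) > 0" if "J (k + 2) = 0" "J (k + 1) \<noteq> 0" for k
  proof -
    have "J k = c k * J (k + 1)" using R[of k] that by simp
    then have "J k * J (k + 1) = c k * (J (k + 1))\<^sup>2" by (simp add: power2_eq_square)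
    then show ?thesis using c[of k] that by simp
  qed
  have next_nz: "J (k + 2) \<noteq> 0" if "J k = 0" "J (k + 1) \<noteq> 0" for k
    using R[of k] c[of k] that by simp
  have next_nz': "J (k + 2) \<noteq> 0" if "J (k + 1) = 0" "J k \<noteq> 0" for k
    using R[of k] that by simp
  have nums: "(0::nat) + 1 = 1" "(0::nat) + 2 = 2" "(1::nat) + 1 = 2" "(1::nat) + 2 = 3" "(2::nat) + 1 = 3" "(2::nat) + 2 = 4"
    "(3::nat) + 1 = 4" "(3::nat) + 2 = 5" "(4::nat) + 1 = 5" "(4::nat) + 2 = 6" "(5::nat) + 1 = 6" "(5::nat) + 2 = 7"
    by simp_all
  note same0 = same[of 0, unfolded nums]
  note D' = D[of 0, unfolded nums] D[of 1, unfolded nums] D[of 2, unfolded nums] D[of 3, unfolded nums] D[of 4, unfolded nums]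
  note lts = lt[of 0, unfolded nums] lt[of 1, unfolded nums] lt[of 2, unfolded nums] lt[of 3, unfolded nums] lt[of 4, unfolded nums] lt[of 5, unfolded nums]
  note les = le[of 0, unfolded nums] le[of 1, unfolded nums] le[of 2, unfolded nums] le[of 3, unfolded nums] le[of 4, unfolded nums] le[of 5, unfolded nums]
  note sames = same[of 2, unfolded nums] same[of 3, unfolded nums] same[of 1, unfolded nums]
  have lt2: "k < (2::nat) \<Longrightarrow> k = 0 \<or> k = 1" and lt3: "k < (3::nat) \<Longrightarrow> k = 0 \<or> k = 1 \<or> k = 2"
    and lt4: "k < (4::nat) \<Longrightarrow> k = 0 \<or> k = 1 \<or> k = 2 \<or> k = 3"
    and lt5: "k < (5::nat) \<Longrightarrow> k = 0 \<or> k = 1 \<or> k = 2 \<or> k = 3 \<or> k = 4"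
    and lt6: "k < (6::nat) \<Longrightarrow> k = 0 \<or> k = 1 \<or> k = 2 \<or> k = 3 \<or> k = 4 \<or> k = 5" for k by linarith+
  note D = D'(1-4)[folded pq] and same = sames[folded pq]
  have p0: "p \<noteq> 0 \<Longrightarrow> J 0 \<noteq> 0 \<and> J 1 \<noteq> 0" and q0: "q \<noteq> 0 \<Longrightarrow> J 2 \<noteq> 0"
    and r0: "r \<noteq> 0 \<Longrightarrow> J 3 \<noteq> 0" and s0: "s \<noteq> 0 \<Longrightarrow> J 4 \<noteq> 0" by (auto simp: pq)
  have p00: "J 0 = 0 \<Longrightarrow> p = 0" "J 1 = 0 \<Longrightarrow> p = 0" "J 1 = 0 \<Longrightarrow> q = 0" "J 3 = 0 \<Longrightarrow> r = 0" "J 3 = 0 \<Longrightarrow> s = 0" "J 4 = 0 \<Longrightarrow> s = 0"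
    by (auto simp: pq)
  have exI4: "P M T C S \<Longrightarrow> \<exists>M T C S. P M T C S" for P :: "nat set \<Rightarrow> nat set \<Rightarrow> real \<Rightarrow> real \<Rightarrow> bool" and M T C S
    by blast
  have "p > 0 \<or> p < 0 \<or> p = 0" by linarith
  moreover have "p = 0 \<Longrightarrow> J 0 = 0 \<or> J 1 = 0" by (simp add: pq)
  ultimately consider (i) "p > 0" | (ii) "p < 0" | (iii) "p = 0" "J 0 = 0" "J 1 \<noteq> 0" | (iv) "p = 0" "J 1 = 0" "J 0 \<noteq> 0"
    using nz by blast
  then show ?thesis
  proof cases
    case i
    then have n: "J 0 \<noteq> 0" "J 1 \<noteq> 0" using p0 by auto
    consider "q > 0" | "q < 0" | "q = 0" by linarith
    then show ?thesis
    proof cases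
      case 1
      then have "L 1 < L 0" "L 2 < L 1" "L 3 < L 1" using i D lts(2) q0 by auto
      then have "gap L {0} {1} (L 0) (L 0 - L 1)"
        by (intro gapI[where n = 2] le) (auto dest: lt2)
      then show ?thesis using i 1 n by (intro exI4[of _ "{0}" "{1}" "L 0" "L 0 - L 1"]) simp
    next
      case 2
      have "J 3 \<noteq> 0" using 2 same(3) q0 by force
      then have "L 2 < L 0" "L 1 < L 2" "L 3 < L 2" "L 4 < L 2" using i 2 n D lts(1,3) les by auto
      then have "gap L {0} {2} (L 0) (L 0 - L 2)"
        by (intro gapI[where n = 3] le) (auto dest: lt3)
      then show ?thesis using i 2 n by (intro exI4[of _ "{0}" "{2}" "L 0" "L 0 - L 2"]) simp
    next
      case 3
      \<comment> \<open>A zero of J 2 merges L 1, L 2 and L 3. The recurrence then makes J 3 and J 4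
        nonzero, so both parities drop strictly afterwards.\<close>
      then have 2: "J 2 = 0" using n by (simp add: pq)
      have 33: "J 3 \<noteq> 0" using next_nz'[of 1, unfolded nums] 2 n by simp
      have 4: "J 4 \<noteq> 0" using next_nz[of 2, unfolded nums] 2 33 by simp
      have e: "L 2 = L 1" "L 3 = L 1" using D 3 2 by (auto simp: pq(3))
      moreover have "L 1 < L 0" "L 4 < L 1" "L 5 < L 1" using i D lts(3,4) 33 4 e by auto
      ultimately have "gap L {0} {1, 2, 3} (L 0) (L 0 - L 1)"
        by (intro gapI[where n = 4] le) (auto dest: lt4)
      then show ?thesis using i 3 n e by (intro exI4[of _ "{0}" "{1, 2, 3}" "L 0" "L 0 - L 1"]) simp
    qed
  next
    case ii
    then have n: "J 0 \<noteq> 0" "J 1 \<noteq> 0" using p0 by auto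
    define JJ where "JJ = p + q + r"
    \<comment> \<open>The sum of the three products telescopes: it compares the only two candidates
      for second place after L 1.\<close>
    have JJ: "JJ = L 0 - L 3" using D by (simp add: JJ_def)
    have J2: "J 2 \<noteq> 0"
    proof
      assume "J 2 = 0"
      then have "J 0 * J 1 > 0" using same0 n by simp
      with ii show False by (simp add: pq)
    qed
    \<comment> \<open>If J 4 were 0, then r > 0, that is L 3 < L 2; with L 2 < L 0 this contradicts
      L 0 <= L 3. Thus L 5 < L 3 strictly whenever index 3 belongs to T.\<close>
    have J4: "J 4 \<noteq> 0" if "JJ \<le> 0"
    proof
      assume 0: "J 4 = 0"
      have "J 3 \<noteq> 0"
      proof
        assume "J 3 = 0"
        then show False using next_nz'[of 2, unfolded nums] 0 J2 by simp
      qed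
      then have "r > 0" using same(1) 0 by simp
      then show False using that JJ D lts(1) n by linarith
    qed
    have l: "L 0 < L 1" "L 2 < L 0" "L 3 < L 1" "L 4 \<le> L 2" using ii D lts(1,2) les n J2 by auto
    consider "JJ > 0" | "JJ < 0" | "JJ = 0" by linarith
    then show ?thesis
    proof cases
      case 1
      then have "L 3 < L 0" using JJ by simp
      with l have "gap L {1} {0} (L 1) (L 1 - L 0)"
        by (intro gapI[where n = 2] le) (auto dest: lt2)
      then show ?thesis using ii 1 n JJ_def by (intro exI4[of _ "{1}" "{0}" "L 1" "L 1 - L 0"]) simp
    next
      case 2
      then have "L 0 < L 3" "L 5 < L 3" using JJ J4 lts(4) by auto
      with l have "gap L {1} {3} (L 1) (L 1 - L 3)"
        by (intro gapI[where n = 4] le) (auto dest: lt4)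
      then show ?thesis using ii 2 n JJ_def by (intro exI4[of _ "{1}" "{3}" "L 1" "L 1 - L 3"]) simp
    next
      case 3
      then have e: "L 3 = L 0" "L 5 < L 0" using JJ J4 lts(4) by auto
      with l have "gap L {1} {0, 3} (L 1) (L 1 - L 0)"
        by (intro gapI[where n = 4] le) (auto dest: lt4)
      then show ?thesis using ii 3 n e JJ_def by (intro exI4[of _ "{1}" "{0, 3}" "L 1" "L 1 - L 0"]) simp
    qed
  next
    case iii
    have J2: "J 2 \<noteq> 0" using next_nz[of 0, unfolded nums] iii by simp
    have l: "L 1 = L 0" "L 2 < L 0" "L 3 < L 0"
    proof -
      show e: "L 1 = L 0" using D iii by simp
      show "L 3 < L 0" using lts(2) J2 e by simp
      have "q > 0"
      proof -
        have "J 2 = c 0 * J 1" using R[of 0, unfolded nums] iii by simp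
        then have "q = c 0 * (J 1)\<^sup>2" by (simp add: pq power2_eq_square)
        then show ?thesis using c[of 0] iii by simp
      qed
      then show "L 2 < L 0" using D e by linarith
    qed
    have "r = 0 \<Longrightarrow> J 3 = 0" using J2 by (simp add: pq)
    then consider "r > 0" | "r < 0" | "r = 0" "J 3 = 0" by linarith
    then show ?thesis
    proof cases
      case 1
      then have "L 3 < L 2" "L 4 < L 2" using D lts(3) r0 by auto
      with l have "gap L {0, 1} {2} (L 0) (L 0 - L 2)"
        by (intro gapI[where n = 3] le) (auto dest: lt3)
      then show ?thesis using iii 1 by (intro exI4[of _ "{0, 1}" "{2}" "L 0" "L 0 - L 2"]) simp
    next
      case 2
      then have "J 4 \<noteq> 0" using same(1) r0 by force
      then have "L 2 < L 3" "L 4 < L 3" "L 5 < L 3" using 2 D lts(4) les by auto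
      with l have "gap L {0, 1} {3} (L 0) (L 0 - L 3)"
        by (intro gapI[where n = 4] le) (auto dest: lt4)
      then show ?thesis using iii 2 by (intro exI4[of _ "{0, 1}" "{3}" "L 0" "L 0 - L 3"]) simp
    next
      case 3
      have J4: "J 4 \<noteq> 0" using next_nz'[of 2, unfolded nums] 3 J2 by simp
      have J5: "J 5 \<noteq> 0" using next_nz[of 3, unfolded nums] 3 J4 by simp
      have e: "L 3 = L 2" "L 4 = L 2" using D 3 p00(5) by auto
      then have "L 5 < L 2" "L 6 < L 2" using lts(4,5) J4 J5 by auto
      with l e have "gap L {0, 1} {2, 3, 4} (L 0) (L 0 - L 2)"
        by (intro gapI[where n = 5] le) (auto dest: lt5)
      then show ?thesis using iii 3 by (intro exI4[of _ "{0, 1}" "{2, 3, 4}" "L 0" "L 0 - L 2"]) simp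
    qed
  next
    case iv
    \<comment> \<open>Because J 1 = 0, L 0 = L 1 = L 2; the recurrence keeps J 2 and J 3 from
      vanishing, so L 3 and L 4 lie strictly below.\<close>
    have J2: "J 2 \<noteq> 0" using next_nz'[of 0, unfolded nums] iv by simp
    have J3: "J 3 \<noteq> 0" using next_nz[of 1, unfolded nums] iv J2 by simp
    have l: "L 1 = L 0" "L 2 = L 0" "L 3 < L 0" "L 4 < L 0"
      using D iv p00(3) lts(2,3) J2 J3 by auto
    have "s = 0 \<Longrightarrow> J 4 = 0" using J3 by (simp add: pq)
    then consider "s > 0" | "s < 0" | "s = 0" "J 4 = 0" by linarith
    then show ?thesis
    proof cases
      case 1
      then have "L 4 < L 3" "L 5 < L 3" using D lts(4) s0 by auto
      with l have "gap L {0, 1, 2} {3} (L 0) (L 0 - L 3)"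
        by (intro gapI[where n = 4] le) (auto dest: lt4)
      then show ?thesis using iv 1 by (intro exI4[of _ "{0, 1, 2}" "{3}" "L 0" "L 0 - L 3"]) simp
    next
      case 2
      then have "J 5 \<noteq> 0" using same(2) s0 by force
      then have "L 3 < L 4" "L 5 < L 4" "L 6 < L 4" using 2 D lts(5) les by auto
      with l have "gap L {0, 1, 2} {4} (L 0) (L 0 - L 4)"
        by (intro gapI[where n = 5] le) (auto dest: lt5)
      then show ?thesis using iv 2 by (intro exI4[of _ "{0, 1, 2}" "{4}" "L 0" "L 0 - L 4"]) simp
    next
      case 3
      have J5: "J 5 \<noteq> 0" using next_nz'[of 3, unfolded nums] 3 J3 by simp
      have J6: "J 6 \<noteq> 0" using next_nz[of 4, unfolded nums] 3 J5 by simp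
      have e: "L 4 = L 3" "L 5 = L 3" using D'(4,5) 3 by auto
      then have "L 6 < L 3" "L 7 < L 3" using lts(5,6) J5 J6 by auto
      with l e have "gap L {0, 1, 2} {3, 4, 5} (L 0) (L 0 - L 3)"
        by (intro gapI[where n = 6] le) (auto dest: lt6)
      then show ?thesis using iv 3 by (intro exI4[of _ "{0, 1, 2}" "{3, 4, 5}" "L 0" "L 0 - L 3"]) simp
    qed
  qed
qed

theorem theorem2:
  fixes \<rho> :: real
  assumes "DIM('a::euclidean_space) \<ge> 2" and "\<rho> > 0"
  shows "\<exists>(S::real) (E::('a \<Rightarrow> complex) set).
    S > 0
    \<and> (\<forall>f::'a \<Rightarrow> complex. L2S f \<longrightarrow>
          S * (L2dist f (Md \<rho>))\<^sup>2 \<le> deficit f \<rho>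
          \<and> deficit f \<rho> \<le> Cd \<rho> TYPE('a) * (L2dist f (Md \<rho>))\<^sup>2)
    \<and> (\<forall>S'. (\<forall>f::'a \<Rightarrow> complex. L2S f \<longrightarrow> S' * (L2dist f (Md \<rho>))\<^sup>2 \<le> deficit f \<rho>) \<longrightarrow> S' \<le> S)
    \<and> (\<forall>C'. (\<forall>f::'a \<Rightarrow> complex. L2S f \<longrightarrow> deficit f \<rho> \<le> C' * (L2dist f (Md \<rho>))\<^sup>2)
           \<longrightarrow> Cd \<rho> TYPE('a) \<le> C')
    \<and> (\<forall>f::'a \<Rightarrow> complex. L2S f \<longrightarrow>
          deficit f \<rho> = Cd \<rho> TYPE('a) * (L2dist f (Md \<rho>))\<^sup>2 \<longrightarrow> in_L2 f (Md \<rho>))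
    \<and> (\<forall>f::'a \<Rightarrow> complex. L2S f \<longrightarrow>
          (S * (L2dist f (Md \<rho>))\<^sup>2 = deficit f \<rho> \<longleftrightarrow> in_L2 f (Md \<rho> \<oplus>\<^sub>S E)))
    \<and> (Jn DIM('a) 0 \<rho> * Jn DIM('a) 1 \<rho> > 0 \<longrightarrow>
          (Jn DIM('a) 1 \<rho> * Jn DIM('a) 2 \<rho> > 0 \<longrightarrow>
             S = Lambda DIM('a) 0 \<rho> - Lambda DIM('a) 1 \<rho> \<and> E = SH 1)
        \<and> (Jn DIM('a) 1 \<rho> * Jn DIM('a) 2 \<rho> < 0 \<longrightarrow>
             S = Lambda DIM('a) 0 \<rho> - Lambda DIM('a) 2 \<rho> \<and> E = SH 2)
        \<and> (Jn DIM('a) 1 \<rho> * Jn DIM('a) 2 \<rho> = 0 \<longrightarrow>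
             S = Lambda DIM('a) 0 \<rho> - Lambda DIM('a) 1 \<rho>
             \<and> S = Lambda DIM('a) 0 \<rho> - Lambda DIM('a) 2 \<rho>
             \<and> E = SH 1 \<oplus>\<^sub>S SH 2 \<oplus>\<^sub>S SH 3))
    \<and> (Jn DIM('a) 0 \<rho> * Jn DIM('a) 1 \<rho> < 0 \<longrightarrow>
          (let JJ = Jn DIM('a) 0 \<rho> * Jn DIM('a) 1 \<rho> + Jn DIM('a) 1 \<rho> * Jn DIM('a) 2 \<rho>
                    + Jn DIM('a) 2 \<rho> * Jn DIM('a) 3 \<rho> in
           (JJ > 0 \<longrightarrow> S = Lambda DIM('a) 1 \<rho> - Lambda DIM('a) 0 \<rho> \<and> E = SH 0)
         \<and> (JJ < 0 \<longrightarrow> S = Lambda DIM('a) 1 \<rho> - Lambda DIM('a) 3 \<rho> \<and> E = SH 3)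
         \<and> (JJ = 0 \<longrightarrow> S = Lambda DIM('a) 1 \<rho> - Lambda DIM('a) 0 \<rho>
                      \<and> S = Lambda DIM('a) 1 \<rho> - Lambda DIM('a) 3 \<rho>
                      \<and> E = SH 0 \<oplus>\<^sub>S SH 3)))
    \<and> (Jn DIM('a) 0 \<rho> = 0 \<longrightarrow>
          (Jn DIM('a) 2 \<rho> * Jn DIM('a) 3 \<rho> > 0 \<longrightarrow>
             S = Lambda DIM('a) 0 \<rho> - Lambda DIM('a) 2 \<rho> \<and> E = SH 2)
        \<and> (Jn DIM('a) 2 \<rho> * Jn DIM('a) 3 \<rho> < 0 \<longrightarrow>
             S = Lambda DIM('a) 0 \<rho> - Lambda DIM('a) 3 \<rho> \<and> E = SH 3))
    \<and> (Jn DIM('a) 1 \<rho> = 0 \<longrightarrow>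
          (Jn DIM('a) 3 \<rho> * Jn DIM('a) 4 \<rho> > 0 \<longrightarrow>
             S = Lambda DIM('a) 0 \<rho> - Lambda DIM('a) 3 \<rho> \<and> E = SH 3)
        \<and> (Jn DIM('a) 3 \<rho> * Jn DIM('a) 4 \<rho> < 0 \<longrightarrow>
             S = Lambda DIM('a) 0 \<rho> - Lambda DIM('a) 4 \<rho> \<and> E = SH 4))"
proof -
  let ?d = "DIM('a)"
  note d = assms(1) and \<rho> = assms(2)
  \<comment> \<open>\<open>Jn\<close> takes a real shift of the order; the combinatorial lemma wants
    a sequence over nat.\<close>
  define J where "J = (\<lambda>k::nat. Jn ?d k \<rho>)"
  define L where "L = (\<lambda>k. Lambda ?d k \<rho>)"
  \<comment> \<open>Coefficient of the three-term recurrence, positive because nu >= 0 for d >=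
    2.\<close>
  define c where "c = (\<lambda>k::nat. 2 * (bessel_nu ?d + k + 1) / \<rho>)"
  have J: "Jn ?d 0 \<rho> = J 0" "Jn ?d 1 \<rho> = J 1" "Jn ?d 2 \<rho> = J 2" "Jn ?d 3 \<rho> = J 3" "Jn ?d 4 \<rho> = J 4"
    by (simp_all add: J_def)
  have L: "Lambda ?d k \<rho> = L k" for k by (simp add: L_def)
  have 1: "c k > 0" for k using d \<rho> by (simp add: c_def bessel_nu_def)
  have 2: "J (k + 2) = c k * J (k + 1) - J k" for k
    using Jn_rec[OF \<rho>, of ?d k] by (simp add: J_def c_def add.commute)
  have 3: "L k - L (k + 1) = J k * J (k + 1)" for k
    using Lambda_diff1[OF \<rho>, of ?d k] by (simp add: J_def L_def add.commute)
  have 4: "J 0 \<noteq> 0 \<or> J 1 \<noteq> 0"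
    using Jn_no_common_zero[OF \<rho>, of ?d 0] d by (simp add: J_def)
  \<comment> \<open>Taking \<open>HS\<close> for the map h of \<open>spectral_cases\<close> makes
    the cases speak of the subspace \<open>HS T\<close>, the witness for E.\<close>
  let ?HS = "HS :: nat set \<Rightarrow> ('a \<Rightarrow> complex) set"
  obtain M T C S where G: "gap L M T C S"
    and M: "M = (if J 0 * J 1 > 0 then {0} else if J 0 * J 1 < 0 then {1} else if J 0 = 0 then {0, 1} else {0, 1, 2})"
    and i: "J 0 * J 1 > 0 \<longrightarrow>
         (J 1 * J 2 > 0 \<longrightarrow> S = L 0 - L 1 \<and> ?HS T = ?HS {1})
       \<and> (J 1 * J 2 < 0 \<longrightarrow> S = L 0 - L 2 \<and> ?HS T = ?HS {2})
       \<and> (J 1 * J 2 = 0 \<longrightarrow> S = L 0 - L 1 \<and> S = L 0 - L 2 \<and> ?HS T = ?HS {1, 2, 3})"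
    and ii: "J 0 * J 1 < 0 \<longrightarrow>
         (J 0 * J 1 + J 1 * J 2 + J 2 * J 3 > 0 \<longrightarrow> S = L 1 - L 0 \<and> ?HS T = ?HS {0})
       \<and> (J 0 * J 1 + J 1 * J 2 + J 2 * J 3 < 0 \<longrightarrow> S = L 1 - L 3 \<and> ?HS T = ?HS {3})
       \<and> (J 0 * J 1 + J 1 * J 2 + J 2 * J 3 = 0 \<longrightarrow> S = L 1 - L 0 \<and> S = L 1 - L 3 \<and> ?HS T = ?HS {0, 3})"
    and iii: "J 0 = 0 \<longrightarrow>
         (J 2 * J 3 > 0 \<longrightarrow> S = L 0 - L 2 \<and> ?HS T = ?HS {2})
       \<and> (J 2 * J 3 < 0 \<longrightarrow> S = L 0 - L 3 \<and> ?HS T = ?HS {3})"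
    and iv: "J 1 = 0 \<longrightarrow>
         (J 3 * J 4 > 0 \<longrightarrow> S = L 0 - L 3 \<and> ?HS T = ?HS {3})
       \<and> (J 3 * J 4 < 0 \<longrightarrow> S = L 0 - L 4 \<and> ?HS T = ?HS {4})"
    using spectral_cases[OF 1 2 3 4 refl refl refl refl, of ?HS] by (elim exE conjE) (rule that)
  have Md: "Md \<rho> = (HS M :: ('a \<Rightarrow> complex) set)"
    unfolding Md_def Let_def J M by (simp add: HS_singleton HS_2 HS_3)
  note gap = spectral_gap[OF d \<rho> G[unfolded L_def], folded Md]
  have S: "S > 0" using G by (simp add: gap_def)
  have SH: "(SH 1 :: ('a \<Rightarrow> complex) set) \<oplus>\<^sub>S SH 2 \<oplus>\<^sub>S SH 3 = HS {1, 2, 3}"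
     "(SH 0 :: ('a \<Rightarrow> complex) set) \<oplus>\<^sub>S SH 3 = HS {0, 3}" "\<And>k. (SH k :: ('a \<Rightarrow> complex) set) = HS {k}"
    by (simp_all add: HS_2 HS_3) (simp add: HS_singleton)
  show ?thesis
    unfolding J L Let_def SH(1,2) unfolding SH(3)
    by (rule exI[of _ S], rule exI[of _ "HS T"], intro conjI S gap i ii iii iv)
qed

end
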